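(* Let $n \geq 3$, let $D$ be a bounded domain in $\mathbb{R}^n$, and let $0 < \alpha \leq 1$. If $f : \overline D \rightarrow \mathbb{R}^n$ is continuous on $\overline D$, Hölder continuous with exponent $\alpha$ on $\partial D$, and harmonic and quasiconformal in $D$, and if $\partial D$ is uniformly perfect, then $f$ is Hölder continuous with exponent $\alpha$ on $\overline D$.
   Context: Hölder continuity: $f$ is Hölder continuous with exponent $\alpha$ on a set $A$ if there is a constant $C$ such that $|f(x)-f(y)| \le C|x-y|^\alpha$ for all $x,y\in A$. Harmonic: a mapping $f=(f_1,\dots,f_n)$ is harmonic in $D$ if each coordinate function $f_i$ is harmonic in $D$. Quasiconformal: $f$ is quasiconformal in $D$ if $f|_D$ is a homeomorphism onto a domain $f(D)\subset\mathbb{R}^n$ and there is $K\ge 1$ such that $M(\Gamma)/K \le M(f\Gamma)\le K M(\Gamma)$ for every family $\Gamma$ of curves in $D$. Here $M(\Gamma)=\inf \int_{\mathbb{R}^n}\rho^n\,dV$ is the ($n$-)modulus of $\Gamma$, the infimum being over Borel functions $\rho:\mathbb{R}^n\to[0,\infty]$ with $\int_\gamma \rho\,ds\ge 1$ for every locally rectifiable $\gamma\in\Gamma$. Uniformly perfect: a ring is a domain $R\subset\overline{\mathbb{R}^n}=\mathbb{R}^n\cup\{\infty\}$ whose complement has exactly two components $C_0,C_1$. Its modulus is $\mathrm{mod}(R)=(\omega_{n-1}/M(\Gamma_R))^{1/(n-1)}$, where $\Gamma_R$ is the family of curves connecting $C_0$ to $C_1$ in $R$ and $\omega_{n-1}$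 is the surface area of the unit sphere in $\mathbb{R}^n$ ($\mathrm{mod}(R)=\infty$ if $M(\Gamma_R)=0$). A ring separates a set $K$ if both components of its complement intersect $K$. A compact set $K\subset\mathbb{R}^n$ consisting of at least two points is $a$-uniformly perfect ($a>0$) if there is no ring $R$ separating $K$ with $\mathrm{mod}(R)>a$. The set $K$ is uniformly perfect if it is $a$-uniformly perfect for some $a>0$. *)

theory Defs
  imports "HOL-Analysis.Analysis"
begin

definition holder_on :: "real \<Rightarrow> 'a::real_normed_vector set \<Rightarrow> ('a \<Rightarrow> 'b::real_normed_vector) \<Rightarrow> bool"
  where "holder_on \<alpha> A f \<longleftrightarrow>
    (\<exists>C. \<forall>x\<in>A. \<forall>y\<in>A. norm (f x - f y) \<le> C * norm (x - y) powr \<alpha>)"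

(* u is C^2 on the open set D with gradient g and Hessian H; the trace of H is the Laplacian of u. *)
definition harmonic_on :: "'a::euclidean_space set \<Rightarrow> ('a \<Rightarrow> real) \<Rightarrow> bool"
  where "harmonic_on D u \<longleftrightarrow>
    (\<exists>(g :: 'a \<Rightarrow> 'a) (H :: 'a \<Rightarrow> 'a \<Rightarrow>\<^sub>L 'a).
      continuous_on D H \<and>
      (\<forall>x\<in>D. (u has_derivative (\<lambda>h. g x \<bullet> h)) (at x) \<and>
             (g has_derivative blinfun_apply (H x)) (at x) \<and>
             (\<Sum>b\<in>Basis. blinfun_apply (H x) b \<bullet> b) = 0))"

definition harmonic_map_on :: "(real^'m) set \<Rightarrow> (real^'m \<Rightarrow> real^'n) \<Rightarrow> bool"
  where "harmonic_map_on D f \<longleftrightarrow> (\<forall>i. harmonic_on D (\<lambda>x. f x $ i))"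

(* A curve is a pair (I, \<gamma>): a nondegenerate interval I, open, half-open or closed, bounded or not,
   and a map \<gamma> that is continuous on I. Values of \<gamma> outside I are irrelevant. *)
type_synonym 'a curve = "real set \<times> (real \<Rightarrow> 'a)"

definition curve_in :: "'a::topological_space set \<Rightarrow> 'a curve \<Rightarrow> bool"
  where "curve_in D c \<longleftrightarrow>
    (case c of (I, \<gamma>) \<Rightarrow>
      is_interval I \<and> (\<exists>s\<in>I. \<exists>t\<in>I. s < t) \<and> continuous_on I \<gamma> \<and> \<gamma> ` I \<subseteq> D)"

(* Supremum of the lengths of inscribed polygons with vertices at s = p 0 \<le> ... \<le> p m = t. *)
definition curve_length :: "(real \<Rightarrow> 'a::metric_space) \<Rightarrow> real \<Rightarrow> real \<Rightarrow> ennreal"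
  where "curve_length \<gamma> s t =
    (SUP (m, p) \<in> {(m :: nat, p :: nat \<Rightarrow> real).
        p 0 = s \<and> p m = t \<and> (\<forall>i<m. p i \<le> p (Suc i))}.
      (\<Sum>i<m. ennreal (dist (\<gamma> (p i)) (\<gamma> (p (Suc i))))))"

definition locally_rectifiable :: "'a::metric_space curve \<Rightarrow> bool"
  where "locally_rectifiable c \<longleftrightarrow>
    (case c of (I, \<gamma>) \<Rightarrow> \<forall>s\<in>I. \<forall>t\<in>I. s \<le> t \<longrightarrow> curve_length \<gamma> s t < top)"

(* Parametrization of \<gamma> restricted to [s, t] by arc length. For a rectifiable restriction and
   0 \<le> u \<le> curve_length \<gamma> s t the point is unique: \<gamma> is constant wherever the length function is. *)
definition arc_length_param :: "(real \<Rightarrow> 'a::metric_space) \<Rightarrow> real \<Rightarrow> real \<Rightarrow> real \<Rightarrow> 'a"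
  where "arc_length_param \<gamma> s t u =
    (THE x. \<exists>\<tau>\<in>{s..t}. curve_length \<gamma> s \<tau> = ennreal u \<and> x = \<gamma> \<tau>)"

(* Integral of \<rho> with respect to arc length over a locally rectifiable curve: the supremum of the
   integrals over its compact subcurves. *)
definition line_integral :: "('a::metric_space \<Rightarrow> ennreal) \<Rightarrow> 'a curve \<Rightarrow> ennreal"
  where "line_integral \<rho> c =
    (case c of (I, \<gamma>) \<Rightarrow>
      SUP (s, t) \<in> {(s, t). s \<in> I \<and> t \<in> I \<and> s \<le> t}.
        \<integral>\<^sup>+u\<in>{0..enn2real (curve_length \<gamma> s t)}. \<rho> (arc_length_param \<gamma> s t u) \<partial>lborel)"

definition admissible :: "'a::euclidean_space curve set \<Rightarrow> ('a \<Rightarrow> ennreal) set"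
  where "admissible \<Gamma> =
    {\<rho> \<in> borel_measurable borel. \<forall>c\<in>\<Gamma>. locally_rectifiable c \<longrightarrow> 1 \<le> line_integral \<rho> c}"

definition curve_modulus :: "'a::euclidean_space curve set \<Rightarrow> ennreal"
  where "curve_modulus \<Gamma> = (INF \<rho>\<in>admissible \<Gamma>. \<integral>\<^sup>+x. \<rho> x ^ DIM('a) \<partial>lborel)"

definition image_family :: "('a \<Rightarrow> 'b) \<Rightarrow> 'a curve set \<Rightarrow> 'b curve set"
  where "image_family f \<Gamma> = (\<lambda>(I, \<gamma>). (I, f \<circ> \<gamma>)) ` \<Gamma>"

definition quasiconformal_on :: "'a::euclidean_space set \<Rightarrow> ('a \<Rightarrow> 'a) \<Rightarrow> bool"
  where "quasiconformal_on D f \<longleftrightarrow>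
    (\<exists>g. homeomorphism D (f ` D) f g) \<and> open (f ` D) \<and> connected (f ` D) \<and>
    (\<exists>K::real. K \<ge> 1 \<and>
      (\<forall>\<Gamma>. (\<forall>c\<in>\<Gamma>. curve_in D c) \<longrightarrow>
         curve_modulus \<Gamma> / ennreal K \<le> curve_modulus (image_family f \<Gamma>) \<and>
         curve_modulus (image_family f \<Gamma>) \<le> ennreal K * curve_modulus \<Gamma>))"

(* The extended space: None is the point at infinity. *)
abbreviation extended_space :: "'a::euclidean_space option topology"
  where "extended_space \<equiv> Alexandroff_compactification euclidean"

definition complement_components :: "'a::euclidean_space option set \<Rightarrow> 'a option set set"
  where "complement_components R =
    connected_components_of (subtopology extended_space (- R))"

definition is_ring :: "'a::euclidean_space option set \<Rightarrow> bool"
  where "is_ring R \<longleftrightarrow>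
    openin extended_space R \<and> connectedin extended_space R \<and> R \<noteq> {} \<and>
    card (complement_components R) = 2"

(* Closed curves with interior in R and end points in the two different complementary components.
   Curves through infinity are left out: they are not locally rectifiable, so they impose no
   condition on admissible functions and do not affect the modulus of the family. *)
definition ring_curves :: "'a::euclidean_space option set \<Rightarrow> 'a curve set"
  where "ring_curves R =
    {({s..t}, \<gamma>) | s t \<gamma>. s < t \<and> continuous_on {s..t} \<gamma> \<and>
       (\<forall>\<tau>\<in>{s<..<t}. Some (\<gamma> \<tau>) \<in> R) \<and>
       (\<exists>C\<in>complement_components R. \<exists>C'\<in>complement_components R.
          C \<noteq> C' \<and> Some (\<gamma> s) \<in> C \<and> Some (\<gamma> t) \<in> C')}"

(* Surface area of the unit sphere of 'a: the volume of a ball of radius r is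
   unit_ball_vol n * r ^ n, and its derivative at r = 1 is the area. *)
definition sphere_area :: "'a::euclidean_space itself \<Rightarrow> real"
  where "sphere_area _ = real DIM('a) * unit_ball_vol (real DIM('a))"

definition ring_mod :: "'a::euclidean_space option set \<Rightarrow> ennreal"
  where "ring_mod R =
    (let M = curve_modulus (ring_curves R) in
     if M = 0 then top
     else ennreal ((sphere_area TYPE('a) / enn2real M) powr (1 / (real DIM('a) - 1))))"

(* A ring separates K only if it does not meet K; without this clause the complement of any two
   points of K would separate K, and no set would be uniformly perfect. *)
definition ring_separates :: "'a::euclidean_space option set \<Rightarrow> 'a set \<Rightarrow> bool"
  where "ring_separates R K \<longleftrightarrow>
    R \<inter> Some ` K = {} \<and> (\<forall>C\<in>complement_components R. C \<inter> Some ` K \<noteq> {})"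

definition uniformly_perfect_with :: "real \<Rightarrow> 'a::euclidean_space set \<Rightarrow> bool"
  where "uniformly_perfect_with a K \<longleftrightarrow>
    a > 0 \<and> compact K \<and> (\<exists>x\<in>K. \<exists>y\<in>K. x \<noteq> y) \<and>
    \<not> (\<exists>R. is_ring R \<and> ring_separates R K \<and> ring_mod R > ennreal a)"

definition uniformly_perfect :: "'a::euclidean_space set \<Rightarrow> bool"
  where "uniformly_perfect K \<longleftrightarrow> (\<exists>a. uniformly_perfect_with a K)"

end

(*
  Let x be a point of D, x0 a nearest boundary point, d = |x - x0|, w0 = f(x0) and R = |f(x) - w0|.
  The crux is R <= C d^alpha; it uses only quasiconformality. On the boundary within distance k d of
  x0 the values of f stay within rho = L (k d)^alpha of w0. If R > 2 rho, consider the curves on the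
  spheres S(w0,t), R/2 < t < R, that start on the image of the segment [x,x0]. If every such sphere
  left f(D \<inter> B(x0,kd)), then the lifts of these curves would run from B(x0,d) to distance about k d
  (they cannot end on the boundary near x0, where f has the wrong values), so their modulus would be
  at most of order (log k)^(1-n), while the modulus of the curves themselves is bounded below. So for
  a large constant k some sphere S(w0,t) lies in f(D \<inter> B(x0,kd)). By Jordan-Brouwer its preimage encloses
  the preimage of its interior, the whole shell rho < |w - w0| < t lies in f(D), and the preimages of
  subshells are rings that separate the boundary of D. Their moduli are comparable to those of the
  round shells, so uniform perfectness bounds t / rho, hence R / rho.

  Harmonicity enters only through the gradient estimate |Df| <= C d^(alpha-1), which follows from the
  first part and upgrades it to Hoelder continuity on the closure.
*)
theory Submission
  imports Defs
begin

section \<open>Arc length and line integrals\<close>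

text \<open>Admissibility tests all locally rectifiable curves through an arc length parametrization
  given by a definite description, whereas images and lifts of curves under \<open>f\<close> and
  \<open>g\<close> are merely continuous. Two estimates bridge this gap. A curve that crosses
  \<open>N\<close> dyadic shells collects a fixed share of a step density in each, which bounds
  moduli from above. The line integral over a Lipschitz path is at most the Lipschitz constant times
  the parameter integral; this suffices for lower bounds, where the curves may be chosen: explicit
  paths on spheres, averaged over intermediate points. Both bounds are scale invariant, so the
  numbers \<open>N\<close> and \<open>N'\<close> of shells depend only on the dimension,
  \<open>K\<close> and the constant of uniform perfectness. The obstacle is that nothing is known
  about the shape of the image. The substitute is a dichotomy: a limit of image points whose
  preimages stay near x0 is either an image point or close to w0. It decides where lifts can end,
  and it puts whole shells and exteriors into the image.\<close>

abbreviation polygon_length :: "(real \<Rightarrow> 'a::metric_space) \<Rightarrow> nat \<Rightarrow> (nat \<Rightarrow> real) \<Rightarrow> real"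
  where "polygon_length \<gamma> m p \<equiv> (\<Sum>i<m. dist (\<gamma> (p i)) (\<gamma> (p (Suc i))))"

definition subdivision :: "real \<Rightarrow> real \<Rightarrow> nat \<Rightarrow> (nat \<Rightarrow> real) \<Rightarrow> bool"
  where "subdivision s t m p \<longleftrightarrow> p 0 = s \<and> p m = t \<and> (\<forall>i<m. p i \<le> p (Suc i))"

lemma curve_length_eq_SUP:
  "curve_length \<gamma> s t = (SUP (m, p) \<in> {(m, p). subdivision s t m p}. ennreal (polygon_length \<gamma> m p))"
  unfolding curve_length_def subdivision_def
  by (intro arg_cong[where f=Sup] image_cong refl) (auto simp: sum_ennreal)

lemma polygon_length_le_curve_length:
  "subdivision s t m p \<Longrightarrow> ennreal (polygon_length \<gamma> m p) \<le> curve_length \<gamma> s t"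
  unfolding curve_length_eq_SUP by (rule SUP_upper2[of "(m, p)"]) auto

lemma curve_length_leI:
  assumes "\<And>m p. subdivision s t m p \<Longrightarrow> ennreal (polygon_length \<gamma> m p) \<le> c"
  shows "curve_length \<gamma> s t \<le> c"
  unfolding curve_length_eq_SUP using assms by (auto intro!: SUP_least)

lemma subdivision_mono:
  assumes "subdivision s t m p" "i \<le> j" "j \<le> m"
  shows "p i \<le> p j"
  using assms(2,3)
proof (induction rule: dec_induct)
  case (step n)
  then show ?case using assms(1) unfolding subdivision_def by (meson Suc_le_lessD order.trans less_imp_le_nat)
qed auto

lemma subdivision_bounds:
  assumes "subdivision s t m p" "i \<le> m"
  shows "s \<le> p i" "p i \<le> t"
  using subdivision_mono[OF assms(1), of 0 i] subdivision_mono[OF assms(1), of i m] assms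
  by (auto simp: subdivision_def)

lemma dist_le_curve_length:
  assumes "s \<le> t"
  shows "ennreal (dist (\<gamma> s) (\<gamma> t)) \<le> curve_length \<gamma> s t"
  using polygon_length_le_curve_length[of s t 1 "\<lambda>i. if i = 0 then s else t" \<gamma>] assms
  by (simp add: subdivision_def)

lemma curve_length_superadditive:
  assumes "s \<le> t" "t \<le> u"
  shows "curve_length \<gamma> s t + curve_length \<gamma> t u \<le> curve_length \<gamma> s u"
proof -
  have *: "ennreal (polygon_length \<gamma> m p) + ennreal (polygon_length \<gamma> k q) \<le> curve_length \<gamma> s u"
    if p: "subdivision s t m p" and q: "subdivision t u k q" for m p k q
  proof -
    define r where "r i = (if i \<le> m then p i else q (i - m))" for i
    have sub: "subdivision s u (m + k) r"
      unfolding subdivision_def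
    proof (intro conjI allI impI)
      fix i assume i: "i < m + k"
      consider "i < m" | "i = m" | "m < i" by linarith
      then show "r i \<le> r (Suc i)"
        using p q i by cases (auto simp: r_def subdivision_def Suc_diff_le)
    qed (use p q in \<open>auto simp: r_def subdivision_def\<close>)
    have "polygon_length \<gamma> (m + k) r = polygon_length \<gamma> m p + polygon_length \<gamma> k q"
    proof -
      have "polygon_length \<gamma> (m + k) r
          = (\<Sum>i<m. dist (\<gamma> (r i)) (\<gamma> (r (Suc i)))) + (\<Sum>i<k. dist (\<gamma> (r (m + i))) (\<gamma> (r (Suc (m + i)))))"
        by (induction k) auto
      moreover have "(\<Sum>i<m. dist (\<gamma> (r i)) (\<gamma> (r (Suc i)))) = polygon_length \<gamma> m p"
        by (intro sum.cong) (auto simp: r_def)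
      moreover have "(\<Sum>i<k. dist (\<gamma> (r (m + i))) (\<gamma> (r (Suc (m + i))))) = polygon_length \<gamma> k q"
        using p q by (intro sum.cong) (auto simp: r_def subdivision_def)
      ultimately show ?thesis by simp
    qed
    then show ?thesis
      using polygon_length_le_curve_length[OF sub, of \<gamma>] by (simp add: sum_nonneg ennreal_plus)
  qed
  have "{(m, p). subdivision s t m p} \<noteq> {}" if "s \<le> t" for s t
  proof -
    have "(1, \<lambda>i. if i = 0 then s else t) \<in> {(m, p). subdivision s t m p}"
      using that by (auto simp: subdivision_def)
    then show ?thesis by blast
  qed
  note ne = this[OF assms(1)] this[OF assms(2)]
  have "ennreal (polygon_length \<gamma> m p) + curve_length \<gamma> t u \<le> curve_length \<gamma> s u"
    if p: "subdivision s t m p" for m p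
    unfolding curve_length_eq_SUP[of \<gamma> t u] ennreal_SUP_add_right[OF ne(2)]
    using *[OF p] by (auto intro!: SUP_least)
  then show ?thesis
    unfolding curve_length_eq_SUP[of \<gamma> s t] ennreal_SUP_add_left[OF ne(1), symmetric]
    by (auto intro!: SUP_least)
qed

text \<open>Clamping the vertices to each side of \<open>t\<close>, instead of inserting
  \<open>t\<close> as a vertex, keeps the number \<open>m\<close> of edges; repeated vertices add
  length 0. The smallness of length on short intervals relies on this fixed number.\<close>

lemma subdivision_cut:
  assumes "subdivision s u m p" "s \<le> t" "t \<le> u"
  shows "subdivision s t m (\<lambda>i. min (p i) t)" "subdivision t u m (\<lambda>i. max (p i) t)"
    "polygon_length \<gamma> m p \<le> polygon_length \<gamma> m (\<lambda>i. min (p i) t) + polygon_length \<gamma> m (\<lambda>i. max (p i) t)"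
proof -
  show "subdivision s t m (\<lambda>i. min (p i) t)" "subdivision t u m (\<lambda>i. max (p i) t)"
    using assms by (auto simp: subdivision_def min_def max_def intro: order.trans)
  have "dist (\<gamma> (p i)) (\<gamma> (p (Suc i))) \<le> dist (\<gamma> (min (p i) t)) (\<gamma> (min (p (Suc i)) t))
      + dist (\<gamma> (max (p i) t)) (\<gamma> (max (p (Suc i)) t))" if "i < m" for i
  proof -
    have "p i \<le> p (Suc i)" using assms(1) that by (auto simp: subdivision_def)
    then consider "p (Suc i) \<le> t" | "t \<le> p i" | "p i \<le> t" "t \<le> p (Suc i)" by linarith
    then show ?thesis using \<open>p i \<le> p (Suc i)\<close> by cases (auto simp: min_def max_def dist_triangle)
  qed
  then show "polygon_length \<gamma> m p \<le> polygon_length \<gamma> m (\<lambda>i. min (p i) t) + polygon_length \<gamma> m (\<lambda>i. max (p i) t)"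
    unfolding sum.distrib[symmetric] by (intro sum_mono) auto
qed

lemma curve_length_additive:
  assumes "s \<le> t" "t \<le> u"
  shows "curve_length \<gamma> s u = curve_length \<gamma> s t + curve_length \<gamma> t u"
proof (rule antisym[OF curve_length_leI curve_length_superadditive[OF assms]])
  fix m p assume p: "subdivision s u m p"
  note c = subdivision_cut[OF p assms]
  have "ennreal (polygon_length \<gamma> m p)
      \<le> ennreal (polygon_length \<gamma> m (\<lambda>i. min (p i) t)) + ennreal (polygon_length \<gamma> m (\<lambda>i. max (p i) t))"
    using c(3)[of \<gamma>] by (simp add: sum_nonneg flip: ennreal_plus)
  also have "\<dots> \<le> curve_length \<gamma> s t + curve_length \<gamma> t u"
    by (intro add_mono polygon_length_le_curve_length c)
  finally show "ennreal (polygon_length \<gamma> m p) \<le> curve_length \<gamma> s t + curve_length \<gamma> t u" .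
qed

lemma curve_length_mono:
  assumes "s' \<le> s" "s \<le> t" "t \<le> t'"
  shows "curve_length \<gamma> s t \<le> curve_length \<gamma> s' t'"
  using curve_length_additive[of s' s t' \<gamma>] curve_length_additive[of s t t' \<gamma>] assms
  by (simp add: add_increasing add_increasing2)

lemma curve_length_lipschitz:
  assumes "\<And>x y. s \<le> x \<Longrightarrow> x \<le> y \<Longrightarrow> y \<le> t \<Longrightarrow> dist (\<gamma> x) (\<gamma> y) \<le> \<Lambda> * (y - x)"
  shows "curve_length \<gamma> s t \<le> ennreal (\<Lambda> * (t - s))"
proof (rule curve_length_leI)
  fix m p assume p: "subdivision s t m p"
  have "polygon_length \<gamma> m p \<le> (\<Sum>i<m. \<Lambda> * (p (Suc i) - p i))"
    using subdivision_bounds[OF p] p by (intro sum_mono assms) (auto simp: subdivision_def)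
  also have "\<dots> = \<Lambda> * (t - s)"
    using p by (simp add: sum_distrib_left[symmetric] sum_lessThan_telescope subdivision_def)
  finally show "ennreal (polygon_length \<gamma> m p) \<le> ennreal (\<Lambda> * (t - s))" by (rule ennreal_leI)
qed

text \<open>
  A subdivision of nearly full length still has nearly full length inside every subinterval, and there
  its polygon has a bounded number of edges, each short by uniform continuity.
\<close>

lemma curve_length_uniformly_small:
  assumes cont: "continuous_on {a..b} \<gamma>" and fin: "curve_length \<gamma> a b < top" and "a \<le> b" "e > 0"
  shows "\<exists>d>0. \<forall>s t. a \<le> s \<longrightarrow> s \<le> t \<longrightarrow> t \<le> b \<longrightarrow> t - s < d \<longrightarrow> curve_length \<gamma> s t < ennreal e"
proof -
  define V where "V s t = enn2real (curve_length \<gamma> s t)" for s t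
  have fin': "curve_length \<gamma> s t < top" if "a \<le> s" "s \<le> t" "t \<le> b" for s t
    using curve_length_mono[of a s t b \<gamma>] that fin by (metis le_less_trans)
  have V: "curve_length \<gamma> s t = ennreal (V s t)" if "a \<le> s" "s \<le> t" "t \<le> b" for s t
    using fin'[OF that] by (simp add: V_def)
  obtain m p where p: "subdivision a b m p" and pl: "V a b - e / 2 < polygon_length \<gamma> m p"
  proof (rule ccontr)
    assume "\<not> thesis"
    then have le: "\<And>m p. subdivision a b m p \<Longrightarrow> polygon_length \<gamma> m p \<le> V a b - e / 2"
      using that by (meson not_le)
    then have "curve_length \<gamma> a b \<le> ennreal (V a b - e / 2)"
      by (intro curve_length_leI ennreal_leI)
    moreover have "0 \<le> V a b - e / 2"
      using le[of 1 "\<lambda>i. if i = 0 then a else b"] \<open>a \<le> b\<close>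
      by (intro order.trans[OF zero_le_dist[of "\<gamma> a" "\<gamma> b"]]) (simp add: subdivision_def)
    ultimately show False
      unfolding V[OF order_refl \<open>a \<le> b\<close> order_refl] using \<open>e > 0\<close> by (simp add: ennreal_le_iff)
  qed
  have "uniformly_continuous_on {a..b} \<gamma>"
    using cont by (intro compact_uniformly_continuous) auto
  then obtain d where d: "d > 0"
    "\<And>x y. x \<in> {a..b} \<Longrightarrow> y \<in> {a..b} \<Longrightarrow> dist x y < d \<Longrightarrow> dist (\<gamma> x) (\<gamma> y) < e / (2 * Suc m)"
    using \<open>e > 0\<close> unfolding uniformly_continuous_on_def by (metis divide_pos_pos mult_pos_pos of_nat_0_less_iff zero_less_Suc zero_less_numeral)
  have "curve_length \<gamma> s t < ennreal e" if st: "a \<le> s" "s \<le> t" "t \<le> b" "t - s < d" for s t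
  proof -
    note c1 = subdivision_cut[OF p st(1) order.trans[OF st(2,3)]]
    note c2 = subdivision_cut[OF c1(2) st(2,3)]
    define q where "q i = min (max (p i) s) t" for i
    have q: "subdivision s t m q" using c2(1) by (simp add: q_def[abs_def])
    have "polygon_length \<gamma> m q \<le> (\<Sum>i<m. e / (2 * Suc m))"
    proof (intro sum_mono less_imp_le d(2))
      fix i assume "i \<in> {..<m}"
      then have "s \<le> q i" "q i \<le> t" "s \<le> q (Suc i)" "q (Suc i) \<le> t"
        using subdivision_bounds[OF q, of i] subdivision_bounds[OF q, of "Suc i"] by auto
      then show "q i \<in> {a..b}" "q (Suc i) \<in> {a..b}" "dist (q i) (q (Suc i)) < d"
        using st by (auto simp: dist_real_def)
    qed
    also have "\<dots> = (e / 2) * (m / Suc m)" by simp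
    also have "\<dots> < e / 2" using \<open>e > 0\<close> by (simp add: field_simps)
    finally have ql: "polygon_length \<gamma> m q < e / 2" .
    have nn: "0 \<le> V x y" for x y by (simp add: V_def)
    have VV: "V a b = V a s + V s t + V t b"
    proof -
      have "ennreal (V a b) = ennreal (V a s) + ennreal (V s t) + ennreal (V t b)"
        using curve_length_additive[of a s b \<gamma>] curve_length_additive[of s t b \<gamma>] st
        by (simp add: V[symmetric] add.assoc)
      also have "\<dots> = ennreal (V a s + V s t + V t b)" by (simp add: V_def)
      finally have eq: "ennreal (V a b) = ennreal (V a s + V s t + V t b)" .
      show ?thesis using eq nn by (metis add_nonneg_nonneg ennreal_inj)
    qed
    have "polygon_length \<gamma> m (\<lambda>i. min (p i) s) \<le> V a s"
      using polygon_length_le_curve_length[OF c1(1), of \<gamma>] st V[of a s] nn by simp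
    moreover have "polygon_length \<gamma> m (\<lambda>i. max (max (p i) s) t) \<le> V t b"
      using polygon_length_le_curve_length[OF c2(2), of \<gamma>] st V[of t b] nn by simp
    ultimately have "V s t < e"
      using c1(3)[of \<gamma>] c2(3)[of \<gamma>] VV pl ql by (simp add: q_def)
    then show ?thesis using st \<open>e > 0\<close> by (simp add: V ennreal_lessI)
  qed
  with d(1) show ?thesis by blast
qed

lemma continuous_on_curve_length:
  assumes cont: "continuous_on {a..b} \<gamma>" and fin: "curve_length \<gamma> a b < top"
  shows "continuous_on {a..b} (\<lambda>\<tau>. enn2real (curve_length \<gamma> a \<tau>))"
proof (cases "a \<le> b")
  case True
  have *: "enn2real (curve_length \<gamma> a t) = enn2real (curve_length \<gamma> a s) + enn2real (curve_length \<gamma> s t)"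
    if "a \<le> s" "s \<le> t" "t \<le> b" for s t
    using that curve_length_mono[of a a s b \<gamma>] curve_length_mono[of a s t b \<gamma>] fin
    by (subst curve_length_additive[of a s t]) (auto intro!: enn2real_plus le_less_trans[OF _ fin])
  show ?thesis
    unfolding continuous_on_iff
  proof (intro ballI allI impI)
    fix x e :: real assume x: "x \<in> {a..b}" and "0 < e"
    obtain d where d: "d > 0"
      "\<And>s t. a \<le> s \<Longrightarrow> s \<le> t \<Longrightarrow> t \<le> b \<Longrightarrow> t - s < d \<Longrightarrow> curve_length \<gamma> s t < ennreal e"
      using curve_length_uniformly_small[OF cont fin True \<open>0 < e\<close>] by blast
    have d': "enn2real (curve_length \<gamma> s t) < e" if "a \<le> s" "s \<le> t" "t \<le> b" "t - s < d" for s t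
      using d(2)[OF that] \<open>0 < e\<close> by (subst enn2real_less_iff) (auto intro: less_trans[OF _ ennreal_less_top])
    have "dist (enn2real (curve_length \<gamma> a y)) (enn2real (curve_length \<gamma> a x)) < e"
      if y: "y \<in> {a..b}" "dist y x < d" for y
    proof (cases "x \<le> y")
      case True
      then show ?thesis using *[of x y] d'[of x y] x y by (auto simp: dist_real_def)
    next
      case False
      then show ?thesis using *[of y x] d'[of y x] x y by (auto simp: dist_real_def)
    qed
    then show "\<exists>d>0. \<forall>y\<in>{a..b}. dist y x < d \<longrightarrow>
        dist (enn2real (curve_length \<gamma> a y)) (enn2real (curve_length \<gamma> a x)) < e"
      using \<open>d > 0\<close> by blast
  qed
qed auto

section \<open>Lipschitz images and substitution on the line\<close>

text \<open>An open set around \<open>A\<close> of nearly the same measure splits into countably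
  many intervals, and \<open>h\<close> maps each into an interval at most \<Lambda> times as long.
  The Borel set \<open>B\<close> stands in for the image, which need not be Borel itself.\<close>

lemma emeasure_lipschitz_image_le:
  fixes h :: "real \<Rightarrow> real"
  assumes A[measurable]: "A \<in> sets borel" and "A \<subseteq> {a..b}"
    and B[measurable]: "B \<in> sets borel" and "B \<subseteq> h ` A"
    and lip: "\<And>x y. x \<in> {a..b} \<Longrightarrow> y \<in> {a..b} \<Longrightarrow> \<bar>h x - h y\<bar> \<le> \<Lambda> * \<bar>x - y\<bar>" and "0 \<le> \<Lambda>"
  shows "emeasure lborel B \<le> ennreal \<Lambda> * emeasure lborel A"
proof -
  have fin: "emeasure lborel A < \<infinity>"
    using emeasure_mono[of A "{a..b}" lborel] \<open>A \<subseteq> {a..b}\<close>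
    by (auto simp: emeasure_lborel_Icc_eq intro: le_less_trans)
  have main: "emeasure lborel B \<le> ennreal \<Lambda> * (emeasure lborel A + ennreal e)" if "e > 0" for e :: real
  proof -
    obtain U where U: "open U" "A \<subseteq> U" "emeasure lborel (U - A) < ennreal e"
      using outer_regular_lborel[of A e] \<open>e > 0\<close> by auto
    have [measurable]: "U \<in> sets borel" using U by auto
    have "emeasure lborel U = emeasure lborel (A \<union> (U - A))"
      using U(2) by (intro arg_cong[where f="emeasure lborel"]) auto
    also have "\<dots> \<le> emeasure lborel A + emeasure lborel (U - A)"
      by (rule emeasure_subadditive) auto
    also have "\<dots> \<le> emeasure lborel A + ennreal e" using U(3) by (intro add_mono) auto
    finally have Ule: "emeasure lborel U \<le> emeasure lborel A + ennreal e" .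
    also have "\<dots> < \<infinity>" using fin by simp
    finally have Ufin: "emeasure lborel U < \<infinity>" .
    define \<C> where "\<C> = components U"
    have opC: "open C" if "C \<in> \<C>" for C using that U(1) open_components \<C>_def by blast
    have disj: "pairwise disjnt \<C>" using pairwise_disjoint_components[of U] by (simp add: pairwise_def disjnt_def \<C>_def)
    have cnt: "countable \<C>"
      using countable_disjoint_open_subsets[of \<C>] opC disj by blast
    have UC: "\<Union>\<C> = U" unfolding \<C>_def by (rule Union_components)
    \<comment> \<open>An interval of the right length, started at the infimum of the values,
      replaces the image of a component and makes the cover Borel. If \<open>C\<close> misses
      \<open>{a..b}\<close> the infimum is unspecified, which is harmless: the interval only adds to
      the cover.\<close>
    define K where "K C = (let m = Inf (h ` (C \<inter> {a..b})) in {m..m + \<Lambda> * measure lborel C})" for C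
    have Cfin: "emeasure lborel C < \<infinity>" if "C \<in> \<C>" for C
      using emeasure_mono[of C U lborel] that UC Ufin opC[OF that]
      by (auto intro: le_less_trans)
    have K: "h ` (C \<inter> {a..b}) \<subseteq> K C" "emeasure lborel (K C) = ennreal \<Lambda> * emeasure lborel C"
      if C: "C \<in> \<C>" for C
    proof -
      have conn: "connected C" using C \<C>_def in_components_connected by blast
      have d: "\<bar>x - y\<bar> \<le> measure lborel C" if "x \<in> C" "y \<in> C" for x y
      proof -
        have sub: "{min x y..max x y} \<subseteq> C"
          using conn that by (intro connected_contains_Icc) (auto simp: min_def max_def)
        have "emeasure lborel {min x y..max x y} \<le> emeasure lborel C"
          using sub opC[OF C] by (intro emeasure_mono) auto
        then have "ennreal \<bar>x - y\<bar> \<le> ennreal (measure lborel C)"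
          using Cfin[OF C] by (simp add: emeasure_eq_ennreal_measure max_def min_def abs_if split: if_splits)
        then show ?thesis by (simp add: measure_nonneg)
      qed
      have hd: "h x - \<Lambda> * measure lborel C \<le> h y" if "x \<in> C \<inter> {a..b}" "y \<in> C \<inter> {a..b}" for x y
      proof -
        have "\<bar>h x - h y\<bar> \<le> \<Lambda> * \<bar>x - y\<bar>" using lip that by auto
        also have "\<dots> \<le> \<Lambda> * measure lborel C" using d that \<open>0 \<le> \<Lambda>\<close> by (intro mult_left_mono) auto
        finally show ?thesis by linarith
      qed
      show "h ` (C \<inter> {a..b}) \<subseteq> K C"
      proof
        fix v assume "v \<in> h ` (C \<inter> {a..b})"
        then obtain x where x: "x \<in> C \<inter> {a..b}" "v = h x" by blast
        have "bdd_below (h ` (C \<inter> {a..b}))" using hd[OF x(1)] by (intro bdd_belowI2)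
        then have "Inf (h ` (C \<inter> {a..b})) \<le> v" using x by (intro cInf_lower) auto
        moreover have "v - \<Lambda> * measure lborel C \<le> Inf (h ` (C \<inter> {a..b}))"
          using x hd[OF x(1)] by (intro cInf_greatest) auto
        ultimately show "v \<in> K C" by (simp add: K_def Let_def)
      qed
      show "emeasure lborel (K C) = ennreal \<Lambda> * emeasure lborel C"
        using \<open>0 \<le> \<Lambda>\<close> Cfin[OF C]
        by (simp add: K_def Let_def emeasure_eq_ennreal_measure measure_nonneg ennreal_mult)
    qed
    \<comment> \<open>The countable family becomes a sequence; indices that name no component get
      the empty set, so finite and infinite families are treated alike.\<close>
    define X where "X n = \<Union>{C \<in> \<C>. to_nat_on \<C> C = n}" for n
    define Y where "Y n = \<Union>{K C |C. C \<in> \<C> \<and> to_nat_on \<C> C = n}" for n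
    have cases: "(X n = {} \<and> Y n = {}) \<or> (\<exists>C\<in>\<C>. X n = C \<and> Y n = K C)" for n
    proof (cases "\<exists>C\<in>\<C>. to_nat_on \<C> C = n")
      case True
      then obtain C where C: "C \<in> \<C>" "to_nat_on \<C> C = n" by blast
      then have "C' = C" if "C' \<in> \<C>" "to_nat_on \<C> C' = n" for C'
        using that cnt by (metis inj_on_to_nat_on inj_onD)
      then have "{C \<in> \<C>. to_nat_on \<C> C = n} = {C}" "{K C |C. C \<in> \<C> \<and> to_nat_on \<C> C = n} = {K C}"
        using C by blast+
      then show ?thesis using C by (auto simp: X_def Y_def)
    next
      case False
      then show ?thesis by (auto simp: X_def Y_def)
    qed
    have KM: "K C \<in> sets borel" for C by (simp add: K_def Let_def)
    have XM: "X n \<in> sets borel" and YM: "Y n \<in> sets borel" for n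
      using cases[of n] opC KM by (auto intro: borel_open)
    have XY: "emeasure lborel (Y n) \<le> ennreal \<Lambda> * emeasure lborel (X n)" for n
      using cases[of n] K(2) by auto
    have "disjoint_family X"
      using disj cnt by (fastforce simp: disjoint_family_on_def X_def pairwise_def disjnt_def)
    moreover have "(\<Union>n. X n) = U" using UC by (auto simp: X_def)
    ultimately have sumX: "(\<Sum>n. emeasure lborel (X n)) = emeasure lborel U"
      using XM suminf_emeasure[of X lborel] by auto
    have "B \<subseteq> (\<Union>n. Y n)"
    proof
      fix v assume "v \<in> B"
      then obtain x where x: "x \<in> A" "v = h x" using \<open>B \<subseteq> h ` A\<close> by blast
      then obtain C where "C \<in> \<C>" "x \<in> C" using U(2) UC by blast
      then have "v \<in> K C" using K(1)[of C] x \<open>A \<subseteq> {a..b}\<close> by auto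
      then show "v \<in> (\<Union>n. Y n)" using \<open>C \<in> \<C>\<close> by (auto simp: Y_def)
    qed
    then have "emeasure lborel B \<le> emeasure lborel (\<Union>n. Y n)"
      using YM by (intro emeasure_mono) auto
    also have "\<dots> \<le> (\<Sum>n. emeasure lborel (Y n))"
      using YM by (intro emeasure_subadditive_countably) auto
    also have "\<dots> \<le> (\<Sum>n. ennreal \<Lambda> * emeasure lborel (X n))"
      by (intro suminf_le XY) auto
    also have "\<dots> = ennreal \<Lambda> * emeasure lborel U" by (simp add: sumX)
    also have "\<dots> \<le> ennreal \<Lambda> * (emeasure lborel A + ennreal e)" using Ule by (intro mult_left_mono) auto
    finally show ?thesis .
  qed
  obtain \<mu> where \<mu>: "emeasure lborel A = ennreal \<mu>" "0 \<le> \<mu>" using fin by (cases "emeasure lborel A") auto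
  show ?thesis
  proof (rule ennreal_le_epsilon)
    fix e :: real assume "0 < e"
    \<comment> \<open>Dividing by \<Lambda> + 1 instead of \<Lambda> allows \<Lambda> = 0.\<close>
    have "emeasure lborel B \<le> ennreal \<Lambda> * (emeasure lborel A + ennreal (e / (\<Lambda> + 1)))"
      using \<open>0 < e\<close> \<open>0 \<le> \<Lambda>\<close> by (intro main) auto
    also have "\<dots> = ennreal (\<Lambda> * \<mu> + \<Lambda> * e / (\<Lambda> + 1))"
      using \<mu> \<open>0 < e\<close> \<open>0 \<le> \<Lambda>\<close> by (simp add: ennreal_mult'[symmetric] distrib_left flip: ennreal_plus)
    also have "\<dots> \<le> ennreal (\<Lambda> * \<mu> + e)"
      using \<open>0 < e\<close> \<open>0 \<le> \<Lambda>\<close> by (intro ennreal_leI add_left_mono) (simp add: field_simps)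
    finally show "emeasure lborel B \<le> ennreal \<Lambda> * emeasure lborel A + ennreal e"
      using \<mu> \<open>0 < e\<close> \<open>0 \<le> \<Lambda>\<close> by (simp add: ennreal_mult' ennreal_plus)
  qed
qed

text \<open>On \<open>J\<close>, Lebesgue measure is at most \<Lambda> times the push-forward of
  Lebesgue measure on \<open>{a..b}\<close> under \<open>S\<close>, because a Borel part of
  \<open>J\<close> is covered by the image of its preimage. Comparing measures instead of
  differentiating \<open>S\<close> suits a length function, which may be constant on
  intervals.\<close>

lemma nn_integral_substitution_lipschitz_le:
  fixes S :: "real \<Rightarrow> real" and g :: "real \<Rightarrow> ennreal"
  assumes [measurable]: "g \<in> borel_measurable borel"
    and contS: "continuous_on {a..b} S" and lip: "\<And>x y. x \<in> {a..b} \<Longrightarrow> y \<in> {a..b} \<Longrightarrow> \<bar>S x - S y\<bar> \<le> \<Lambda> * \<bar>x - y\<bar>"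
    and "0 \<le> \<Lambda>" and J[measurable]: "J \<in> sets borel" and "J \<subseteq> S ` {a..b}"
  shows "(\<integral>\<^sup>+u\<in>J. g u \<partial>lborel) \<le> ennreal \<Lambda> * (\<integral>\<^sup>+s\<in>{a..b}. g (S s) \<partial>lborel)"
proof -
  define S' where "S' = restrict_space lborel {a..b}"
  have S[measurable]: "S \<in> S' \<rightarrow>\<^sub>M borel"
    using borel_measurable_continuous_on_restrict[OF contS]
    by (simp add: S'_def measurable_def space_restrict_space sets_restrict_space)
  define N where "N = scale_measure (ennreal \<Lambda>) (distr S' borel S)"
  define M where "M = density lborel (indicator J)"
  have sets: "sets M = sets N" by (simp add: M_def N_def)
  have "emeasure M B \<le> emeasure N B" if B[measurable]: "B \<in> sets borel" for B
  proof -
    have "emeasure M B = emeasure lborel (J \<inter> B)"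
    proof -
      have "emeasure M B = (\<integral>\<^sup>+x. indicator J x * indicator B x \<partial>lborel)"
        by (simp add: M_def emeasure_density)
      also have "\<dots> = (\<integral>\<^sup>+x. indicator (J \<inter> B) x \<partial>lborel)" by (simp add: indicator_inter_arith)
      finally show ?thesis by simp
    qed
    moreover have sp: "S -` B \<inter> space S' = S -` B \<inter> {a..b}" by (auto simp: S'_def space_restrict_space)
    have meas: "S -` B \<inter> {a..b} \<in> sets borel"
      using measurable_sets[OF S B] unfolding sp S'_def
      by (subst (asm) sets_restrict_space_iff) auto
    have "emeasure N B = ennreal \<Lambda> * emeasure lborel (S -` B \<inter> {a..b})"
      unfolding N_def by (simp add: emeasure_distr sp) (simp add: S'_def emeasure_restrict_space)
    moreover have "emeasure lborel (J \<inter> B) \<le> ennreal \<Lambda> * emeasure lborel (S -` B \<inter> {a..b})"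
      using \<open>J \<subseteq> S ` {a..b}\<close> lip \<open>0 \<le> \<Lambda>\<close> by (intro emeasure_lipschitz_image_le[where h=S] meas) auto
    ultimately show ?thesis by simp
  qed
  then have "M \<le> N" by (intro le_measure[THEN iffD2]) (auto simp: le_fun_def sets M_def N_def)
  have "(\<integral>\<^sup>+u\<in>J. g u \<partial>lborel) = nn_integral M g"
    by (simp add: M_def nn_integral_density mult.commute)
  also have "\<dots> \<le> nn_integral N g" by (rule nn_integral_mono_measure[OF sets \<open>M \<le> N\<close>])
  also have "\<dots> = ennreal \<Lambda> * (\<integral>\<^sup>+s. g (S s) \<partial>S')"
    by (simp add: N_def nn_integral_scale_measure nn_integral_distr)
  also have "(\<integral>\<^sup>+s. g (S s) \<partial>S') = (\<integral>\<^sup>+s\<in>{a..b}. g (S s) \<partial>lborel)"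
    unfolding S'_def by (simp add: nn_integral_restrict_space)
  finally show ?thesis .
qed

section \<open>Arc length parametrization\<close>

lemma arc_length_param_eq:
  assumes "curve_length \<gamma> a b < top" "\<tau> \<in> {a..b}"
  shows "arc_length_param \<gamma> a b (enn2real (curve_length \<gamma> a \<tau>)) = \<gamma> \<tau>"
proof -
  have fin: "curve_length \<gamma> a t < top" if "t \<in> {a..b}" for t
    using curve_length_mono[of a a t b \<gamma>] that assms(1) by (auto intro: le_less_trans)
  have *: "\<gamma> x = \<gamma> y" if "x \<in> {a..b}" "y \<in> {a..b}" "x \<le> y" "curve_length \<gamma> a x = curve_length \<gamma> a y" for x y
  proof -
    have "curve_length \<gamma> a x + 0 = curve_length \<gamma> a x + curve_length \<gamma> x y"
      using curve_length_additive[of a x y \<gamma>] that by simp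
    then have "curve_length \<gamma> x y = 0"
      using fin[OF that(1)] by (metis ennreal_add_left_cancel less_irrefl top.not_eq_extremum infinity_ennreal_def)
    then show ?thesis using dist_le_curve_length[OF that(3), of \<gamma>] by (simp add: ennreal_eq_0_iff)
  qed
  have eq: "ennreal (enn2real (curve_length \<gamma> a \<tau>)) = curve_length \<gamma> a \<tau>"
    using fin[OF assms(2)] by simp
  show ?thesis
    unfolding arc_length_param_def eq
  proof (rule the_equality)
    show "\<exists>\<tau>'\<in>{a..b}. curve_length \<gamma> a \<tau>' = curve_length \<gamma> a \<tau> \<and> \<gamma> \<tau> = \<gamma> \<tau>'"
      using assms(2) by blast
  next
    fix x assume "\<exists>\<tau>'\<in>{a..b}. curve_length \<gamma> a \<tau>' = curve_length \<gamma> a \<tau> \<and> x = \<gamma> \<tau>'"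
    then obtain \<tau>' where \<tau>': "\<tau>' \<in> {a..b}" "curve_length \<gamma> a \<tau>' = curve_length \<gamma> a \<tau>" "x = \<gamma> \<tau>'" by blast
    have "\<gamma> \<tau>' = \<gamma> \<tau>"
      using *[OF \<tau>'(1) assms(2) _ \<tau>'(2)] *[OF assms(2) \<tau>'(1) _ \<tau>'(2)[symmetric]] by (metis linear)
    then show "x = \<gamma> \<tau>" using \<tau>'(3) by simp
  qed
qed

lemma arc_length_exists:
  assumes "continuous_on {a..b} \<gamma>" "curve_length \<gamma> a b < top" "a \<le> b"
    and "0 \<le> u" "u \<le> enn2real (curve_length \<gamma> a b)"
  obtains \<tau> where "\<tau> \<in> {a..b}" "enn2real (curve_length \<gamma> a \<tau>) = u"
proof -
  have "curve_length \<gamma> a a \<le> ennreal (0 * (a - a))"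
  proof (rule curve_length_lipschitz)
    fix x y :: real assume "a \<le> x" "x \<le> y" "y \<le> a"
    then have "x = y" by linarith
    then show "dist (\<gamma> x) (\<gamma> y) \<le> 0 * (y - x)" by simp
  qed
  then have "curve_length \<gamma> a a = 0" by simp
  then show ?thesis
    using IVT'[OF _ _ \<open>a \<le> b\<close> continuous_on_curve_length[OF assms(1,2)], of u] assms that by auto
qed

lemma enn2real_curve_length_diff:
  assumes "curve_length \<gamma> a b < top" "a \<le> s" "s \<le> t" "t \<le> b"
  shows "enn2real (curve_length \<gamma> a t) - enn2real (curve_length \<gamma> a s) = enn2real (curve_length \<gamma> s t)"
    and "curve_length \<gamma> s t < top"
proof -
  have f: "curve_length \<gamma> a s < top" "curve_length \<gamma> s t < top"
    using curve_length_mono[of a a s b \<gamma>] curve_length_mono[of a s t b \<gamma>] assms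
    by (auto intro: le_less_trans)
  show "enn2real (curve_length \<gamma> a t) - enn2real (curve_length \<gamma> a s) = enn2real (curve_length \<gamma> s t)"
    using assms f by (subst curve_length_additive[of a s t]) (auto simp: enn2real_plus)
  show "curve_length \<gamma> s t < top" by (fact f)
qed

lemma dist_arc_length_param_le:
  assumes "continuous_on {a..b} \<gamma>" "curve_length \<gamma> a b < top" "a \<le> b"
    and uv: "u \<in> {0..enn2real (curve_length \<gamma> a b)}" "v \<in> {0..enn2real (curve_length \<gamma> a b)}"
  shows "dist (arc_length_param \<gamma> a b u) (arc_length_param \<gamma> a b v) \<le> \<bar>u - v\<bar>"
proof -
  obtain s t where s: "s \<in> {a..b}" "enn2real (curve_length \<gamma> a s) = u"
    and t: "t \<in> {a..b}" "enn2real (curve_length \<gamma> a t) = v"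
    using arc_length_exists[OF assms(1-3)] uv by (metis atLeastAtMost_iff)
  have *: "dist (\<gamma> x) (\<gamma> y) \<le> enn2real (curve_length \<gamma> a y) - enn2real (curve_length \<gamma> a x)"
    if "x \<in> {a..b}" "y \<in> {a..b}" "x \<le> y" for x y
  proof -
    have "ennreal (dist (\<gamma> x) (\<gamma> y)) \<le> ennreal (enn2real (curve_length \<gamma> x y))"
      using dist_le_curve_length[OF that(3), of \<gamma>] enn2real_curve_length_diff(2)[OF assms(2), of x y] that by simp
    then show ?thesis
      using enn2real_curve_length_diff(1)[OF assms(2), of x y] that by (subst (asm) ennreal_le_iff) auto
  qed
  have "arc_length_param \<gamma> a b u = \<gamma> s" "arc_length_param \<gamma> a b v = \<gamma> t"
    using arc_length_param_eq[OF assms(2)] s t by auto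
  then show ?thesis
    using *[of s t] *[of t s] s t by (cases "s \<le> t") (auto simp: dist_commute)
qed

lemma continuous_on_arc_length_param:
  assumes "continuous_on {a..b} \<gamma>" "curve_length \<gamma> a b < top" "a \<le> b"
  shows "continuous_on {0..enn2real (curve_length \<gamma> a b)} (arc_length_param \<gamma> a b)"
proof (rule lipschitz_on_continuous_on)
  show "1-lipschitz_on {0..enn2real (curve_length \<gamma> a b)} (arc_length_param \<gamma> a b)"
    using dist_arc_length_param_le[OF assms] by (intro lipschitz_onI) (simp_all add: dist_real_def)
qed

section \<open>Line integrals across shells and along Lipschitz paths\<close>

text \<open>By the intermediate value theorem each value in \<open>{p<..<q}\<close> is taken at a
  parameter of the set, and a 1-Lipschitz map does not increase measure.\<close>

lemma emeasure_crossing: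
  fixes h :: "real \<Rightarrow> real"
  assumes lip: "\<And>x y. x \<in> {a..b} \<Longrightarrow> y \<in> {a..b} \<Longrightarrow> \<bar>h x - h y\<bar> \<le> \<bar>x - y\<bar>"
    and "u \<in> {a..b}" "v \<in> {a..b}" "h u \<le> p" "q \<le> h v" "p \<le> q"
  shows "{s \<in> {a..b}. p < h s \<and> h s < q} \<in> sets borel"
    "ennreal (q - p) \<le> emeasure lborel {s \<in> {a..b}. p < h s \<and> h s < q}"
proof -
  have cont: "continuous_on {a..b} h"
  proof (rule lipschitz_on_continuous_on)
    show "1-lipschitz_on {a..b} h"
      using lip by (intro lipschitz_onI) (simp_all add: dist_real_def)
  qed
  have "openin (top_of_set {a..b}) ({a..b} \<inter> h -` {p<..<q})"
    using cont by (rule continuous_openin_preimage_gen) auto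
  then obtain T where "open T" "{a..b} \<inter> h -` {p<..<q} = {a..b} \<inter> T" by (metis openin_open)
  moreover have "{s \<in> {a..b}. p < h s \<and> h s < q} = {a..b} \<inter> h -` {p<..<q}" by auto
  ultimately show M: "{s \<in> {a..b}. p < h s \<and> h s < q} \<in> sets borel" by auto
  have "{p<..<q} \<subseteq> h ` {s \<in> {a..b}. p < h s \<and> h s < q}"
  proof
    fix w assume w: "w \<in> {p<..<q}"
    have "connected (h ` {a..b})" using cont by (intro connected_continuous_image) auto
    moreover have "h u \<in> h ` {a..b}" "h v \<in> h ` {a..b}" using assms by auto
    ultimately have "w \<in> h ` {a..b}"
      using w assms unfolding is_interval_connected_1[symmetric] is_interval_1
      by (meson greaterThanLessThan_iff le_less_trans less_imp_le less_le_trans)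
    then show "w \<in> h ` {s \<in> {a..b}. p < h s \<and> h s < q}" using w by auto
  qed
  then have "emeasure lborel {p<..<q} \<le> ennreal 1 * emeasure lborel {s \<in> {a..b}. p < h s \<and> h s < q}"
    using lip M by (intro emeasure_lipschitz_image_le[where a=a and b=b and h=h]) auto
  then show "ennreal (q - p) \<le> emeasure lborel {s \<in> {a..b}. p < h s \<and> h s < q}"
    using \<open>p \<le> q\<close> by simp
qed

text \<open>A step version of the extremal density of a round ring, which is a multiple of 1 / |x -
  w|. On the shell of width \<open>r * 2 ^ i\<close> its value is 1 / N divided by that width, so
  each of the \<open>N\<close> shells contributes at least 1 / N to the integral over a crossing
  curve.\<close>

definition dyadic_density :: "'a::euclidean_space \<Rightarrow> real \<Rightarrow> nat \<Rightarrow> 'a \<Rightarrow> ennreal"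
  where "dyadic_density w r N x =
    (\<Sum>i<N. indicator {x. r * 2 ^ i < dist w x \<and> dist w x < r * 2 ^ Suc i} x * ennreal (1 / (N * r * 2 ^ i)))"

lemma borel_measurable_dyadic_density [measurable]: "dyadic_density w r N \<in> borel_measurable borel"
  unfolding dyadic_density_def[abs_def] by measurable

lemma nn_integral_dyadic_density_ge:
  fixes h :: "real \<Rightarrow> 'a::euclidean_space"
  assumes lip: "\<And>x y. x \<in> {a..b} \<Longrightarrow> y \<in> {a..b} \<Longrightarrow> dist (h x) (h y) \<le> \<bar>x - y\<bar>"
    and uv: "u \<in> {a..b}" "v \<in> {a..b}" "dist w (h u) \<le> r" "r * 2 ^ N \<le> dist w (h v)" and "r > 0" "N > 0"
  shows "1 \<le> (\<integral>\<^sup>+s\<in>{a..b}. dyadic_density w r N (h s) \<partial>lborel)"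
proof -
  define E where "E i = {s \<in> {a..b}. r * 2 ^ i < dist w (h s) \<and> dist w (h s) < r * 2 ^ Suc i}" for i
  have lip': "\<bar>dist w (h x) - dist w (h y)\<bar> \<le> \<bar>x - y\<bar>" if "x \<in> {a..b}" "y \<in> {a..b}" for x y
  proof -
    have "dist w (h x) \<le> dist w (h y) + dist (h x) (h y)" "dist w (h y) \<le> dist w (h x) + dist (h x) (h y)"
      using dist_triangle[of w "h x" "h y"] dist_triangle[of w "h y" "h x"] by (simp_all add: dist_commute)
    then show ?thesis using lip[OF that] by linarith
  qed
  have E: "E i \<in> sets borel" "ennreal (r * 2 ^ i) \<le> emeasure lborel (E i)" if "i < N" for i
  proof -
    have "r * 2 ^ Suc i \<le> r * 2 ^ N" using that \<open>r > 0\<close> by (intro mult_left_mono power_increasing) auto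
    then have q: "r * 2 ^ Suc i \<le> dist w (h v)" using uv by linarith
    have "r * 1 \<le> r * 2 ^ i" using \<open>r > 0\<close> by (intro mult_left_mono) auto
    then have p: "dist w (h u) \<le> r * 2 ^ i" using uv by linarith
    have pq: "r * 2 ^ i \<le> r * 2 ^ Suc i" using \<open>r > 0\<close> by simp
    have eq: "r * 2 ^ Suc i - r * 2 ^ i = r * 2 ^ i" by simp
    note c = emeasure_crossing[of a b "\<lambda>s. dist w (h s)", OF lip' uv(1,2) p q pq]
    show "E i \<in> sets borel" using c(1) unfolding E_def .
    show "ennreal (r * 2 ^ i) \<le> emeasure lborel (E i)" using c(2) unfolding eq E_def .
  qed
  have "(1::ennreal) = (\<Sum>i<N. ennreal (1 / N))"
    using \<open>N > 0\<close> by (simp add: ennreal_of_nat_eq_real_of_nat ennreal_mult'[symmetric])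
  also have "\<dots> = (\<Sum>i<N. ennreal (1 / (N * r * 2 ^ i)) * ennreal (r * 2 ^ i))"
    using \<open>r > 0\<close> by (intro sum.cong refl) (simp add: ennreal_mult'[symmetric])
  also have "\<dots> \<le> (\<Sum>i<N. ennreal (1 / (N * r * 2 ^ i)) * emeasure lborel (E i))"
    using E by (intro sum_mono mult_left_mono) auto
  also have "\<dots> = (\<Sum>i<N. \<integral>\<^sup>+s. ennreal (1 / (N * r * 2 ^ i)) * indicator (E i) s \<partial>lborel)"
    using E by (intro sum.cong refl) (simp add: nn_integral_cmult_indicator)
  also have "\<dots> = (\<integral>\<^sup>+s. (\<Sum>i<N. ennreal (1 / (N * r * 2 ^ i)) * indicator (E i) s) \<partial>lborel)"
    using E by (intro nn_integral_sum[symmetric]) auto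
  also have "\<dots> \<le> (\<integral>\<^sup>+s\<in>{a..b}. dyadic_density w r N (h s) \<partial>lborel)"
    unfolding dyadic_density_def
    by (intro nn_integral_mono) (auto simp: sum_distrib_right E_def indicator_def intro!: sum_mono)
  finally show ?thesis .
qed

text \<open>Parametrized by arc length, the compact subcurve between the two parameters is
  1-Lipschitz and crosses every shell. Taking minimum and maximum covers both directions of
  crossing.\<close>

lemma line_integral_dyadic_density_ge:
  assumes "is_interval I" and cont: "continuous_on I \<gamma>" and rect: "locally_rectifiable (I, \<gamma>)"
    and s: "s \<in> I" "dist w (\<gamma> s) \<le> r" and s': "s' \<in> I" "r * 2 ^ N \<le> dist w (\<gamma> s')"
    and "r > 0" "N > 0"
  shows "1 \<le> line_integral (dyadic_density w r N) (I, \<gamma>)"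
proof -
  define a b where "a = min s s'" and "b = max s s'"
  have ab: "a \<in> I" "b \<in> I" "a \<le> b" using s s' by (auto simp: a_def b_def min_def max_def)
  have "{a..b} \<subseteq> I"
    using \<open>is_interval I\<close> ab by (meson atLeastAtMost_iff is_interval_1 subsetI)
  then have cont': "continuous_on {a..b} \<gamma>" using cont continuous_on_subset by blast
  have fin: "curve_length \<gamma> a b < top" using rect ab by (auto simp: locally_rectifiable_def)
  define \<sigma> where "\<sigma> t = enn2real (curve_length \<gamma> a t)" for t
  have \<sigma>: "\<sigma> t \<in> {0..\<sigma> b} \<and> arc_length_param \<gamma> a b (\<sigma> t) = \<gamma> t" if "t \<in> {a..b}" for t
    using that arc_length_param_eq[OF fin that] fin curve_length_mono[of a a t b \<gamma>]
    by (auto simp: \<sigma>_def intro!: enn2real_mono)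
  have "1 \<le> (\<integral>\<^sup>+u\<in>{0..\<sigma> b}. dyadic_density w r N (arc_length_param \<gamma> a b u) \<partial>lborel)"
    using \<sigma>[of s] \<sigma>[of s'] s s' \<open>r > 0\<close> \<open>N > 0\<close> dist_arc_length_param_le[OF cont' fin ab(3)]
    by (intro nn_integral_dyadic_density_ge[where u="\<sigma> s" and v="\<sigma> s'"]) (auto simp: a_def b_def \<sigma>_def)
  also have "\<dots> \<le> line_integral (dyadic_density w r N) (I, \<gamma>)"
    using ab unfolding line_integral_def \<sigma>_def by (auto intro!: SUP_upper2[of "(a, b)"])
  finally show ?thesis .
qed

text \<open>The length function is itself \<Lambda>-Lipschitz in the parameter, so substituting it
  for the arc length costs a factor \<Lambda>. Bounding every compact subcurve by the integral over
  all of \<open>I\<close> also serves the half-open intervals on which lifts live.\<close>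

lemma line_integral_lipschitz_le:
  fixes \<gamma> :: "real \<Rightarrow> 'a::euclidean_space"
  assumes [measurable]: "\<rho> \<in> borel_measurable borel"
    and lip: "\<And>x y. x \<in> I \<Longrightarrow> y \<in> I \<Longrightarrow> dist (\<gamma> x) (\<gamma> y) \<le> \<Lambda> * \<bar>x - y\<bar>" and "0 \<le> \<Lambda>" and "is_interval I"
  shows "locally_rectifiable (I, \<gamma>)"
    and "line_integral \<rho> (I, \<gamma>) \<le> ennreal \<Lambda> * (\<integral>\<^sup>+s\<in>I. \<rho> (\<gamma> s) \<partial>lborel)"
proof -
  have sub: "{s..t} \<subseteq> I" if "s \<in> I" "t \<in> I" for s t
    using \<open>is_interval I\<close> that by (meson atLeastAtMost_iff is_interval_1 subsetI)
  have len: "curve_length \<gamma> x y \<le> ennreal (\<Lambda> * (y - x))" if "x \<in> I" "y \<in> I" for x y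
  proof (rule curve_length_lipschitz)
    fix x' y' assume "x \<le> x'" "x' \<le> y'" "y' \<le> y"
    moreover from this have "x' \<in> I" "y' \<in> I" using sub[OF that] by auto
    ultimately show "dist (\<gamma> x') (\<gamma> y') \<le> \<Lambda> * (y' - x')" using lip[of x' y'] by auto
  qed
  show "locally_rectifiable (I, \<gamma>)"
    unfolding locally_rectifiable_def by (auto intro: le_less_trans[OF len ennreal_less_top])
  show "line_integral \<rho> (I, \<gamma>) \<le> ennreal \<Lambda> * (\<integral>\<^sup>+s\<in>I. \<rho> (\<gamma> s) \<partial>lborel)"
    unfolding line_integral_def prod.case
  proof (rule SUP_least, clarsimp)
    fix s t assume st: "s \<in> I" "t \<in> I" "s \<le> t"
    note sub = sub[OF st(1,2)]
    define \<sigma> where "\<sigma> \<tau> = enn2real (curve_length \<gamma> s \<tau>)" for \<tau>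
    have fin: "curve_length \<gamma> s t < top" using len[OF st(1,2)] by (auto intro: le_less_trans)
    have cont: "continuous_on {s..t} \<gamma>"
    proof (rule lipschitz_on_continuous_on)
      show "\<Lambda>-lipschitz_on {s..t} \<gamma>"
        using lip[OF subsetD[OF sub] subsetD[OF sub]] \<open>0 \<le> \<Lambda>\<close>
        by (intro lipschitz_onI) (simp_all add: dist_real_def)
    qed
    have contS: "continuous_on {s..t} \<sigma>" unfolding \<sigma>_def by (rule continuous_on_curve_length[OF cont fin])
    have lipS: "\<bar>\<sigma> x - \<sigma> y\<bar> \<le> \<Lambda> * \<bar>x - y\<bar>" if "x \<in> {s..t}" "y \<in> {s..t}" for x y
    proof -
      have *: "\<bar>\<sigma> y - \<sigma> x\<bar> \<le> \<Lambda> * (y - x)" if xy: "x \<in> {s..t}" "y \<in> {s..t}" "x \<le> y" for x y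
      proof -
        have "enn2real (curve_length \<gamma> x y) \<le> \<Lambda> * (y - x)"
          using len[OF subsetD[OF sub xy(1)] subsetD[OF sub xy(2)]] xy \<open>0 \<le> \<Lambda>\<close> by (intro enn2real_leI) auto
        then show ?thesis using enn2real_curve_length_diff(1)[OF fin, of x y] xy by (simp add: \<sigma>_def)
      qed
      show ?thesis using *[of x y] *[of y x] that by (cases "x \<le> y") (auto simp: abs_minus_commute)
    qed
    define J where "J = {0..\<sigma> t}"
    \<comment> \<open>Outside \<open>J\<close> the definite description behind
      \<open>arc_length_param\<close> is uncontrolled; the cut-off gives a Borel function on the
      whole line.\<close>
    define g where "g u = \<rho> (arc_length_param \<gamma> s t u) * indicator J u" for u
    have "arc_length_param \<gamma> s t \<in> borel_measurable (restrict_space borel J)"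
      unfolding J_def \<sigma>_def
      by (intro borel_measurable_continuous_on_restrict continuous_on_arc_length_param cont fin st)
    from measurable_compose[OF this assms(1)] have [measurable]: "g \<in> borel_measurable borel"
      unfolding g_def[abs_def] by (subst (asm) borel_measurable_restrict_space_iff_ennreal) (auto simp: J_def)
    have \<sigma>: "\<sigma> \<tau> \<in> J \<and> arc_length_param \<gamma> s t (\<sigma> \<tau>) = \<gamma> \<tau>" if "\<tau> \<in> {s..t}" for \<tau>
      using that arc_length_param_eq[OF fin that] fin curve_length_mono[of s s \<tau> t \<gamma>]
      by (auto simp: \<sigma>_def J_def intro!: enn2real_mono)
    have "(\<integral>\<^sup>+u\<in>J. \<rho> (arc_length_param \<gamma> s t u) \<partial>lborel) = (\<integral>\<^sup>+u\<in>J. g u \<partial>lborel)"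
      by (intro nn_integral_cong) (auto simp: g_def indicator_def)
    also have "\<dots> \<le> ennreal \<Lambda> * (\<integral>\<^sup>+\<tau>\<in>{s..t}. g (\<sigma> \<tau>) \<partial>lborel)"
    proof (rule nn_integral_substitution_lipschitz_le[OF _ contS lipS \<open>0 \<le> \<Lambda>\<close>])
      show "J \<subseteq> \<sigma> ` {s..t}"
      proof
        fix u assume "u \<in> J"
        then obtain \<tau> where "\<tau> \<in> {s..t}" "enn2real (curve_length \<gamma> s \<tau>) = u"
          using arc_length_exists[OF cont fin st(3), of u] by (auto simp: J_def \<sigma>_def)
        then show "u \<in> \<sigma> ` {s..t}" by (auto simp: \<sigma>_def)
      qed
    qed (auto simp: J_def)
    also have "(\<integral>\<^sup>+\<tau>\<in>{s..t}. g (\<sigma> \<tau>) \<partial>lborel) \<le> (\<integral>\<^sup>+\<tau>\<in>I. \<rho> (\<gamma> \<tau>) \<partial>lborel)"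
      using \<sigma> sub by (intro nn_integral_mono) (auto simp: g_def indicator_def)
    finally show "(\<integral>\<^sup>+u\<in>{0..enn2real (curve_length \<gamma> s t)}. \<rho> (arc_length_param \<gamma> s t u) \<partial>lborel)
        \<le> ennreal \<Lambda> * (\<integral>\<^sup>+s\<in>I. \<rho> (\<gamma> s) \<partial>lborel)"
      by (simp add: J_def \<sigma>_def mult_left_mono)
  qed
qed

section \<open>Upper bounds for moduli\<close>

text \<open>The open shells are disjoint, so at most one summand is nonzero and the power acts on it
  alone. Enlarging shells to balls costs a constant factor and leaves only ball volumes to
  evaluate.\<close>

lemma dyadic_density_power_le:
  assumes "r > 0" "n > 0"
  shows "dyadic_density w r N x ^ n \<le>
    (\<Sum>i<N. ennreal ((1 / (N * r * 2 ^ i)) ^ n) * indicator (ball w (r * 2 ^ Suc i)) x)"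
proof (cases "\<exists>i<N. r * 2 ^ i < dist w x \<and> dist w x < r * 2 ^ Suc i")
  case True
  then obtain i where i: "i < N" "r * 2 ^ i < dist w x" "dist w x < r * 2 ^ Suc i" by blast
  have uniq: "j = i" if "r * 2 ^ j < dist w x" "dist w x < r * 2 ^ Suc j" for j
  proof -
    have "r * 2 ^ j < r * 2 ^ Suc i" "r * 2 ^ i < r * 2 ^ Suc j" using i that by linarith+
    then have "(2::real) ^ j < 2 ^ Suc i" "(2::real) ^ i < 2 ^ Suc j" using \<open>r > 0\<close> by auto
    then have "j < Suc i" "i < Suc j"
      using power_less_imp_less_exp[of "2::real" j "Suc i"] power_less_imp_less_exp[of "2::real" i "Suc j"] by auto
    then show ?thesis by simp
  qed
  have "indicator {x. r * 2 ^ j < dist w x \<and> dist w x < r * 2 ^ Suc j} x * ennreal (1 / (N * r * 2 ^ j))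
      = (if j = i then ennreal (1 / (N * r * 2 ^ i)) else 0)" for j
    using uniq[of j] i(2,3) by (cases "j = i") (auto simp: indicator_def)
  then have "dyadic_density w r N x = (\<Sum>j<N. if j = i then ennreal (1 / (N * r * 2 ^ i)) else 0)"
    unfolding dyadic_density_def by (intro sum.cong refl)
  also have "\<dots> = ennreal (1 / (N * r * 2 ^ i))" using i(1) by (subst sum.delta) auto
  finally have "dyadic_density w r N x ^ n = ennreal ((1 / (N * r * 2 ^ i)) ^ n)"
    using \<open>r > 0\<close> by (simp only: ennreal_power[symmetric])
      (subst ennreal_power, auto)
  also have "\<dots> = ennreal ((1 / (N * r * 2 ^ i)) ^ n) * indicator (ball w (r * 2 ^ Suc i)) x"
    using i(3) by (simp add: indicator_def)
  also have "\<dots> \<le> (\<Sum>i<N. ennreal ((1 / (N * r * 2 ^ i)) ^ n) * indicator (ball w (r * 2 ^ Suc i)) x)"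
    using i by (intro member_le_sum) auto
  finally show ?thesis .
next
  case False
  then have "dyadic_density w r N x = 0"
    unfolding dyadic_density_def by (intro sum.neutral) (auto simp: indicator_def)
  then show ?thesis using \<open>n > 0\<close> by (simp add: zero_power)
qed

text \<open>The n-th power of the density scales like the reciprocal of volume, so every shell
  contributes the same amount, of order N^(-n), and the \<open>N\<close> shells give N^(1-n). With
  \<open>2 ^ N\<close> as the ratio of the radii this is the logarithmic bound for rings.\<close>

lemma curve_modulus_le:
  fixes \<Gamma> :: "'a::euclidean_space curve set"
  assumes \<Gamma>: "\<And>I \<gamma>. (I, \<gamma>) \<in> \<Gamma> \<Longrightarrow> is_interval I \<and> continuous_on I \<gamma> \<and>
      (\<exists>s\<in>I. dist w (\<gamma> s) \<le> r) \<and> (\<exists>s\<in>I. r * 2 ^ N \<le> dist w (\<gamma> s))"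
    and "r > 0" "N > 0"
  shows "curve_modulus \<Gamma> \<le> ennreal (unit_ball_vol DIM('a) * 2 ^ DIM('a) / N ^ (DIM('a) - 1))"
proof -
  let ?n = "DIM('a)"
  define c where "c i = (1 / (N * r * 2 ^ i)) ^ ?n" for i
  have "dyadic_density w r N \<in> admissible \<Gamma>"
    unfolding admissible_def
  proof (intro CollectI conjI ballI impI)
    fix c assume "c \<in> \<Gamma>" "locally_rectifiable c"
    moreover obtain I \<gamma> where "c = (I, \<gamma>)" by (cases c)
    moreover obtain s s' where "is_interval I" "continuous_on I \<gamma>"
      "s \<in> I" "dist w (\<gamma> s) \<le> r" "s' \<in> I" "r * 2 ^ N \<le> dist w (\<gamma> s')"
      using \<Gamma>[of I \<gamma>] calculation by blast
    ultimately show "1 \<le> line_integral (dyadic_density w r N) c"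
      using line_integral_dyadic_density_ge[of I \<gamma> s w r s' N] \<open>r > 0\<close> \<open>N > 0\<close> by simp
  qed simp
  then have "curve_modulus \<Gamma> \<le> (\<integral>\<^sup>+x. dyadic_density w r N x ^ ?n \<partial>lborel)"
    unfolding curve_modulus_def by (rule INF_lower)
  also have "\<dots> \<le> (\<integral>\<^sup>+x. (\<Sum>i<N. ennreal (c i) * indicator (ball w (r * 2 ^ Suc i)) x) \<partial>lborel)"
    using dyadic_density_power_le[OF \<open>r > 0\<close>, of ?n w N] by (intro nn_integral_mono) (auto simp: c_def)
  also have "\<dots> = (\<Sum>i<N. ennreal (c i) * emeasure lborel (ball w (r * 2 ^ Suc i)))"
    by (subst nn_integral_sum) (auto simp: nn_integral_cmult_indicator
        intro!: borel_measurable_times_ennreal borel_measurable_indicator borel_open)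
  also have "\<dots> = (\<Sum>i<N. ennreal (unit_ball_vol ?n * 2 ^ ?n / N ^ ?n))"
  proof (intro sum.cong refl)
    fix i
    have "c i * (unit_ball_vol ?n * (r * 2 ^ Suc i) ^ ?n) = unit_ball_vol ?n * 2 ^ ?n / N ^ ?n"
      using \<open>r > 0\<close> by (simp add: c_def power_mult_distrib power_divide field_simps)
    then show "ennreal (c i) * emeasure lborel (ball w (r * 2 ^ Suc i)) = ennreal (unit_ball_vol ?n * 2 ^ ?n / N ^ ?n)"
      using \<open>r > 0\<close> by (simp add: emeasure_ball c_def ennreal_mult'[symmetric])
  qed
  also have "\<dots> = ennreal (N * (unit_ball_vol ?n * 2 ^ ?n / N ^ ?n))"
    by (simp add: ennreal_of_nat_eq_real_of_nat ennreal_mult'[symmetric])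
  also have "N * (unit_ball_vol ?n * 2 ^ ?n / N ^ ?n) = unit_ball_vol ?n * 2 ^ ?n / N ^ (?n - 1)"
    using \<open>N > 0\<close> by (cases ?n) (auto simp: field_simps)
  finally show ?thesis .
qed

section \<open>Lower bounds for integrals over concentric spheres\<close>

text \<open>
  Integrals over spheres are replaced by Lebesgue integrals, over a shell, of functions that are
  homogeneous of degree 0; no surface measure is needed.
\<close>

definition fat_shell :: "'a::real_normed_vector set"
  where "fat_shell = {x. 1 / 4 < norm x \<and> norm x < 3}"

lemma borel_fat_shell [measurable]: "fat_shell \<in> sets borel"
  unfolding fat_shell_def by measurable

lemma nn_integral_affine:
  fixes f :: "'a::euclidean_space \<Rightarrow> ennreal"
  assumes [measurable]: "f \<in> borel_measurable borel" and "c \<noteq> 0"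
  shows "(\<integral>\<^sup>+x. f x \<partial>lborel) = ennreal (\<bar>c\<bar> ^ DIM('a)) * (\<integral>\<^sup>+x. f (p + c *\<^sub>R x) \<partial>lborel)"
  by (subst lborel_affine[OF \<open>c \<noteq> 0\<close>, of p])
     (simp add: nn_integral_density nn_integral_distr nn_integral_cmult)

text \<open>Polar coordinates, with \<open>fat_shell\<close> in place of the unit sphere.
  Substituting t = |x| \<tau> and exchanging the integrals leaves a dilation by \<tau>, where \<tau>
  lies between a / 3 and 8 a. The constant collects 3 from dt = |x| d\<tau>, (3 / a)^n from the
  dilation and 8 a from the range of \<tau>.\<close>

lemma nn_integral_polar_le:
  fixes g :: "'a::euclidean_space \<Rightarrow> ennreal"
  assumes g[measurable]: "g \<in> borel_measurable borel" and "a > 0"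
  shows "(\<integral>\<^sup>+t\<in>{a<..<2*a}. (\<integral>\<^sup>+x\<in>fat_shell. g (t *\<^sub>R (x /\<^sub>R norm x)) \<partial>lborel) \<partial>lborel)
    \<le> ennreal (24 * 3 ^ DIM('a) * a / a ^ DIM('a)) * (\<integral>\<^sup>+x. g x \<partial>lborel)"
proof -
  let ?n = "DIM('a)"
  define T where "T = {a<..<2*a}"
  have [measurable]: "T \<in> sets borel" by (simp add: T_def)
  have "(\<integral>\<^sup>+t\<in>T. (\<integral>\<^sup>+x\<in>fat_shell. g (t *\<^sub>R (x /\<^sub>R norm x)) \<partial>lborel) \<partial>lborel)
      = (\<integral>\<^sup>+t. (\<integral>\<^sup>+x. g (t *\<^sub>R (x /\<^sub>R norm x)) * indicator fat_shell x * indicator T t \<partial>lborel) \<partial>lborel)"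
    by (intro nn_integral_cong) (simp add: nn_integral_multc)
  also have "\<dots> = (\<integral>\<^sup>+x. (\<integral>\<^sup>+t. g (t *\<^sub>R (x /\<^sub>R norm x)) * indicator fat_shell x * indicator T t \<partial>lborel) \<partial>lborel)"
    by (rule lborel_pair.Fubini') measurable
  also have "\<dots> \<le> (\<integral>\<^sup>+x. (\<integral>\<^sup>+\<tau>. ennreal 3 * (g (\<tau> *\<^sub>R x) * indicator {a/3<..<8*a} \<tau>) \<partial>lborel) \<partial>lborel)"
  proof (rule nn_integral_mono)
    fix x :: 'a
    show "(\<integral>\<^sup>+t. g (t *\<^sub>R (x /\<^sub>R norm x)) * indicator fat_shell x * indicator T t \<partial>lborel)
        \<le> (\<integral>\<^sup>+\<tau>. ennreal 3 * (g (\<tau> *\<^sub>R x) * indicator {a/3<..<8*a} \<tau>) \<partial>lborel)"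
    proof (cases "x \<in> fat_shell")
      case True
      then have x: "1 / 4 < norm x" "norm x < 3" by (auto simp: fat_shell_def)
      then have n3: "ennreal (norm x) \<le> ennreal 3" by (intro ennreal_leI) simp
      have "(\<integral>\<^sup>+t. g (t *\<^sub>R (x /\<^sub>R norm x)) * indicator fat_shell x * indicator T t \<partial>lborel)
          = ennreal \<bar>norm x\<bar> * (\<integral>\<^sup>+\<tau>. g ((0 + norm x * \<tau>) *\<^sub>R (x /\<^sub>R norm x)) * indicator fat_shell x
              * indicator T (0 + norm x * \<tau>) \<partial>lborel)"
        using x by (intro nn_integral_real_affine) auto
      also have "\<dots> = ennreal (norm x) * (\<integral>\<^sup>+\<tau>. g (\<tau> *\<^sub>R x) * indicator T (norm x * \<tau>) \<partial>lborel)"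
        using x True by (intro arg_cong2[where f="(*)"] nn_integral_cong) (auto simp: field_simps)
      also have "\<dots> \<le> ennreal 3 * (\<integral>\<^sup>+\<tau>. g (\<tau> *\<^sub>R x) * indicator {a/3<..<8*a} \<tau> \<partial>lborel)"
      proof (intro mult_mono nn_integral_mono mult_left_mono)
        fix \<tau>
        have "a / 3 < \<tau> \<and> \<tau> < 8 * a" if "a < norm x * \<tau>" "norm x * \<tau> < 2 * a"
        proof -
          have "0 < norm x * \<tau>" using that \<open>a > 0\<close> by linarith
          then have "\<tau> > 0" using x by (simp add: zero_less_mult_iff)
          have "norm x * \<tau> \<le> 3 * \<tau>" "1 / 4 * \<tau> \<le> norm x * \<tau>"
            using x \<open>\<tau> > 0\<close> by (intro mult_right_mono; simp)+
          with that show ?thesis by linarith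
        qed
        then show "indicator T (norm x * \<tau>) \<le> (indicator {a/3<..<8*a} \<tau> :: ennreal)"
          by (auto simp: T_def indicator_def)
      qed (use n3 in auto)
      finally show ?thesis by (simp add: nn_integral_cmult)
    qed simp
  qed
  also have "\<dots> = (\<integral>\<^sup>+\<tau>. (\<integral>\<^sup>+x. ennreal 3 * (g (\<tau> *\<^sub>R x) * indicator {a/3<..<8*a} \<tau>) \<partial>lborel) \<partial>lborel)"
    by (rule lborel_pair.Fubini'[symmetric]) measurable
  also have "\<dots> \<le> (\<integral>\<^sup>+\<tau>. ennreal 3 * (ennreal ((3 / a) ^ ?n) * (\<integral>\<^sup>+x. g x \<partial>lborel)) * indicator {a/3<..<8*a} \<tau> \<partial>lborel)"
  proof (intro nn_integral_mono)
    fix \<tau> :: real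
    show "(\<integral>\<^sup>+x. ennreal 3 * (g (\<tau> *\<^sub>R x) * indicator {a/3<..<8*a} \<tau>) \<partial>lborel)
      \<le> ennreal 3 * (ennreal ((3 / a) ^ ?n) * (\<integral>\<^sup>+x. g x \<partial>lborel)) * indicator {a/3<..<8*a} \<tau>"
    proof (cases "\<tau> \<in> {a/3<..<8*a}")
      case True
      then have \<tau>: "\<tau> > 0" "1 \<le> 3 / a * \<tau>" using \<open>a > 0\<close> by (auto simp: field_simps intro: less_trans[of 0 "a/3"])
      have "1 \<le> (3 / a * \<tau>) ^ ?n" by (rule one_le_power[OF \<tau>(2)])
      then have "1 \<le> ennreal ((3 / a) ^ ?n * \<bar>\<tau>\<bar> ^ ?n)" using \<tau> by (simp add: power_mult_distrib power_divide)
      then have "1 * (\<integral>\<^sup>+x. g (\<tau> *\<^sub>R x) \<partial>lborel) \<le> ennreal ((3 / a) ^ ?n * \<bar>\<tau>\<bar> ^ ?n) * (\<integral>\<^sup>+x. g (\<tau> *\<^sub>R x) \<partial>lborel)"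
        by (rule mult_right_mono) simp
      also have "\<dots> = ennreal ((3 / a) ^ ?n) * (\<integral>\<^sup>+x. g x \<partial>lborel)"
        using \<tau> nn_integral_affine[of g \<tau> 0] \<open>a > 0\<close> by (simp add: ennreal_mult mult.assoc)
      finally show ?thesis using True by (simp add: nn_integral_cmult mult_left_mono)
    qed simp
  qed
  also have "\<dots> = ennreal 3 * (ennreal ((3 / a) ^ ?n) * (\<integral>\<^sup>+x. g x \<partial>lborel)) * ennreal (8 * a - a / 3)"
    using \<open>a > 0\<close> by (simp add: nn_integral_cmult_indicator)
  also have "\<dots> = ennreal (3 * (3 / a) ^ ?n * (8 * a - a / 3)) * (\<integral>\<^sup>+x. g x \<partial>lborel)"
    using \<open>a > 0\<close> by (subst ennreal_mult, simp, simp, subst ennreal_mult, simp, simp) (simp only: ac_simps)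
  also have "\<dots> \<le> ennreal (24 * 3 ^ ?n * a / a ^ ?n) * (\<integral>\<^sup>+x. g x \<partial>lborel)"
  proof (intro mult_right_mono ennreal_leI)
    have "3 * (3 / a) ^ ?n * (8 * a - a / 3) \<le> 3 * (3 / a) ^ ?n * (8 * a)"
      using \<open>a > 0\<close> by (intro mult_left_mono) auto
    then show "3 * (3 / a) ^ ?n * (8 * a - a / 3) \<le> 24 * 3 ^ ?n * a / a ^ ?n"
      by (simp add: power_divide field_simps)
  qed simp
  finally show ?thesis unfolding T_def .
qed

text \<open>
  The dilates of the ball by factors between 1 and 2 cover each point of the shell for a set of factors
  of length at most of order \<open>r\<close>.
\<close>

lemma nn_integral_thin_ball_le:
  fixes h :: "'a::euclidean_space \<Rightarrow> ennreal"
  assumes h[measurable]: "h \<in> borel_measurable borel" and hom: "\<And>c x. c > 0 \<Longrightarrow> h (c *\<^sub>R x) = h x"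
    and p: "1 / 2 \<le> norm p" "norm p \<le> 1" and r: "0 < r" "r \<le> 1 / 4"
  shows "(\<integral>\<^sup>+x\<in>ball p r. h x \<partial>lborel) \<le> ennreal (32 * r) * (\<integral>\<^sup>+x\<in>fat_shell. h x \<partial>lborel)"
proof -
  let ?n = "DIM('a)"
  have [measurable]: "ball p r \<in> sets borel" by auto
  let ?F = "\<lambda>l x. h x * indicator (ball p r) (x /\<^sub>R l) * indicator {1<..<2} l :: ennreal"
  have "(\<integral>\<^sup>+x\<in>ball p r. h x \<partial>lborel) = (\<integral>\<^sup>+x\<in>ball p r. h x \<partial>lborel) * emeasure lborel {1<..<2::real}"
    by simp
  also have "\<dots> = (\<integral>\<^sup>+l. (\<integral>\<^sup>+x\<in>ball p r. h x \<partial>lborel) * indicator {1<..<2::real} l \<partial>lborel)"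
    by (subst nn_integral_cmult_indicator) auto
  also have "\<dots> \<le> (\<integral>\<^sup>+l. (\<integral>\<^sup>+x. ?F l x \<partial>lborel) \<partial>lborel)"
  proof (intro nn_integral_mono)
    fix l :: real
    show "(\<integral>\<^sup>+x\<in>ball p r. h x \<partial>lborel) * indicator {1<..<2} l \<le> (\<integral>\<^sup>+x. ?F l x \<partial>lborel)"
    proof (cases "l \<in> {1<..<2}")
      case True
      then have l: "l > 0" "1 \<le> l" by auto
      have "(\<integral>\<^sup>+x. ?F l x \<partial>lborel) = ennreal (\<bar>l\<bar> ^ ?n) * (\<integral>\<^sup>+x. ?F l (0 + l *\<^sub>R x) \<partial>lborel)"
        using l by (intro nn_integral_affine) auto
      also have "\<dots> = ennreal (l ^ ?n) * (\<integral>\<^sup>+x\<in>ball p r. h x \<partial>lborel)"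
        using l True by (simp add: hom)
      also have "\<dots> \<ge> 1 * (\<integral>\<^sup>+x\<in>ball p r. h x \<partial>lborel)"
        using one_le_power[OF l(2), of ?n] by (intro mult_right_mono) auto
      finally show ?thesis using True by simp
    qed simp
  qed
  also have "\<dots> = (\<integral>\<^sup>+x. (\<integral>\<^sup>+l. ?F l x \<partial>lborel) \<partial>lborel)"
    by (rule lborel_pair.Fubini') measurable
  also have "\<dots> \<le> (\<integral>\<^sup>+x. (\<integral>\<^sup>+l. h x * indicator fat_shell x * indicator {norm x / (norm p + r)..norm x / (norm p - r)} l \<partial>lborel) \<partial>lborel)"
  proof (intro nn_integral_mono)
    fix x :: 'a and l :: real
    \<comment> \<open>As |p| lies in [1/2, 1], r \<le> 1/4 and 1 < l < 2, the dilated ball has norms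
      between 1/4 and 5/2; the bounds of \<open>fat_shell\<close> are chosen to contain
      them.\<close>
    have "x \<in> fat_shell \<and> norm x / (norm p + r) \<le> l \<and> l \<le> norm x / (norm p - r)"
      if l: "1 < l" "l < 2" and b: "x /\<^sub>R l \<in> ball p r"
    proof -
      have "\<bar>norm (x /\<^sub>R l) - norm p\<bar> < r"
        using b norm_triangle_ineq3[of "x /\<^sub>R l" p] by (simp add: dist_norm norm_minus_commute)
      then have "\<bar>norm x / l - norm p\<bar> < r" using l by (simp add: divide_inverse_commute)
      then have "norm x / l < norm p + r" "norm p - r < norm x / l" by auto
      then have 1: "norm x < (norm p + r) * l" "(norm p - r) * l < norm x"
        using l by (simp_all add: field_simps)
      have "(norm p + r) * l \<le> (5/4) * l" "(1/4) * l \<le> (norm p - r) * l"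
        using p r l by (intro mult_right_mono; simp)+
      then show ?thesis using 1 p r l by (auto simp: fat_shell_def field_simps)
    qed
    then show "?F l x \<le> h x * indicator fat_shell x * indicator {norm x / (norm p + r)..norm x / (norm p - r)} l"
      by (auto simp: indicator_def)
  qed
  also have "\<dots> \<le> (\<integral>\<^sup>+x. h x * indicator fat_shell x * ennreal (32 * r) \<partial>lborel)"
  proof (intro nn_integral_mono)
    fix x :: 'a
    have pr: "norm p - r > 0" "norm p + r > 0" using p r by auto
    \<comment> \<open>The difference equals 2 r |x| / (|p|^2 - r^2); the bounds |x| < 3 and |p|^2 -
      r^2 \<ge> 3/16 give 32 r.\<close>
    have "norm x / (norm p - r) - norm x / (norm p + r) \<le> 32 * r" if "x \<in> fat_shell"
    proof -
      have "1/4 * (3/4) \<le> (norm p - r) * (norm p + r)"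
      proof -
        have "(1 / 2)\<^sup>2 \<le> (norm p)\<^sup>2" "r\<^sup>2 \<le> (1 / 4)\<^sup>2" using p r by (auto intro!: power_mono)
        then show ?thesis by (simp add: power2_eq_square algebra_simps)
      qed
      then have d: "3 / 16 \<le> (norm p - r) * (norm p + r)" by simp
      have "norm x / (norm p - r) - norm x / (norm p + r) = norm x * (2 * r) / ((norm p - r) * (norm p + r))"
        using pr by (simp add: field_simps)
      also have "\<dots> \<le> 3 * (2 * r) / (3 / 16)"
        using d that r by (intro frac_le mult_right_mono) (auto simp: fat_shell_def)
      finally show ?thesis using r by simp
    qed
    then show "(\<integral>\<^sup>+l. h x * indicator fat_shell x * indicator {norm x / (norm p + r)..norm x / (norm p - r)} l \<partial>lborel)
        \<le> h x * indicator fat_shell x * ennreal (32 * r)"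
      using pr r by (cases "x \<in> fat_shell") (auto simp: nn_integral_cmult_indicator frac_le intro!: mult_left_mono ennreal_leI)
  qed
  also have "\<dots> = ennreal (32 * r) * (\<integral>\<^sup>+x\<in>fat_shell. h x \<partial>lborel)"
    by (simp add: nn_integral_multc mult.commute)
  finally show ?thesis .
qed

text \<open>Either x \<le> e, or x > e and the power term alone dominates. This crude form takes the
  place of Hoelder's inequality and also holds for infinite values.\<close>

lemma ennreal_young:
  fixes x :: ennreal
  assumes "e > 0" "n > 0"
  shows "x \<le> ennreal e + ennreal (1 / e ^ (n - 1)) * x ^ n"
proof (cases x)
  case (real t)
  have "t \<le> e + 1 / e ^ (n - 1) * t ^ n"
  proof (cases "t \<le> e")
    case True
    then show ?thesis using real assms by (intro add_increasing2) auto
  next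
    case False
    then have "e ^ (n - 1) * t \<le> t ^ (n - 1) * t"
      using assms by (intro mult_right_mono power_mono) auto
    also have "\<dots> = t ^ n" using \<open>n > 0\<close> by (cases n) auto
    finally have "t \<le> 1 / e ^ (n - 1) * t ^ n" using \<open>e > 0\<close> by (simp add: field_simps)
    then show ?thesis using \<open>e > 0\<close> by linarith
  qed
  then show ?thesis
    using real assms
    by (subst real(2), subst real(2)) (simp add: ennreal_power ennreal_mult[symmetric] ennreal_plus[symmetric] del: ennreal_plus)
next
  case top
  then show ?thesis using assms by (simp add: ennreal_mult_top)
qed

lemma nn_integral_powr_unit:
  assumes "n > (0::nat)"
  shows "(\<integral>\<^sup>+s\<in>{0<..<1}. ennreal (s powr (- 1 + 1 / n)) \<partial>lborel) = ennreal n"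
proof -
  have "((\<lambda>s. s powr (- 1 + 1 / n)) has_integral (1 powr (- 1 + 1 / n + 1) / (- 1 + 1 / n + 1))) {0..1}"
    using assms by (intro has_integral_powr_from_0) auto
  then have "(\<integral>\<^sup>+s. ennreal (s powr (- 1 + 1 / n)) * indicator {0..1} s \<partial>lborel) = ennreal n"
    by (subst nn_integral_has_integral_lebesgue'[where I="real n"]) auto
  moreover have "(\<integral>\<^sup>+s\<in>{0<..<1}. ennreal (s powr (- 1 + 1 / n)) \<partial>lborel)
      = (\<integral>\<^sup>+s. ennreal (s powr (- 1 + 1 / n)) * indicator {0..1} s \<partial>lborel)"
  proof (rule nn_integral_cong_AE)
    have "AE s in lborel. s \<noteq> (0::real) \<and> s \<noteq> 1"
      using AE_lborel_singleton[of 0] AE_lborel_singleton[of "1::real"] by (rule AE_conjI)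
    then show "AE s in lborel. ennreal (s powr (- 1 + 1 / n)) * indicator {0<..<1} s =
        ennreal (s powr (- 1 + 1 / n)) * indicator {0..1} s"
      by (auto simp: indicator_def)
  qed
  ultimately show ?thesis by simp
qed

text \<open>The weight solves w^n = s^(1-n): with it the factors s^(-n) and s of the Morrey estimate
  leave both terms of Young's inequality with the same order in s.\<close>

lemma powr_balance:
  fixes s :: real
  assumes "s > 0" "n > (0::nat)"
  shows "1 / (s powr (- 1 + 1 / n)) ^ (n - 1) / s ^ n * s = s powr (- 1 + 1 / n)"
proof -
  have n1: "real (n - 1) = real n - 1" using assms by simp
  have "1 / (s powr (- 1 + 1 / n)) ^ (n - 1) / s ^ n * s
      = s powr (- ((- 1 + 1 / n) * real (n - 1))) * s powr (- real n) * s powr 1"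
    using assms by (simp add: powr_realpow[symmetric] powr_powr powr_minus_divide)
  also have "\<dots> = s powr (- ((- 1 + 1 / n) * real (n - 1)) + - real n + 1)"
    by (simp only: powr_add[symmetric])
  also have "- ((- 1 + 1 / n) * real (n - 1)) + - real n + 1 = - 1 + 1 / n"
    unfolding n1 using assms by (simp add: field_simps)
  finally show ?thesis .
qed

lemma convex_combination_norm:
  fixes q m :: "'a::euclidean_space"
  assumes "norm q = 1" "norm m = 1" "0 \<le> q \<bullet> m" "0 \<le> s" "s \<le> 1"
  shows "1 / 2 \<le> norm ((1 - s) *\<^sub>R q + s *\<^sub>R m)" "norm ((1 - s) *\<^sub>R q + s *\<^sub>R m) \<le> 1"
proof -
  have qq: "q \<bullet> q = 1" "m \<bullet> m = 1" using assms by (simp_all add: dot_square_norm)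
  have "(norm ((1 - s) *\<^sub>R q + s *\<^sub>R m))\<^sup>2 = (1 - s)\<^sup>2 + s\<^sup>2 + 2 * (s * (1 - s)) * (q \<bullet> m)"
    unfolding power2_norm_eq_inner
    by (simp add: inner_add_left inner_add_right inner_commute[of m q] qq power2_eq_square algebra_simps)
  also have "\<dots> \<ge> (1 - s)\<^sup>2 + s\<^sup>2" using assms by simp
  also have "(1 - s)\<^sup>2 + s\<^sup>2 \<ge> (1 / 2)\<^sup>2"
  proof -
    have "0 \<le> (2 * s - 1)\<^sup>2" by simp
    then show ?thesis by (simp add: power2_eq_square algebra_simps)
  qed
  finally show "1 / 2 \<le> norm ((1 - s) *\<^sub>R q + s *\<^sub>R m)"
    by (rule power2_le_imp_le) simp
  have "norm ((1 - s) *\<^sub>R q + s *\<^sub>R m) \<le> norm ((1 - s) *\<^sub>R q) + norm (s *\<^sub>R m)"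
    by (rule norm_triangle_ineq)
  then show "norm ((1 - s) *\<^sub>R q + s *\<^sub>R m) \<le> 1" using assms by simp
qed

text \<open>
  A Morrey estimate. The homothety with centre \<open>q\<close> and ratio \<open>s\<close> costs a factor \<open>s\<^sup>-\<^sup>n\<close>, the thinness of
  the image ball gains a factor \<open>s\<close>; Young's inequality with parameter \<open>\<epsilon> s powr (- 1 + 1 / n)\<close> turns
  both of its terms into multiples of this same weight, which is integrable on the unit interval.
\<close>

lemma nn_integral_segments_le:
  fixes h :: "'a::euclidean_space \<Rightarrow> ennreal"
  assumes h[measurable]: "h \<in> borel_measurable borel" and hom: "\<And>c x. c > 0 \<Longrightarrow> h (c *\<^sub>R x) = h x"
    and qm: "norm q = 1" "norm m = 1" "0 \<le> q \<bullet> m" and "\<epsilon> > 0"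
  shows "(\<integral>\<^sup>+z\<in>ball m (1/4). (\<integral>\<^sup>+s\<in>{0<..<1}. h ((1 - s) *\<^sub>R q + s *\<^sub>R z) \<partial>lborel) \<partial>lborel)
    \<le> ennreal DIM('a) * (ennreal \<epsilon> * emeasure lborel (ball m (1/4))
        + ennreal (8 / \<epsilon> ^ (DIM('a) - 1)) * (\<integral>\<^sup>+x\<in>fat_shell. h x ^ DIM('a) \<partial>lborel))"
proof -
  let ?n = "DIM('a)"
  let ?Z = "ball m (1/4)"
  let ?I = "\<integral>\<^sup>+x\<in>fat_shell. h x ^ ?n \<partial>lborel"
  let ?x = "\<lambda>s z. (1 - s) *\<^sub>R q + s *\<^sub>R z"
  define w where "w s = s powr (- 1 + 1 / ?n)" for s :: real
  have [measurable]: "?Z \<in> sets borel" by auto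
  have "(\<integral>\<^sup>+z\<in>?Z. (\<integral>\<^sup>+s\<in>{0<..<1}. h (?x s z) \<partial>lborel) \<partial>lborel)
     = (\<integral>\<^sup>+z. (\<integral>\<^sup>+s. h (?x s z) * indicator {0<..<1} s * indicator ?Z z \<partial>lborel) \<partial>lborel)"
    by (intro nn_integral_cong) (simp add: nn_integral_multc)
  also have "\<dots> = (\<integral>\<^sup>+s. (\<integral>\<^sup>+z. h (?x s z) * indicator {0<..<1} s * indicator ?Z z \<partial>lborel) \<partial>lborel)"
    by (rule lborel_pair.Fubini') measurable
  also have "\<dots> \<le> (\<integral>\<^sup>+s. ennreal (w s) * indicator {0<..<1} s *
      (ennreal \<epsilon> * emeasure lborel ?Z + ennreal (8 / \<epsilon> ^ (?n - 1)) * ?I) \<partial>lborel)"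
  proof (rule nn_integral_mono)
    fix s :: real
    show "(\<integral>\<^sup>+z. h (?x s z) * indicator {0<..<1} s * indicator ?Z z \<partial>lborel)
      \<le> ennreal (w s) * indicator {0<..<1} s * (ennreal \<epsilon> * emeasure lborel ?Z + ennreal (8 / \<epsilon> ^ (?n - 1)) * ?I)"
    proof (cases "s \<in> {0<..<1}")
      case True
      then have s: "0 < s" "s < 1" by auto
      define p where "p = (1 - s) *\<^sub>R q + s *\<^sub>R m"
      have p: "1 / 2 \<le> norm p" "norm p \<le> 1"
        unfolding p_def using convex_combination_norm[OF qm, of s] s by auto
      have ws: "w s > 0" using s by (simp add: w_def)
      define e where "e = w s * \<epsilon>"
      have e: "e > 0" using ws \<open>\<epsilon> > 0\<close> by (simp add: e_def)
      have "(\<integral>\<^sup>+z. h (?x s z) ^ ?n * indicator ?Z z \<partial>lborel)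
          = ennreal (1 / s ^ ?n) * (ennreal (\<bar>s\<bar> ^ ?n) * (\<integral>\<^sup>+z. h (?x s z) ^ ?n
              * indicator (ball p (s / 4)) (?x s z) \<partial>lborel))"
      proof -
        have "dist p (?x s z) = s * dist m z" for z
          using s by (simp add: p_def dist_norm flip: scaleR_diff_right)
        then have "indicator (ball p (s / 4)) (?x s z) = (indicator ?Z z :: ennreal)" for z
          using s by (simp add: indicator_def)
        moreover have "ennreal (1 / s ^ ?n) * (ennreal (\<bar>s\<bar> ^ ?n) * y) = y" for y
          using s by (simp add: mult.assoc[symmetric] ennreal_mult[symmetric])
        ultimately show ?thesis by simp
      qed
      also have "\<dots> = ennreal (1 / s ^ ?n) * (\<integral>\<^sup>+x\<in>ball p (s / 4). h x ^ ?n \<partial>lborel)"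
      proof -
        have [measurable]: "ball p (s / 4) \<in> sets borel" by simp
        show ?thesis
          using s by (subst nn_integral_affine[of "\<lambda>x. h x ^ ?n * indicator (ball p (s / 4)) x" s "(1 - s) *\<^sub>R q"]) auto
      qed
      \<comment> \<open>The image ball has radius s / 4, so the thin ball factor is 32 (s / 4) = 8
        s; this is the origin of the 8 in the bound.\<close>
      also have "\<dots> \<le> ennreal (1 / s ^ ?n) * (ennreal (32 * (s / 4)) * ?I)"
        using p s by (intro mult_left_mono nn_integral_thin_ball_le) (auto simp: hom)
      also have "\<dots> = ennreal (8 / s ^ ?n * s) * ?I"
        using s by (simp add: mult.assoc[symmetric] ennreal_mult[symmetric])
      finally have pw: "(\<integral>\<^sup>+z. h (?x s z) ^ ?n * indicator ?Z z \<partial>lborel) \<le> ennreal (8 / s ^ ?n * s) * ?I" .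
      have "(\<integral>\<^sup>+z. h (?x s z) * indicator {0<..<1} s * indicator ?Z z \<partial>lborel)
          \<le> (\<integral>\<^sup>+z. ennreal e * indicator ?Z z
              + ennreal (1 / e ^ (?n - 1)) * (h (?x s z) ^ ?n * indicator ?Z z) \<partial>lborel)"
        using ennreal_young[OF e, of ?n] True by (intro nn_integral_mono) (auto simp: indicator_def)
      also have "\<dots> = ennreal e * emeasure lborel ?Z
          + ennreal (1 / e ^ (?n - 1)) * (\<integral>\<^sup>+z. h (?x s z) ^ ?n * indicator ?Z z \<partial>lborel)"
        by (subst nn_integral_add) (auto simp: nn_integral_cmult nn_integral_cmult_indicator)
      also have "\<dots> \<le> ennreal e * emeasure lborel ?Z + ennreal (1 / e ^ (?n - 1)) * (ennreal (8 / s ^ ?n * s) * ?I)"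
        by (intro add_left_mono mult_left_mono pw) auto
      also have "ennreal (1 / e ^ (?n - 1)) * (ennreal (8 / s ^ ?n * s) * ?I) = ennreal (w s) * (ennreal (8 / \<epsilon> ^ (?n - 1)) * ?I)"
      proof -
        have "1 / e ^ (?n - 1) * (8 / s ^ ?n * s) = (1 / w s ^ (?n - 1) / s ^ ?n * s) * (8 / \<epsilon> ^ (?n - 1))"
          by (simp add: e_def power_mult_distrib mult_ac)
        also have "\<dots> = w s * (8 / \<epsilon> ^ (?n - 1))"
          unfolding w_def using s by (subst powr_balance) auto
        finally have eq: "1 / e ^ (?n - 1) * (8 / s ^ ?n * s) = w s * (8 / \<epsilon> ^ (?n - 1))" .
        have "ennreal (1 / e ^ (?n - 1)) * ennreal (8 / s ^ ?n * s) = ennreal (w s) * ennreal (8 / \<epsilon> ^ (?n - 1))"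
          using e s ws \<open>\<epsilon> > 0\<close> by (simp only: ennreal_mult[symmetric] eq less_imp_le zero_le_power zero_le_divide_1_iff
              divide_nonneg_nonneg zero_le_numeral mult_nonneg_nonneg)
        then show ?thesis by (simp only: mult.assoc[symmetric])
      qed
      also have "ennreal e = ennreal (w s) * ennreal \<epsilon>"
        using ws \<open>\<epsilon> > 0\<close> by (simp add: e_def ennreal_mult)
      finally show ?thesis using True by (simp add: distrib_left mult.assoc)
    qed simp
  qed
  also have "\<dots> = ennreal ?n * (ennreal \<epsilon> * emeasure lborel ?Z + ennreal (8 / \<epsilon> ^ (?n - 1)) * ?I)"
  proof -
    have "(\<integral>\<^sup>+s. ennreal (w s) * indicator {0<..<1} s \<partial>lborel) = ennreal ?n"
      unfolding w_def using nn_integral_powr_unit[of ?n] by simp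
    moreover have [measurable]: "w \<in> borel_measurable borel" unfolding w_def[abs_def] by measurable
    ultimately show ?thesis by (simp add: nn_integral_multc)
  qed
  finally show ?thesis .
qed

section \<open>Paths on spheres\<close>

lemma norm_direction_diff_le:
  fixes x y :: "'a::real_normed_vector"
  assumes "x \<noteq> 0" "y \<noteq> 0"
  shows "norm (x /\<^sub>R norm x - y /\<^sub>R norm y) \<le> 2 * norm (x - y) / norm x"
proof -
  have "x /\<^sub>R norm x - y /\<^sub>R norm y = (x - y) /\<^sub>R norm x + (inverse (norm x) - inverse (norm y)) *\<^sub>R y"
    by (simp add: algebra_simps)
  also have "norm \<dots> \<le> norm ((x - y) /\<^sub>R norm x) + norm ((inverse (norm x) - inverse (norm y)) *\<^sub>R y)"
    by (rule norm_triangle_ineq)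
  also have "norm ((inverse (norm x) - inverse (norm y)) *\<^sub>R y) = \<bar>norm y - norm x\<bar> / norm x"
  proof -
    have "inverse (norm x) - inverse (norm y) = (norm y - norm x) / (norm x * norm y)"
      using assms by (simp add: field_simps)
    then show ?thesis using assms by (simp add: abs_mult)
  qed
  also have "\<bar>norm y - norm x\<bar> / norm x \<le> norm (x - y) / norm x"
    using norm_triangle_ineq3[of y x] by (intro divide_right_mono) (auto simp: norm_minus_commute)
  also have "norm ((x - y) /\<^sub>R norm x) = norm (x - y) / norm x" by (simp add: divide_inverse_commute)
  finally show ?thesis by (simp add: add_divide_distrib[symmetric])
qed

text \<open>The broken line from \<open>q\<close> through \<open>z\<close> to \<open>y\<close>,
  written with piecewise linear weights so that one formula covers both legs and the Lipschitz bound
  needs no distinction between them.\<close>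

definition tent_path :: "'a::real_vector \<Rightarrow> 'a \<Rightarrow> 'a \<Rightarrow> real \<Rightarrow> 'a"
  where "tent_path q z y s = max 0 (1 - s) *\<^sub>R q + (1 - \<bar>s - 1\<bar>) *\<^sub>R z + max 0 (s - 1) *\<^sub>R y"

lemma tent_path_left: "0 \<le> s \<Longrightarrow> s \<le> 1 \<Longrightarrow> tent_path q z y s = (1 - s) *\<^sub>R q + s *\<^sub>R z"
  and tent_path_right: "1 \<le> s \<Longrightarrow> s \<le> 2 \<Longrightarrow> tent_path q z y s = (1 - (2 - s)) *\<^sub>R y + (2 - s) *\<^sub>R z"
  by (auto simp: tent_path_def max_def)

lemma norm_tent_path_diff_le:
  fixes q z y :: "'a::real_normed_vector"
  assumes "norm q \<le> 1" "norm y \<le> 1" "norm z \<le> 2"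
  shows "norm (tent_path q z y s - tent_path q z y t) \<le> 4 * \<bar>s - t\<bar>"
proof -
  have "tent_path q z y s - tent_path q z y t = (max 0 (1 - s) - max 0 (1 - t)) *\<^sub>R q
      + (\<bar>t - 1\<bar> - \<bar>s - 1\<bar>) *\<^sub>R z + (max 0 (s - 1) - max 0 (t - 1)) *\<^sub>R y"
    by (simp add: tent_path_def algebra_simps)
  also have "norm \<dots> \<le> \<bar>max 0 (1 - s) - max 0 (1 - t)\<bar> * norm q + \<bar>\<bar>t - 1\<bar> - \<bar>s - 1\<bar>\<bar> * norm z
      + \<bar>max 0 (s - 1) - max 0 (t - 1)\<bar> * norm y"
    by (intro norm_triangle_le add_mono) auto
  also have "\<dots> \<le> \<bar>max 0 (1 - s) - max 0 (1 - t)\<bar> * 1 + \<bar>s - t\<bar> * 2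
      + \<bar>max 0 (s - 1) - max 0 (t - 1)\<bar> * 1"
    using assms by (intro add_mono mult_mono) auto
  also have "\<dots> \<le> 4 * \<bar>s - t\<bar>"
  proof -
    have "\<bar>max 0 (1 - s) - max 0 (1 - t)\<bar> \<le> \<bar>s - t\<bar>" "\<bar>max 0 (s - 1) - max 0 (t - 1)\<bar> \<le> \<bar>s - t\<bar>"
      by (auto simp: max_def)
    then show ?thesis by linarith
  qed
  finally show ?thesis .
qed

text \<open>The sum of the two vectors bisects their angle. If they are antipodal, a vector
  orthogonal to both serves instead, which takes dimension at least 2.\<close>

lemma exists_unit_with_nonneg_inner:
  fixes q y :: "'a::euclidean_space"
  assumes "norm q = 1" "norm y = 1" "DIM('a) \<ge> 2"
  obtains m where "norm m = 1" "0 \<le> q \<bullet> m" "0 \<le> y \<bullet> m"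
proof -
  have qq: "q \<bullet> q = 1" "y \<bullet> y = 1" using assms by (simp_all add: dot_square_norm)
  have "\<exists>m. m \<noteq> 0 \<and> 0 \<le> q \<bullet> m \<and> 0 \<le> y \<bullet> m"
  proof (cases "q + y = 0")
    case True
    obtain m :: 'a where "m \<noteq> 0" "orthogonal q m" using orthogonal_to_vector_exists[OF assms(3)] by blast
    moreover have "y = - q" using True by (simp add: eq_neg_iff_add_eq_0 add.commute)
    ultimately show ?thesis by (auto simp: orthogonal_def intro!: exI[of _ m])
  next
    case False
    have "- 1 \<le> q \<bullet> y" using Cauchy_Schwarz_ineq2[of q y] assms by auto
    then show ?thesis using False qq
      by (intro exI[of _ "q + y"]) (auto simp: inner_add_right inner_commute[of y q])
  qed
  then obtain m where m: "m \<noteq> 0" "0 \<le> q \<bullet> m" "0 \<le> y \<bullet> m" by blast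
  show ?thesis using m by (intro that[of "m /\<^sub>R norm m"]) auto
qed

lemma norm_segment_ge:
  fixes q m z :: "'a::euclidean_space"
  assumes "norm q = 1" "norm m = 1" "0 \<le> q \<bullet> m" "0 \<le> s" "s \<le> 1" "z \<in> ball m (1/4)"
  shows "1 / 4 \<le> norm ((1 - s) *\<^sub>R q + s *\<^sub>R z)"
proof -
  have "(1 - s) *\<^sub>R q + s *\<^sub>R m = ((1 - s) *\<^sub>R q + s *\<^sub>R z) + s *\<^sub>R (m - z)" by (simp add: algebra_simps)
  then have "norm ((1 - s) *\<^sub>R q + s *\<^sub>R m) \<le> norm ((1 - s) *\<^sub>R q + s *\<^sub>R z) + norm (s *\<^sub>R (m - z))"
    by (metis norm_triangle_ineq)
  moreover have "norm (s *\<^sub>R (m - z)) \<le> 1 * (1 / 4)"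
    using assms by (simp only: norm_scaleR, intro mult_mono) (auto simp: dist_norm)
  moreover have "1 / 2 \<le> norm ((1 - s) *\<^sub>R q + s *\<^sub>R m)"
    using convex_combination_norm(1) assms by blast
  ultimately show ?thesis by linarith
qed

text \<open>
  The paths used are the radial projections to the sphere of the broken lines from \<open>q\<close> through \<open>z\<close> to
  \<open>y\<close>, averaged over \<open>z\<close> in a ball about a unit vector at angle at most \<open>\<pi> / 2\<close> from both.
\<close>

lemma spherical_shell_integral_ge:
  fixes \<rho> :: "'a::euclidean_space \<Rightarrow> ennreal" and t :: real
  assumes dim: "DIM('a) \<ge> 2" and \<rho>[measurable]: "\<rho> \<in> borel_measurable borel" and "t > 0"
    and qy: "norm q = 1" "norm y = 1"
    and paths: "\<And>\<gamma>. (\<And>u v. u \<in> {0..2} \<Longrightarrow> v \<in> {0..2} \<Longrightarrow> dist (\<gamma> u) (\<gamma> v) \<le> 32 * t * \<bar>u - v\<bar>) \<Longrightarrow>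
        \<gamma> 0 = w + t *\<^sub>R q \<Longrightarrow> \<gamma> 2 = w + t *\<^sub>R y \<Longrightarrow> \<gamma> ` {0..2} \<subseteq> sphere w t \<Longrightarrow>
        1 \<le> ennreal (32 * t) * (\<integral>\<^sup>+s\<in>{0..2}. \<rho> (\<gamma> s) \<partial>lborel)"
  shows "ennreal (unit_ball_vol DIM('a) * (1/4) ^ DIM('a) / (8 * (128 * DIM('a) * t) ^ DIM('a)))
    \<le> (\<integral>\<^sup>+x\<in>fat_shell. \<rho> (w + t *\<^sub>R (x /\<^sub>R norm x)) ^ DIM('a) \<partial>lborel)"
proof -
  let ?n = "DIM('a)"
  define h where "h x = \<rho> (w + t *\<^sub>R (x /\<^sub>R norm x))" for x
  have [measurable]: "h \<in> borel_measurable borel" unfolding h_def[abs_def] by measurable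
  have hom: "h (c *\<^sub>R x) = h x" if "c > 0" for c x
    using that by (simp add: h_def field_simps)
  obtain m where m: "norm m = 1" "0 \<le> q \<bullet> m" "0 \<le> y \<bullet> m"
    using exists_unit_with_nonneg_inner[OF qy dim] .
  let ?Z = "ball m (1/4)"
  have [measurable]: "?Z \<in> sets borel" by simp
  define V where "V = unit_ball_vol ?n * (1/4) ^ ?n"
  have V: "emeasure lborel ?Z = ennreal V" "V > 0" by (simp_all add: emeasure_ball V_def)
  define I where "I = (\<integral>\<^sup>+x\<in>fat_shell. h x ^ ?n \<partial>lborel)"
  define J where "J p z = (\<integral>\<^sup>+s\<in>{0<..<1}. h ((1 - s) *\<^sub>R p + s *\<^sub>R z) \<partial>lborel)" for p z
  have [measurable]: "J p \<in> borel_measurable borel" for p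
    unfolding J_def[abs_def] by measurable
  have one: "1 \<le> ennreal (32 * t) * (J q z + J y z)" if z: "z \<in> ?Z" for z
  proof -
    define \<gamma> where "\<gamma> s = w + t *\<^sub>R (tent_path q z y s /\<^sub>R norm (tent_path q z y s))" for s
    have "norm z \<le> norm m + dist m z" by (metis dist_commute dist_norm norm_triangle_sub)
    then have nz: "norm z \<le> 2" using z m by simp
    have low: "1 / 4 \<le> norm (tent_path q z y s)" if "s \<in> {0..2}" for s
    proof (cases "s \<le> 1")
      case True
      then show ?thesis using that norm_segment_ge[OF qy(1) m(1,2) _ _ z, of s] by (simp add: tent_path_left)
    next
      case False
      then show ?thesis using that norm_segment_ge[OF qy(2) m(1,3) _ _ z, of "2 - s"] by (simp add: tent_path_right)
    qed
    have "1 \<le> ennreal (32 * t) * (\<integral>\<^sup>+s\<in>{0..2}. \<rho> (\<gamma> s) \<partial>lborel)"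
    proof (rule paths)
      fix u v :: real assume uv: "u \<in> {0..2}" "v \<in> {0..2}"
      let ?u = "tent_path q z y u" and ?v = "tent_path q z y v"
      have "\<gamma> u - \<gamma> v = t *\<^sub>R (?u /\<^sub>R norm ?u - ?v /\<^sub>R norm ?v)"
        by (simp add: \<gamma>_def scaleR_diff_right)
      then have "dist (\<gamma> u) (\<gamma> v) = t * norm (?u /\<^sub>R norm ?u - ?v /\<^sub>R norm ?v)"
        using \<open>t > 0\<close> by (simp only: dist_norm norm_scaleR abs_of_pos)
      \<comment> \<open>Radial projection from norms of at least 1/4 stretches by at most 2 / (1/4),
        the broken line by at most 4: hence the factor 32 t.\<close>
      also have "\<dots> \<le> t * (2 * norm (?u - ?v) / norm ?u)"
        using low[OF uv(1)] low[OF uv(2)] \<open>t > 0\<close> by (intro mult_left_mono norm_direction_diff_le) auto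
      also have "\<dots> \<le> t * (2 * (4 * \<bar>u - v\<bar>) / (1 / 4))"
        using low[OF uv(1)] \<open>t > 0\<close> norm_tent_path_diff_le[of q y z u v] qy nz
        by (intro mult_left_mono frac_le) auto
      finally show "dist (\<gamma> u) (\<gamma> v) \<le> 32 * t * \<bar>u - v\<bar>" by simp
    next
      show "\<gamma> 0 = w + t *\<^sub>R q" "\<gamma> 2 = w + t *\<^sub>R y" using qy by (auto simp: \<gamma>_def tent_path_def)
      have "dist w (\<gamma> s) = t" if "s \<in> {0..2}" for s
      proof -
        have "norm (tent_path q z y s) \<noteq> 0" using low[OF that] by linarith
        then show ?thesis using \<open>t > 0\<close> by (simp add: \<gamma>_def dist_norm)
      qed
      then show "\<gamma> ` {0..2} \<subseteq> sphere w t" by auto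
    qed
    \<comment> \<open>The second leg is run backwards, from \<open>y\<close> to \<open>z\<close>, so
      that both legs start at a unit vector and one estimate serves both.\<close>
    also have "(\<integral>\<^sup>+s\<in>{0..2}. \<rho> (\<gamma> s) \<partial>lborel) = J q z + J y z"
    proof -
      have "(\<integral>\<^sup>+s\<in>{0..2}. \<rho> (\<gamma> s) \<partial>lborel)
        = (\<integral>\<^sup>+s. h ((1 - s) *\<^sub>R q + s *\<^sub>R z) * indicator {0<..<1} s
           + h ((1 - (2 - s)) *\<^sub>R y + (2 - s) *\<^sub>R z) * indicator {0<..<1} (2 - s) \<partial>lborel)"
      proof (rule nn_integral_cong_AE)
        have "AE s in lborel. s \<noteq> (0::real) \<and> s \<noteq> 1 \<and> s \<noteq> 2"
          using AE_lborel_singleton[of 0] AE_lborel_singleton[of "1::real"] AE_lborel_singleton[of "2::real"]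
          by (auto simp: AE_conj_iff)
        then show "AE s in lborel. \<rho> (\<gamma> s) * indicator {0..2} s = h ((1 - s) *\<^sub>R q + s *\<^sub>R z) * indicator {0<..<1} s
           + h ((1 - (2 - s)) *\<^sub>R y + (2 - s) *\<^sub>R z) * indicator {0<..<1} (2 - s)"
        proof eventually_elim
          case (elim s)
          consider "s < 0 \<or> s > 2" | "0 < s" "s < 1" | "1 < s" "s < 2" using elim by linarith
          then show ?case
          proof cases
            case 2
            then show ?thesis by (simp add: \<gamma>_def h_def tent_path_left)
          next
            case 3
            then show ?thesis using tent_path_right[of s q z y] by (simp add: \<gamma>_def h_def)
          qed auto
        qed
      qed
      also have "\<dots> = J q z + (\<integral>\<^sup>+s. h ((1 - (2 - s)) *\<^sub>R y + (2 - s) *\<^sub>R z) * indicator {0<..<1} (2 - s) \<partial>lborel)"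
        unfolding J_def by (rule nn_integral_add) measurable
      also have "(\<integral>\<^sup>+s. h ((1 - (2 - s)) *\<^sub>R y + (2 - s) *\<^sub>R z) * indicator {0<..<1} (2 - s) \<partial>lborel) = J y z"
        unfolding J_def
        by (subst nn_integral_real_affine[where c="-1" and t=2]) auto
      finally show ?thesis .
    qed
    finally show ?thesis .
  qed
  \<comment> \<open>With this \<epsilon> the first term of the estimate amounts to V / 2 and is
    absorbed on the left; what remains bounds the integral of the n-th power.\<close>
  define \<epsilon> where "\<epsilon> = 1 / (128 * ?n * t)"
  have "\<epsilon> > 0" using \<open>t > 0\<close> by (simp add: \<epsilon>_def)
  define E where "E = ennreal ?n * (ennreal \<epsilon> * ennreal V + ennreal (8 / \<epsilon> ^ (?n - 1)) * I)"
  have JE: "(\<integral>\<^sup>+z\<in>?Z. J p z \<partial>lborel) \<le> E" if "norm p = 1" "0 \<le> p \<bullet> m" for p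
    unfolding J_def E_def I_def V(1)[symmetric]
    by (rule nn_integral_segments_le) (use that m hom \<open>\<epsilon> > 0\<close> in auto)
  have "ennreal V = (\<integral>\<^sup>+z. indicator ?Z z \<partial>lborel)" by (simp add: V)
  also have "\<dots> \<le> (\<integral>\<^sup>+z. ennreal (32 * t) * (J q z * indicator ?Z z + J y z * indicator ?Z z) \<partial>lborel)"
    using one by (intro nn_integral_mono) (auto simp: indicator_def)
  also have "\<dots> = ennreal (32 * t) * ((\<integral>\<^sup>+z\<in>?Z. J q z \<partial>lborel) + (\<integral>\<^sup>+z\<in>?Z. J y z \<partial>lborel))"
    by (simp add: nn_integral_cmult nn_integral_add)
  also have "\<dots> \<le> ennreal (32 * t) * (E + E)"
    using JE qy m by (intro mult_left_mono add_mono) auto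
  finally have main: "ennreal V \<le> ennreal (32 * t) * (E + E)" .
  have "ennreal (V / (8 * (128 * ?n * t) ^ ?n)) \<le> I"
  proof (cases I)
    case (real i)
    let ?y = "8 / \<epsilon> ^ (?n - 1)"
    let ?X = "\<epsilon> * V + ?y * i"
    have E': "E = ennreal (?n * ?X)"
    proof -
      have "ennreal (?y) * ennreal i = ennreal (?y * i)"
        "ennreal \<epsilon> * ennreal V = ennreal (\<epsilon> * V)"
        using real \<open>\<epsilon> > 0\<close> V(2) by (intro ennreal_mult[symmetric]; simp)+
      moreover have "ennreal (\<epsilon> * V) + ennreal (?y * i) = ennreal ?X"
        using real \<open>\<epsilon> > 0\<close> V(2) by (intro ennreal_plus[symmetric]) auto
      ultimately have "E = ennreal ?n * ennreal ?X"
        unfolding E_def real by (simp only:)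
      then show ?thesis by (simp only: ennreal_mult'[OF of_nat_0_le_iff, symmetric])
    qed
    have "V \<le> 32 * t * (2 * (?n * ?X))"
    proof -
      have nn: "0 \<le> ?n * ?X" using real \<open>\<epsilon> > 0\<close> V(2) by auto
      have *: "ennreal (32 * t) * (ennreal X + ennreal X) = ennreal (32 * t * (2 * X))" if "0 \<le> X" for X
      proof -
        have "ennreal (32 * t) * (ennreal X + ennreal X) = ennreal (32 * t) * ennreal (X + X)"
          by (simp only: ennreal_plus[OF that that])
        also have "\<dots> = ennreal (32 * t * (X + X))"
          using that \<open>t > 0\<close> by (intro ennreal_mult[symmetric]) auto
        finally show ?thesis by (simp only: mult_2)
      qed
      show ?thesis
        using main nn \<open>t > 0\<close> unfolding E' *[OF nn] by (subst (asm) ennreal_le_iff) auto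
    qed
    also have "32 * t * (2 * (?n * ?X)) = (64 * t * ?n * \<epsilon>) * V + (512 * t * ?n) / \<epsilon> ^ (?n - 1) * i"
      by (simp add: algebra_simps)
    also have "64 * t * ?n * \<epsilon> = 1 / 2" using \<open>t > 0\<close> by (simp add: \<epsilon>_def)
    also have "(512 * t * ?n) / \<epsilon> ^ (?n - 1) = 4 * (128 * ?n * t) ^ ?n"
    proof -
      have "(128 * ?n * t) ^ ?n = (128 * ?n * t) * (128 * ?n * t) ^ (?n - 1)"
        using dim by (cases ?n) auto
      then show ?thesis by (simp add: \<epsilon>_def power_one_over)
    qed
    finally have "V \<le> 8 * (128 * ?n * t) ^ ?n * i" by simp
    then have "V / (8 * (128 * ?n * t) ^ ?n) \<le> i" using \<open>t > 0\<close> by (simp add: field_simps)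
    then show ?thesis using real by (simp add: ennreal_leI)
  qed simp
  then show ?thesis by (simp add: I_def h_def V_def)
qed

text \<open>The bound for a single sphere at t = 2 a, times the length a of the range of radii,
  divided by the constant of \<open>nn_integral_polar_le\<close>: 192 = 8 * 24 and 768 = 256 * 3,
  while a cancels.\<close>

definition sphere_const :: "'a::euclidean_space itself \<Rightarrow> real"
  where "sphere_const _ = unit_ball_vol DIM('a) * (1/4) ^ DIM('a) / (192 * (768 * real DIM('a)) ^ DIM('a))"

lemma sphere_const_pos: "sphere_const TYPE('a::euclidean_space) > 0"
  by (simp add: sphere_const_def)

text \<open>The bound on one sphere depends on t alone, so the end points may be picked separately
  for each radius, without measurability in t. Integrating over t between a and 2 a makes it
  independent of scale.\<close>

lemma sphere_family_integral_ge:
  fixes \<rho> :: "'a::euclidean_space \<Rightarrow> ennreal" and a :: real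
  assumes dim: "DIM('a) \<ge> 2" and \<rho>[measurable]: "\<rho> \<in> borel_measurable borel" and "a > 0"
    and paths: "\<And>t. a < t \<Longrightarrow> t < 2 * a \<Longrightarrow> \<exists>q\<in>sphere w t. \<exists>y\<in>sphere w t. \<forall>\<gamma>.
        (\<forall>u\<in>{0..2}. \<forall>v\<in>{0..2}. dist (\<gamma> u) (\<gamma> v) \<le> 32 * t * \<bar>u - v\<bar>) \<longrightarrow>
        \<gamma> 0 = q \<longrightarrow> \<gamma> 2 = y \<longrightarrow> \<gamma> ` {0..2} \<subseteq> sphere w t \<longrightarrow>
        1 \<le> ennreal (32 * t) * (\<integral>\<^sup>+s\<in>{0..2}. \<rho> (\<gamma> s) \<partial>lborel)"
  shows "ennreal (sphere_const TYPE('a)) \<le> (\<integral>\<^sup>+x. \<rho> x ^ DIM('a) \<partial>lborel)"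
proof -
  let ?n = "DIM('a)"
  define V where "V = unit_ball_vol ?n * (1/4) ^ ?n"
  have "V > 0" by (simp add: V_def)
  define c where "c = V / (8 * (256 * ?n * a) ^ ?n)"
  have "c > 0" using \<open>V > 0\<close> \<open>a > 0\<close> by (simp add: c_def)
  have "ennreal c * ennreal a = (\<integral>\<^sup>+t\<in>{a<..<2*a}. ennreal c \<partial>lborel)"
    using \<open>a > 0\<close> by (simp add: nn_integral_cmult_indicator)
  also have "\<dots> \<le> (\<integral>\<^sup>+t\<in>{a<..<2*a}. (\<integral>\<^sup>+x\<in>fat_shell. \<rho> (w + t *\<^sub>R (x /\<^sub>R norm x)) ^ ?n \<partial>lborel) \<partial>lborel)"
  proof (rule nn_integral_mono)
    fix t :: real
    show "ennreal c * indicator {a<..<2*a} t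
      \<le> (\<integral>\<^sup>+x\<in>fat_shell. \<rho> (w + t *\<^sub>R (x /\<^sub>R norm x)) ^ ?n \<partial>lborel) * indicator {a<..<2*a} t"
    proof (cases "t \<in> {a<..<2*a}")
      case True
      then have t: "a < t" "t < 2 * a" "t > 0" using \<open>a > 0\<close> by auto
      obtain q y where q: "q \<in> sphere w t" and y: "y \<in> sphere w t" and p: "\<And>\<gamma>.
        (\<forall>u\<in>{0..2}. \<forall>v\<in>{0..2}. dist (\<gamma> u) (\<gamma> v) \<le> 32 * t * \<bar>u - v\<bar>) \<Longrightarrow>
        \<gamma> 0 = q \<Longrightarrow> \<gamma> 2 = y \<Longrightarrow> \<gamma> ` {0..2} \<subseteq> sphere w t \<Longrightarrow>
        1 \<le> ennreal (32 * t) * (\<integral>\<^sup>+s\<in>{0..2}. \<rho> (\<gamma> s) \<partial>lborel)"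
        using paths[OF t(1,2)] by blast
      have "c \<le> V / (8 * (128 * ?n * t) ^ ?n)"
        unfolding c_def using t \<open>V > 0\<close> by (intro divide_left_mono mult_left_mono power_mono mult_pos_pos) auto
      also have "ennreal (V / (8 * (128 * ?n * t) ^ ?n))
          \<le> (\<integral>\<^sup>+x\<in>fat_shell. \<rho> (w + t *\<^sub>R (x /\<^sub>R norm x)) ^ ?n \<partial>lborel)"
        unfolding V_def
      proof (rule spherical_shell_integral_ge[OF dim \<rho> t(3), of "(q - w) /\<^sub>R t" "(y - w) /\<^sub>R t"])
        show "norm ((q - w) /\<^sub>R t) = 1" "norm ((y - w) /\<^sub>R t) = 1"
          using q y t by (auto simp: dist_norm norm_minus_commute)
      qed (use p t in auto)
      finally show ?thesis using True by (simp add: ennreal_leI)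
    qed simp
  qed
  also have "\<dots> \<le> ennreal (24 * 3 ^ ?n * a / a ^ ?n) * (\<integral>\<^sup>+x. \<rho> (w + x) ^ ?n \<partial>lborel)"
    using nn_integral_polar_le[of "\<lambda>x. \<rho> (w + x) ^ ?n", OF _ \<open>a > 0\<close>] by simp
  also have "(\<integral>\<^sup>+x. \<rho> (w + x) ^ ?n \<partial>lborel) = (\<integral>\<^sup>+x. \<rho> x ^ ?n \<partial>lborel)"
    using nn_integral_affine[of "\<lambda>x. \<rho> x ^ ?n" 1 w] by simp
  finally have *: "ennreal (c * a) \<le> ennreal (24 * 3 ^ ?n * a / a ^ ?n) * (\<integral>\<^sup>+x. \<rho> x ^ ?n \<partial>lborel)"
    using \<open>c > 0\<close> \<open>a > 0\<close> by (simp add: ennreal_mult)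
  show ?thesis
  proof (cases "\<integral>\<^sup>+x. \<rho> x ^ ?n \<partial>lborel")
    case (real i)
    have "c * a \<le> 24 * 3 ^ ?n * a / a ^ ?n * i"
      using * real \<open>a > 0\<close> by (simp add: ennreal_mult'[symmetric])
    then have "c * a ^ ?n / (24 * 3 ^ ?n) \<le> i" using \<open>a > 0\<close> by (simp add: field_simps)
    moreover have "c * a ^ ?n / (24 * 3 ^ ?n) = sphere_const TYPE('a)"
    proof -
      have "c * a ^ ?n / (24 * 3 ^ ?n) = V * a ^ ?n / (192 * ((256 * real ?n * a) ^ ?n * 3 ^ ?n))"
        by (simp add: c_def)
      also have "(256 * real ?n * a) ^ ?n * 3 ^ ?n = (256 * real ?n * a * 3) ^ ?n"
        by (rule power_mult_distrib[symmetric])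
      also have "256 * real ?n * a * 3 = (768 * real ?n) * a" by simp
      also have "((768 * real ?n) * a) ^ ?n = (768 * real ?n) ^ ?n * a ^ ?n" by (rule power_mult_distrib)
      also have "V * a ^ ?n / (192 * ((768 * real ?n) ^ ?n * a ^ ?n)) = V / (192 * (768 * real ?n) ^ ?n)"
        using \<open>a > 0\<close> by simp
      finally show ?thesis by (simp add: sphere_const_def V_def)
    qed
    ultimately show ?thesis using real by (simp add: ennreal_leI)
  qed simp
qed

section \<open>Harmonic functions\<close>

lemma second_derivative_nonpos_at_max:
  fixes \<phi> \<phi>' :: "real \<Rightarrow> real"
  assumes "\<delta> > 0" and d1: "\<And>\<tau>. \<bar>\<tau>\<bar> < \<delta> \<Longrightarrow> (\<phi> has_real_derivative \<phi>' \<tau>) (at \<tau>)"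
    and d2: "(\<phi>' has_real_derivative L) (at 0)"
    and max: "\<And>\<tau>. \<bar>\<tau>\<bar> < \<delta> \<Longrightarrow> \<phi> \<tau> \<le> \<phi> 0"
  shows "L \<le> 0"
proof (rule ccontr)
  assume "\<not> L \<le> 0"
  have "\<phi>' 0 = 0"
    using DERIV_local_max[OF d1[of 0] \<open>\<delta> > 0\<close>] max \<open>\<delta> > 0\<close> by auto
  obtain d where d: "d > 0" "\<And>h. 0 < h \<Longrightarrow> h < d \<Longrightarrow> \<phi>' 0 < \<phi>' (0 + h)"
    using DERIV_pos_inc_right[OF d2] \<open>\<not> L \<le> 0\<close> by auto
  define h where "h = min d \<delta> / 2"
  have h: "0 < h" "h < d" "h < \<delta>" using d(1) \<open>\<delta> > 0\<close> by (auto simp: h_def min_def)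
  obtain z where z: "0 < z" "z < h" "\<phi> h - \<phi> 0 = (h - 0) * \<phi>' z"
    using MVT2[of 0 h \<phi> \<phi>'] h d1 by auto
  then have "\<phi>' z > 0" using d(2)[of z] h \<open>\<phi>' 0 = 0\<close> by auto
  then show False using z h max[of h] by (smt (verit) mult_pos_pos)
qed

text \<open>The trace is invariant under orthogonal changes of basis. For a reflection this says
  that a mirrored harmonic function is harmonic, in terms of second derivatives along the mirrored
  basis.\<close>

lemma trace_reflection:
  fixes T :: "'a::euclidean_space \<Rightarrow> 'a" and e :: 'a
  assumes "linear T" "norm e = 1"
  shows "(\<Sum>b\<in>Basis. T (b - (2 * (b \<bullet> e)) *\<^sub>R e) \<bullet> (b - (2 * (b \<bullet> e)) *\<^sub>R e)) = (\<Sum>b\<in>Basis. T b \<bullet> b)"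
proof -
  interpret linear T by fact
  have e1: "(\<Sum>b\<in>Basis. (b \<bullet> e) *\<^sub>R b) = e"
    using euclidean_representation[of e] by (simp add: inner_commute)
  have a: "(\<Sum>b\<in>Basis. (b \<bullet> e) * (T b \<bullet> e)) = T e \<bullet> e"
  proof -
    have "T e = (\<Sum>b\<in>Basis. (b \<bullet> e) *\<^sub>R T b)"
      by (subst e1[symmetric]) (simp add: sum scale)
    then show ?thesis by (simp add: inner_sum_left)
  qed
  have b: "(\<Sum>b\<in>Basis. (b \<bullet> e) * (T e \<bullet> b)) = T e \<bullet> e"
    using euclidean_inner[of "T e" e] by (simp add: mult.commute inner_commute)
  have c: "(\<Sum>b\<in>Basis. (b \<bullet> e) * (b \<bullet> e)) = 1"
    using euclidean_inner[of e e] assms(2) by (simp add: inner_commute dot_square_norm)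
  have "T (b - (2 * (b \<bullet> e)) *\<^sub>R e) \<bullet> (b - (2 * (b \<bullet> e)) *\<^sub>R e)
      = T b \<bullet> b - 2 * ((b \<bullet> e) * (T b \<bullet> e)) - 2 * ((b \<bullet> e) * (T e \<bullet> b)) + 4 * (((b \<bullet> e) * (b \<bullet> e)) * (T e \<bullet> e))" for b
    by (simp add: diff scale algebra_simps)
  then show ?thesis
    by (simp add: sum.distrib sum_subtractf a b c flip: sum_distrib_left sum_distrib_right)
qed

text \<open>
  With \<open>R\<close> the reflection in the hyperplane through \<open>c\<close> orthogonal to \<open>e\<close>, the function \<open>u - u \<circ> R\<close>
  vanishes on the hyperplane; on the half ball it is compared with the strictly superharmonic barrier
  \<open>k (\<bar>z - c\<bar>\<^sup>2 + (n + 1) (r s - s\<^sup>2))\<close>, where \<open>s\<close> is the distance from the hyperplane.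
\<close>

lemma harmonic_symmetric_difference_le:
  fixes u :: "'a::euclidean_space \<Rightarrow> real"
  assumes harm: "harmonic_on D u" and D: "cball c r \<subseteq> D" and "r > 0" "M > 0"
    and M: "\<And>z. z \<in> cball c r \<Longrightarrow> \<bar>u z\<bar> \<le> M"
    and e: "norm e = 1" and "0 \<le> t" "t \<le> r"
  shows "u (c + t *\<^sub>R e) - u (c - t *\<^sub>R e) \<le> 2 * M * (DIM('a) + 1) * t / r"
proof -
  let ?n = "real DIM('a)"
  obtain g :: "'a \<Rightarrow> 'a" and H :: "'a \<Rightarrow> 'a \<Rightarrow>\<^sub>L 'a" where
    g: "\<And>x. x \<in> D \<Longrightarrow> (u has_derivative (\<lambda>h. g x \<bullet> h)) (at x)" and
    H: "\<And>x. x \<in> D \<Longrightarrow> (g has_derivative blinfun_apply (H x)) (at x)" and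
    tr: "\<And>x. x \<in> D \<Longrightarrow> (\<Sum>b\<in>Basis. blinfun_apply (H x) b \<bullet> b) = 0"
    using harm unfolding harmonic_on_def by blast
  define \<rho> where "\<rho> b = b - (2 * (b \<bullet> e)) *\<^sub>R e" for b
  define R where "R z = c + \<rho> (z - c)" for z
  define s where "s z = (z - c) \<bullet> e" for z
  \<comment> \<open>On the spherical part of the boundary of the half ball the barrier is then at
    least k r^2 = 2 M, which dominates the difference of two values of \<open>u\<close>.\<close>
  define k where "k = 2 * M / r\<^sup>2"
  define B where "B z = k * ((norm (z - c))\<^sup>2 + (?n + 1) * (r * s z - (s z)\<^sup>2))" for z
  define v where "v z = u z - u (R z) - B z" for z
  define K where "K = cball c r \<inter> {z. 0 \<le> s z}"
  have k: "k > 0" using \<open>M > 0\<close> \<open>r > 0\<close> by (simp add: k_def)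
  have ee: "e \<bullet> e = 1" using e by (simp add: dot_square_norm)
  have n\<rho>: "norm (\<rho> b) = norm b" for b
  proof -
    have "\<rho> b \<bullet> \<rho> b = b \<bullet> b"
      by (simp add: \<rho>_def inner_diff_left inner_diff_right ee inner_commute[of e b] algebra_simps)
    then show ?thesis by (simp add: norm_eq_sqrt_inner)
  qed
  have Rball: "R z \<in> cball c r" if "z \<in> cball c r" for z
    using that n\<rho>[of "z - c"] by (simp add: R_def dist_norm norm_minus_commute)
  have Rlin: "R (z + \<tau> *\<^sub>R b) = R z + \<tau> *\<^sub>R \<rho> b" for z \<tau> b
    by (simp add: R_def \<rho>_def algebra_simps inner_add_left inner_diff_left)
  have contu: "continuous_on D u"
    using g by (meson continuous_at_imp_continuous_on has_derivative_continuous)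
  have contR: "continuous_on S R" for S
    unfolding R_def[abs_def] \<rho>_def by (intro continuous_intros)
  have conts: "continuous_on S s" for S unfolding s_def by (intro continuous_intros)
  have "continuous_on (cball c r) v"
    unfolding v_def[abs_def] B_def s_def
    by (intro continuous_intros continuous_on_subset[OF contu D]
        continuous_on_compose2[OF contu contR]) (use Rball D in auto)
  then have contv: "continuous_on K v" unfolding K_def by (rule continuous_on_subset) auto
  have "closed {z. 0 \<le> s z}" unfolding s_def by (intro closed_Collect_le continuous_intros)
  then have "compact K" unfolding K_def by (intro compact_Int_closed) auto
  moreover have "c \<in> K" using \<open>r > 0\<close> by (simp add: K_def s_def)
  ultimately obtain z0 where z0: "z0 \<in> K" "\<And>z. z \<in> K \<Longrightarrow> v z \<le> v z0"
    using continuous_attains_sup[OF _ _ contv] by blast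
  have "v z0 \<le> 0"
  proof (rule ccontr)
    assume pos: "\<not> v z0 \<le> 0"
    have z0c: "z0 \<in> cball c r" "0 \<le> s z0" using z0(1) by (auto simp: K_def)
    have sle: "\<bar>s z\<bar> \<le> norm (z - c)" for z
      using Cauchy_Schwarz_ineq2[of "z - c" e] e by (simp add: s_def)
    have sr: "s z0 \<le> r" using sle[of z0] z0c by (simp add: dist_norm norm_minus_commute)
    have s1: "s z0 > 0"
    proof (rule ccontr)
      assume "\<not> s z0 > 0"
      then have 0: "s z0 = 0" using z0c by simp
      then have "R z0 = z0" by (simp add: R_def \<rho>_def s_def)
      then show False using pos k 0 by (simp add: v_def B_def)
    qed
    have s2: "norm (z0 - c) < r"
    proof (rule ccontr)
      assume "\<not> norm (z0 - c) < r"
      then have nr: "norm (z0 - c) = r" using z0c by (simp add: dist_norm norm_minus_commute)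
      have "0 \<le> s z0 * (r - s z0)" using s1 sr by simp
      then have "0 \<le> r * s z0 - (s z0)\<^sup>2" by (simp add: power2_eq_square algebra_simps)
      then have "0 \<le> (?n + 1) * (r * s z0 - (s z0)\<^sup>2)" by (intro mult_nonneg_nonneg) auto
      then have "r\<^sup>2 \<le> (norm (z0 - c))\<^sup>2 + (?n + 1) * (r * s z0 - (s z0)\<^sup>2)"
        using nr by simp
      then have "k * r\<^sup>2 \<le> B z0" unfolding B_def using k by (intro mult_left_mono) auto
      then have "2 * M \<le> B z0" using \<open>r > 0\<close> by (simp add: k_def)
      moreover have "\<bar>u z0\<bar> \<le> M" "\<bar>u (R z0)\<bar> \<le> M" using M Rball z0c by auto
      ultimately show False using pos by (simp add: v_def)
    qed
    have "open (ball c r \<inter> {z. 0 < s z})"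
      unfolding s_def by (intro open_Int open_ball open_Collect_less continuous_intros)
    moreover have "z0 \<in> ball c r \<inter> {z. 0 < s z}" using s1 s2 by (simp add: dist_norm norm_minus_commute)
    ultimately obtain \<delta> where \<delta>: "\<delta> > 0" "ball z0 \<delta> \<subseteq> ball c r \<inter> {z. 0 < s z}"
      using openE by blast
    have 2: "blinfun_apply (H z0) b \<bullet> b - blinfun_apply (H (R z0)) (\<rho> b) \<bullet> \<rho> b
        - k * (2 - 2 * (?n + 1) * (b \<bullet> e)\<^sup>2) \<le> 0" if b: "b \<in> Basis" for b
    proof (rule second_derivative_nonpos_at_max[OF \<delta>(1)])
      define \<phi>' where "\<phi>' \<tau> = g (z0 + \<tau> *\<^sub>R b) \<bullet> b - g (R z0 + \<tau> *\<^sub>R \<rho> b) \<bullet> \<rho> b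
        - k * (2 * ((z0 - c) \<bullet> b) + 2 * \<tau> + (?n + 1) * (r * (b \<bullet> e) - 2 * (s z0 + \<tau> * (b \<bullet> e)) * (b \<bullet> e)))" for \<tau>
      have bb: "b \<bullet> b = 1" using b by simp
      have mem: "z0 + \<tau> *\<^sub>R b \<in> ball c r" "0 < s (z0 + \<tau> *\<^sub>R b)" if "\<bar>\<tau>\<bar> < \<delta>" for \<tau>
      proof -
        have "z0 + \<tau> *\<^sub>R b \<in> ball z0 \<delta>" using that b by (simp add: dist_norm)
        then show "z0 + \<tau> *\<^sub>R b \<in> ball c r" "0 < s (z0 + \<tau> *\<^sub>R b)" using \<delta>(2) by auto
      qed
      have memR: "R z0 + \<tau> *\<^sub>R \<rho> b \<in> cball c r" if "\<bar>\<tau>\<bar> < \<delta>" for \<tau>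
        using Rball[of "z0 + \<tau> *\<^sub>R b"] mem[OF that] by (simp add: Rlin)
      have vline: "v (z0 + \<tau> *\<^sub>R b) = u (z0 + \<tau> *\<^sub>R b) - u (R z0 + \<tau> *\<^sub>R \<rho> b)
         - k * ((norm (z0 - c))\<^sup>2 + 2 * \<tau> * ((z0 - c) \<bullet> b) + \<tau>\<^sup>2
            + (?n + 1) * (r * (s z0 + \<tau> * (b \<bullet> e)) - (s z0 + \<tau> * (b \<bullet> e))\<^sup>2))" for \<tau>
      proof -
        have "(norm (z0 + \<tau> *\<^sub>R b - c))\<^sup>2 = (norm (z0 - c))\<^sup>2 + 2 * \<tau> * ((z0 - c) \<bullet> b) + \<tau>\<^sup>2"
          unfolding power2_norm_eq_inner
          by (simp add: algebra_simps inner_add_left inner_add_right inner_diff_left inner_diff_right bb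
              inner_commute power2_eq_square)
        moreover have "s (z0 + \<tau> *\<^sub>R b) = s z0 + \<tau> * (b \<bullet> e)"
          by (simp add: s_def algebra_simps inner_add_left inner_diff_left)
        ultimately show ?thesis by (simp add: v_def B_def Rlin)
      qed
      have line: "((\<lambda>\<tau>. u (p + \<tau> *\<^sub>R q)) has_real_derivative g (p + \<tau> *\<^sub>R q) \<bullet> q) (at \<tau>)"
        if "p + \<tau> *\<^sub>R q \<in> D" for p q \<tau>
      proof -
        have "((\<lambda>\<tau>. p + \<tau> *\<^sub>R q) has_derivative (\<lambda>h. h *\<^sub>R q)) (at \<tau>)"
          by (auto intro!: derivative_eq_intros)
        from has_derivative_compose[OF this g[OF that]] show ?thesis
          by (simp add: has_field_derivative_def mult.commute[of "g _ \<bullet> _"] mult_commute_abs)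
      qed
      have line': "((\<lambda>\<tau>. g (p + \<tau> *\<^sub>R q) \<bullet> q) has_real_derivative blinfun_apply (H p) q \<bullet> q) (at 0)"
        if "p \<in> D" for p q
      proof -
        have "((\<lambda>\<tau>. p + \<tau> *\<^sub>R q) has_derivative (\<lambda>h. h *\<^sub>R q)) (at 0)"
          by (auto intro!: derivative_eq_intros)
        from has_derivative_compose[OF this, of g "blinfun_apply (H p)"]
        have "((\<lambda>\<tau>. g (p + \<tau> *\<^sub>R q)) has_derivative (\<lambda>h. h *\<^sub>R blinfun_apply (H p) q)) (at 0)"
          using H[OF that] by (simp add: blinfun.scaleR_right)
        from has_derivative_inner_left[OF this, of q] show ?thesis
          by (simp add: has_field_derivative_def mult_commute_abs)
      qed
      show "((\<lambda>\<tau>. v (z0 + \<tau> *\<^sub>R b)) has_real_derivative \<phi>' \<tau>) (at \<tau>)" if "\<bar>\<tau>\<bar> < \<delta>" for \<tau>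
        unfolding vline \<phi>'_def
        by ((rule derivative_eq_intros line refl | (use mem[OF that] memR[OF that] D in force))+,
           (simp_all add: power2_eq_square algebra_simps)?)
      show "(\<phi>' has_real_derivative blinfun_apply (H z0) b \<bullet> b - blinfun_apply (H (R z0)) (\<rho> b) \<bullet> \<rho> b
        - k * (2 - 2 * (?n + 1) * (b \<bullet> e)\<^sup>2)) (at 0)"
        unfolding \<phi>'_def[abs_def]
        by ((rule derivative_eq_intros line' refl | (use mem[of 0] memR[of 0] D \<delta>(1) in force))+,
           (simp_all add: power2_eq_square algebra_simps)?)
      show "v (z0 + \<tau> *\<^sub>R b) \<le> v (z0 + 0 *\<^sub>R b)" if "\<bar>\<tau>\<bar> < \<delta>" for \<tau>
        using z0(2)[of "z0 + \<tau> *\<^sub>R b"] mem[OF that] by (simp add: K_def less_imp_le)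
    qed
    \<comment> \<open>Both Hessian traces vanish, so this sum is the Laplacian of
      \<open>- B\<close>, that is 2 k > 0: the coefficient n + 1 in the barrier is taken just above
      n for this contradiction.\<close>
    have "(\<Sum>b\<in>Basis. blinfun_apply (H z0) b \<bullet> b - blinfun_apply (H (R z0)) (\<rho> b) \<bullet> \<rho> b
        - k * (2 - 2 * (?n + 1) * (b \<bullet> e)\<^sup>2)) \<le> 0"
      by (intro sum_nonpos 2)
    moreover have "(\<Sum>b\<in>Basis. blinfun_apply (H (R z0)) (\<rho> b) \<bullet> \<rho> b) = 0"
    proof -
      have "R z0 \<in> D" using Rball[OF z0c(1)] D by blast
      moreover have "linear (blinfun_apply (H (R z0)))"
        by (rule bounded_linear.linear[OF blinfun.bounded_linear_right])
      ultimately show ?thesis unfolding \<rho>_def using trace_reflection[OF _ e] tr by simp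
    qed
    moreover have "(\<Sum>b\<in>Basis. blinfun_apply (H z0) b \<bullet> b) = 0" using tr z0c D by blast
    moreover have "(\<Sum>b\<in>(Basis::'a set). (b \<bullet> e)\<^sup>2) = 1"
      using euclidean_inner[of e e] ee by (simp add: inner_commute power2_eq_square)
    moreover from this have "(\<Sum>b\<in>(Basis::'a set). k * (2 - 2 * (?n + 1) * (b \<bullet> e)\<^sup>2)) = k * (2 * ?n - 2 * (?n + 1))"
      by (simp add: sum_subtractf sum_distrib_left[symmetric])
    ultimately have "0 \<le> k * (2 * ?n - 2 * (?n + 1))"
      by (simp only: sum_subtractf)
    also have "k * (2 * ?n - 2 * (?n + 1)) = - 2 * k" by (simp add: algebra_simps)
    finally show False using k by simp
  qed
  define z where "z = c + t *\<^sub>R e"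
  have "z \<in> K" using \<open>0 \<le> t\<close> \<open>t \<le> r\<close> e ee by (simp add: K_def z_def s_def dist_norm)
  then have "v z \<le> 0" using z0(2) \<open>v z0 \<le> 0\<close> by force
  moreover have "R z = c - t *\<^sub>R e" by (simp add: R_def \<rho>_def z_def ee algebra_simps flip: scaleR_add_left)
  moreover have "s z = t" "norm (z - c) = t" using \<open>0 \<le> t\<close> e ee by (simp_all add: s_def z_def)
  ultimately have "u (c + t *\<^sub>R e) - u (c - t *\<^sub>R e) \<le> k * (t\<^sup>2 + (?n + 1) * (r * t - t\<^sup>2))"
    by (simp add: v_def B_def z_def)
  \<comment> \<open>The quadratic part t^2 - (n + 1) t^2 is nonpositive and dropped; the rest is
    linear in t, as a gradient bound requires.\<close>
  also have "\<dots> \<le> k * ((?n + 1) * (r * t))"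
    using k by (intro mult_left_mono) (auto simp: algebra_simps mult_nonneg_nonneg)
  also have "\<dots> = 2 * M * (?n + 1) * t / r"
    using \<open>r > 0\<close> by (simp add: k_def power2_eq_square field_simps)
  finally show ?thesis by (simp add: add.commute)
qed

text \<open>Any two points are symmetric about their midpoint, so the reflection estimate is already
  a Lipschitz bound; no gradient has to be estimated and integrated along the segment.\<close>

lemma harmonic_diff_le:
  fixes u :: "'a::euclidean_space \<Rightarrow> real"
  assumes harm: "harmonic_on D u" and D: "cball ((1/2) *\<^sub>R (x + y)) r \<subseteq> D" and "r > 0" "M > 0"
    and M: "\<And>z. z \<in> cball ((1/2) *\<^sub>R (x + y)) r \<Longrightarrow> \<bar>u z\<bar> \<le> M" and "norm (x - y) \<le> 2 * r"
  shows "u x - u y \<le> M * (DIM('a) + 1) * norm (x - y) / r"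
proof (cases "x = y")
  case False
  define e where "e = (1 / norm (x - y)) *\<^sub>R (x - y)"
  define t where "t = norm (x - y) / 2"
  define c where "c = (1/2) *\<^sub>R (x + y)"
  have te: "t *\<^sub>R e = (1/2) *\<^sub>R (x - y)" using False by (simp add: t_def e_def)
  have "c + t *\<^sub>R e = x" "c - t *\<^sub>R e = y"
    unfolding te by (simp_all add: c_def algebra_simps flip: scaleR_add_left)
  moreover have "norm e = 1" using False by (simp add: e_def)
  ultimately show ?thesis
    using harmonic_symmetric_difference_le[OF harm D \<open>r > 0\<close> \<open>M > 0\<close> M, of e t] \<open>norm (x - y) \<le> 2 * r\<close>
    by (simp add: t_def c_def)
qed simp

section \<open>Separation by image spheres\<close>

lemma connected_shell:
  fixes w :: "'a::euclidean_space"
  assumes "2 \<le> DIM('a)"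
  shows "connected {x. a < dist w x \<and> dist w x < b}"
  using connected_annulus(1)[OF assms, of a w b] by (simp add: dist_norm norm_minus_commute)

lemma shell_nonempty:
  fixes w :: "'a::euclidean_space"
  assumes "0 \<le> a" "a < b"
  shows "{x. a < dist w x \<and> dist w x < b} \<noteq> {}"
proof -
  obtain v :: 'a where "norm v = (a + b) / 2" using vector_choose_size[of "(a + b) / 2"] assms by auto
  then have "w + v \<in> {x. a < dist w x \<and> dist w x < b}" using assms by (simp add: dist_norm)
  then show ?thesis by blast
qed

lemma sphere_collar:
  fixes w :: "'a::euclidean_space"
  assumes "open V" "sphere w t \<subseteq> V" "t > 0"
  obtains d where "0 < d" "d < t" "{x. t - d < dist w x \<and> dist w x < t + d} \<subseteq> V"
proof -
  obtain e where e: "e > 0" "(\<Union>x\<in>sphere w t. ball x e) \<subseteq> V"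
    using compact_subset_open_imp_ball_epsilon_subset[OF compact_sphere assms(1,2)] by blast
  define d where "d = min e (t / 2)"
  have "x \<in> V" if x: "t - d < dist w x" "dist w x < t + d" for x
  proof -
    have "d \<le> t / 2" by (simp add: d_def)
    then have pos: "dist w x > 0" using x(1) \<open>t > 0\<close> by linarith
    define p where "p = w + (t / dist w x) *\<^sub>R (x - w)"
    have "dist w p = t" using pos \<open>t > 0\<close> by (simp add: p_def dist_norm norm_minus_commute)
    have "x - p = (1 - t / dist w x) *\<^sub>R (x - w)" by (simp add: p_def algebra_simps)
    then have "dist p x = \<bar>1 - t / dist w x\<bar> * dist w x"
      by (simp add: dist_norm norm_minus_commute[of p x] norm_minus_commute[of w x])
    also have "\<dots> = \<bar>(1 - t / dist w x) * dist w x\<bar>" by (simp add: abs_mult)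
    also have "(1 - t / dist w x) * dist w x = dist w x - t" using pos by (simp add: field_simps)
    finally have "dist p x < e" using x by (simp add: d_def abs_if split: if_splits)
    moreover have "p \<in> sphere w t" using \<open>dist w p = t\<close> by simp
    ultimately show ?thesis using e(2) by (meson UN_I mem_ball subsetD)
  qed
  then show ?thesis using e(1) \<open>t > 0\<close> by (intro that[of d]) (auto simp: d_def)
qed

text \<open>If \<open>X\<close> splits into open parts, the connected collar \<open>C\<close> lies
  in one of them. The set \<open>T\<close> covers the rest of \<open>V\<close> and meets
  \<open>X\<close> only inside \<open>C\<close>, so adding it to that part leaves the other part
  untouched and splits \<open>V\<close>.\<close>

lemma connected_piece_with_collar:
  assumes V: "connected V" "open V" and X: "open X" "X \<subseteq> V"
    and C: "connected C" "C \<subseteq> X" and T: "open T" "V \<subseteq> X \<union> T" "X \<inter> T \<subseteq> C" "T \<inter> V \<noteq> {}"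
  shows "connected X"
proof (rule ccontr)
  assume "\<not> connected X"
  then obtain A0 B0 where AB0: "open A0" "open B0" "X \<subseteq> A0 \<union> B0" "A0 \<inter> B0 \<inter> X = {}" "A0 \<inter> X \<noteq> {}" "B0 \<inter> X \<noteq> {}"
    unfolding connected_def by blast
  obtain A B where AB: "open A" "open B" "X = A \<union> B" "A \<inter> B = {}" "B \<noteq> {}" "C \<subseteq> A"
  proof (cases "C \<subseteq> A0")
    case True
    then show ?thesis using AB0 X C(2) by (intro that[of "A0 \<inter> X" "B0 \<inter> X"]) auto
  next
    case False
    then have "C \<subseteq> B0"
      using connectedD[OF C(1) AB0(1,2)] AB0(3,4) C(2) by blast
    then show ?thesis using AB0 X C(2) by (intro that[of "B0 \<inter> X" "A0 \<inter> X"]) auto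
  qed
  have "B \<inter> (A \<union> (V \<inter> T)) = {}" using AB T(3) by blast
  moreover have "V \<subseteq> B \<union> (A \<union> (V \<inter> T))" using AB T(2) by blast
  moreover have "B \<inter> V \<noteq> {}" "(A \<union> (V \<inter> T)) \<inter> V \<noteq> {}" using AB X(2) T(4) by blast+
  ultimately show False
    using connectedD[OF V(1), of B "A \<union> (V \<inter> T)"] AB(1,2) V(2) T(1) by blast
qed

text \<open>Each side contains a thin shell along the sphere, connected in dimension at least 2,
  which serves as the collar. Pulled back by \<open>g\<close>, the two pieces become the connected
  sets \<open>P\<close> and \<open>N\<close> of \<open>trapped_sphere\<close>.\<close>

lemma connected_Int_ball_and_Diff_cball:
  fixes w :: "'a::euclidean_space"
  assumes dim: "2 \<le> DIM('a)" and V: "connected V" "open V" and S: "sphere w t \<subseteq> V" and "t > 0"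
  shows "connected (V \<inter> ball w t)" "connected (V - cball w t)"
proof -
  obtain d where d: "0 < d" "d < t" "{x. t - d < dist w x \<and> dist w x < t + d} \<subseteq> V"
    using sphere_collar[OF V(2) S \<open>t > 0\<close>] .
  have "sphere w t \<noteq> {}" using \<open>t > 0\<close> by simp
  then obtain p where "p \<in> sphere w t" by blast
  then have p: "p \<in> V" "dist w p = t" using S by auto
  have o: "open {x. a < dist w x}" for a by (intro open_Collect_less continuous_intros)
  show "connected (V \<inter> ball w t)"
  proof (rule connected_piece_with_collar[OF V _ _ connected_shell[OF dim, of "t - d" w t]])
    show "open {x. t - d < dist w x}" by (rule o)
    have "p \<in> {x. t - d < dist w x} \<inter> V" using p d by simp
    then show "{x. t - d < dist w x} \<inter> V \<noteq> {}" by blast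
  qed (use d V in \<open>auto simp: open_Int\<close>)
  show "connected (V - cball w t)"
  proof (rule connected_piece_with_collar[OF V _ _ connected_shell[OF dim, of t w "t + d"]])
    show "open (ball w (t + d))" by simp
    have "p \<in> ball w (t + d) \<inter> V" using p d by simp
    then show "ball w (t + d) \<inter> V \<noteq> {}" by blast
  qed (use d V in \<open>auto simp: open_Diff\<close>)
qed

section \<open>Topology near a boundary point with controlled values\<close>

text \<open>Here \<open>r0\<close> is the distance k d of the overview and \<open>\<rho>0\<close>
  the bound L (k d)^\<alpha>. Modulus inequalities are kept out of the locale, so the separation
  statements are purely topological.\<close>

locale boundary_trap =
  fixes D :: "'a::euclidean_space set" and f g :: "'a \<Rightarrow> 'a" and x0 :: 'a and r0 \<rho>0 :: real
  assumes dim: "2 \<le> DIM('a)"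
    and D: "open D" "connected D" "bounded D"
    and contf: "continuous_on (closure D) f"
    and hom: "homeomorphism D (f ` D) f g"
    and openV: "open (f ` D)"
    and trap: "\<And>\<zeta>. \<zeta> \<in> frontier D \<Longrightarrow> dist x0 \<zeta> \<le> r0 \<Longrightarrow> dist (f x0) (f \<zeta>) \<le> \<rho>0"
    and x0: "x0 \<in> frontier D" and r0: "0 < r0"
begin

abbreviation "w0 \<equiv> f x0"

lemma rho0: "0 \<le> \<rho>0"
  using trap[OF x0] r0 by simp

lemma gf [simp]: "z \<in> D \<Longrightarrow> g (f z) = z"
  using hom by (simp add: homeomorphism_apply1)

lemma fg [simp]: "w \<in> f ` D \<Longrightarrow> f (g w) = w"
  using hom by (simp add: homeomorphism_apply2)

lemma gD: "w \<in> f ` D \<Longrightarrow> g w \<in> D"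
  using hom by (auto simp: homeomorphism_def)

lemma contg: "continuous_on (f ` D) g"
  using hom by (simp add: homeomorphism_def)

lemma contfD: "continuous_on D f"
  using hom by (simp add: homeomorphism_def)

lemma connV: "connected (f ` D)"
  using D(2) contfD by (rule connected_continuous_image[rotated])

lemma g_image_eq: "A \<subseteq> f ` D \<Longrightarrow> g ` A = {z \<in> D. f z \<in> A}"
proof (intro equalityI subsetI)
  fix z assume A: "A \<subseteq> f ` D" and "z \<in> g ` A"
  then obtain w where "w \<in> A" "z = g w" by blast
  with A show "z \<in> {z \<in> D. f z \<in> A}" using gD[of w] fg[of w] by auto
next
  fix z assume "z \<in> {z \<in> D. f z \<in> A}"
  then have "z = g (f z)" "f z \<in> A" by auto
  then show "z \<in> g ` A" by blast
qed

lemma open_g_image: "open A \<Longrightarrow> A \<subseteq> f ` D \<Longrightarrow> open (g ` A)"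
  using continuous_open_preimage[OF contfD D(1), of A] by (simp add: g_image_eq vimage_def Int_def)

lemma open_image: "open U \<Longrightarrow> U \<subseteq> D \<Longrightarrow> open (f ` U)"
  using homeomorphism_imp_open_map[OF hom, of U] D(1) openV by (metis openin_open_eq)

text \<open>A boundary point of the image inside \<open>X\<close> would be the value of \<open>f\<close> at a boundary point near \<open>x0\<close>.\<close>

lemma subset_image_of_trapped:
  assumes "connected X" "X \<inter> f ` D \<noteq> {}" "\<And>w. w \<in> X \<Longrightarrow> \<rho>0 < dist w0 w"
    and tr: "g ` (X \<inter> f ` D) \<subseteq> cball x0 r0"
  shows "X \<subseteq> f ` D"
proof -
  have "X \<inter> f ` D = X \<inter> f ` (closure D \<inter> cball x0 r0)"
  proof (intro equalityI subsetI)
    fix w assume w: "w \<in> X \<inter> f ` D"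
    then have "g w \<in> closure D \<inter> cball x0 r0" "f (g w) = w"
      using tr gD closure_subset by (blast, simp)
    then show "w \<in> X \<inter> f ` (closure D \<inter> cball x0 r0)" using w by (metis IntD1 IntI imageI)
  next
    fix w assume w: "w \<in> X \<inter> f ` (closure D \<inter> cball x0 r0)"
    then obtain \<zeta> where z: "\<zeta> \<in> closure D" "dist x0 \<zeta> \<le> r0" "w = f \<zeta>" by auto
    have "\<zeta> \<in> D"
    proof (rule ccontr)
      assume "\<zeta> \<notin> D"
      then have "\<zeta> \<in> frontier D" using z D(1) by (simp add: frontier_def interior_open)
      then show False using trap[of \<zeta>] z assms(3)[of w] w by force
    qed
    then show "w \<in> X \<inter> f ` D" using w z by blast
  qed
  moreover have "compact (f ` (closure D \<inter> cball x0 r0))"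
    using D(3) by (intro compact_continuous_image continuous_on_subset[OF contf] compact_Int_closed) auto
  ultimately have "closedin (top_of_set X) (X \<inter> f ` D)"
    using compact_imp_closed closedin_closed_Int by metis
  moreover have "openin (top_of_set X) (X \<inter> f ` D)" using openV by blast
  ultimately show ?thesis using assms(1,2) unfolding connected_clopen by blast
qed

lemma unbounded_not_subset_image: "\<not> bounded X \<Longrightarrow> \<not> X \<subseteq> f ` D"
proof
  assume "\<not> bounded X" "X \<subseteq> f ` D"
  moreover have "compact (f ` closure D)"
    using D(3) by (intro compact_continuous_image contf) auto
  ultimately show False
    by (meson bounded_subset closure_subset compact_imp_bounded image_mono)
qed

lemma unbounded_Compl_cball: "\<not> bounded (- cball (w::'a) t)"
  using cobounded_imp_unbounded[of "- cball w t"] by simp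

text \<open>
  Each component of the complement of \<open>\<Sigma>\<close> has frontier \<open>\<Sigma>\<close>, hence meets \<open>D\<close> and contains the preimage of
  the interior or of the exterior of the sphere. The exterior cannot be the one inside \<open>\<Sigma>\<close>, since
  then the unbounded set \<open>- cball w0 t\<close> would lie in the image.
\<close>

lemma trapped_sphere:
  fixes t
  assumes t: "\<rho>0 < t" and S: "sphere w0 t \<subseteq> f ` (D \<inter> ball x0 r0)"
  defines "\<Sigma> \<equiv> g ` sphere w0 t"
  shows "compact \<Sigma>" "\<Sigma> \<subseteq> D" "connected (inside \<Sigma>)" "frontier (inside \<Sigma>) = \<Sigma>" "frontier (outside \<Sigma>) = \<Sigma>"
    "D \<inter> inside \<Sigma> = {z \<in> D. dist w0 (f z) < t}" "D \<inter> outside \<Sigma> = {z \<in> D. t < dist w0 (f z)}"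
    "{w. \<rho>0 < dist w0 w \<and> dist w0 w < t} \<subseteq> f ` D"
    "{z \<in> D. dist w0 (f z) < t} \<subseteq> ball x0 r0"
proof -
  have "t > 0" using t rho0 by simp
  have SV: "sphere w0 t \<subseteq> f ` D" using S by blast
  have homS: "homeomorphism (sphere w0 t) \<Sigma> g f"
    using homeomorphism_of_subsets[OF homeomorphism_symD[OF hom] SV, of \<Sigma>] gD SV
    unfolding \<Sigma>_def by (metis image_subset_iff subset_iff order_refl)
  then have homeo: "\<Sigma> homeomorphic sphere w0 t"
    using homeomorphic_def homeomorphic_sym by blast
  show comp: "compact \<Sigma>"
    unfolding \<Sigma>_def by (intro compact_continuous_image continuous_on_subset[OF contg SV]) auto
  have \<Sigma>eq: "\<Sigma> = {z \<in> D. dist w0 (f z) = t}" unfolding \<Sigma>_def g_image_eq[OF SV] by auto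
  then show \<Sigma>D: "\<Sigma> \<subseteq> D" by blast
  have \<Sigma>ball: "\<Sigma> \<subseteq> ball x0 r0" using S by (auto simp: \<Sigma>_def)
  have \<Sigma>ne: "\<Sigma> \<noteq> {}" using \<open>t > 0\<close> by (simp add: \<Sigma>_def)
  define P where "P = {z \<in> D. dist w0 (f z) < t}"
  define N where "N = {z \<in> D. t < dist w0 (f z)}"
  have "P = g ` (f ` D \<inter> ball w0 t)" by (subst g_image_eq) (auto simp: P_def)
  then have connP: "connected P"
    using connected_Int_ball_and_Diff_cball(1)[OF dim connV openV SV \<open>t > 0\<close>]
    by (metis connected_continuous_image continuous_on_subset contg inf_le1)
  have "N = g ` (f ` D - cball w0 t)" by (subst g_image_eq) (auto simp: N_def)
  then have connN: "connected N"
    using connected_Int_ball_and_Diff_cball(2)[OF dim connV openV SV \<open>t > 0\<close>]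
    by (metis connected_continuous_image continuous_on_subset contg Diff_subset)
  have PN: "P \<union> N = D - \<Sigma>" "P \<inter> N = {}" by (auto simp: P_def N_def \<Sigma>eq)
  have bd: "bounded \<Sigma>" using comp compact_imp_bounded by blast
  have outc: "outside \<Sigma> \<in> components (- \<Sigma>)"
    using connected_outside[OF bd dim] unbounded_outside[OF bd] by (auto simp: outside_in_components)
  have fr: "frontier C = \<Sigma>" if "C \<in> components (- \<Sigma>)" for C
    by (rule Jordan_Brouwer_frontier[OF homeo that dim])
  have meets: "P \<noteq> {} \<and> P \<subseteq> C \<or> N \<noteq> {} \<and> N \<subseteq> C" and meets': "C \<inter> D \<noteq> {}" if C: "C \<in> components (- \<Sigma>)" for C
  proof -
    obtain p where "p \<in> \<Sigma>" using \<Sigma>ne by blast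
    then have "p \<in> closure C" "p \<in> D" using fr[OF C] \<Sigma>D by (auto simp: frontier_def)
    then have "C \<inter> D \<noteq> {}" using D(1) open_Int_closure_eq_empty[of D C] by blast
    then show "C \<inter> D \<noteq> {}" .
    moreover have "C \<subseteq> - \<Sigma>" using C by (rule in_components_subset)
    ultimately have "C \<inter> P \<noteq> {} \<or> C \<inter> N \<noteq> {}" using PN by blast
    then show "P \<noteq> {} \<and> P \<subseteq> C \<or> N \<noteq> {} \<and> N \<subseteq> C"
      using components_maximal[OF C connP] components_maximal[OF C connN] PN by blast
  qed
  have "inside \<Sigma> \<noteq> {}"
  proof
    assume "inside \<Sigma> = {}"
    then have "outside \<Sigma> = - \<Sigma>" using inside_Un_outside[of \<Sigma>] by blast
    then show False
      using Jordan_Brouwer_separation[OF homeo \<open>t > 0\<close>] connected_outside[OF bd dim] by simp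
  qed
  then obtain y where y: "y \<in> inside \<Sigma>" by blast
  define C where "C = connected_component_set (- \<Sigma>) y"
  have ycompl: "y \<in> - \<Sigma>" using y inside_no_overlap by blast
  have C: "C \<in> components (- \<Sigma>)" unfolding C_def components_def using ycompl by blast
  have Cne: "C \<noteq> outside \<Sigma>"
    using y ycompl inside_Int_outside[of \<Sigma>] by (metis C_def IntI connected_component_refl empty_iff mem_Collect_eq)
  \<comment> \<open>Three different components would be pairwise disjoint, yet each contains one of
    the nonempty pieces among \<open>P\<close> and \<open>N\<close>; there is room for only
    two.\<close>
  have uniq: "C' = C" if C': "C' \<in> components (- \<Sigma>)" "C' \<noteq> outside \<Sigma>" for C'
  proof (rule ccontr)
    assume "C' \<noteq> C"
    then have "C \<inter> C' = {}" "C \<inter> outside \<Sigma> = {}" "C' \<inter> outside \<Sigma> = {}"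
      using components_nonoverlap[OF C C'(1)] components_nonoverlap[OF C outc]
        components_nonoverlap[OF C'(1) outc] C' Cne by auto
    then show False using meets[OF C] meets[OF C'(1)] meets[OF outc] by blast
  qed
  have "inside \<Sigma> = C"
  proof (intro equalityI subsetI)
    fix z assume z: "z \<in> inside \<Sigma>"
    then have zc: "z \<in> - \<Sigma>" using inside_no_overlap by blast
    have "connected_component_set (- \<Sigma>) z = C"
    proof (rule uniq)
      show "connected_component_set (- \<Sigma>) z \<in> components (- \<Sigma>)" using zc by (auto simp: components_def)
      show "connected_component_set (- \<Sigma>) z \<noteq> outside \<Sigma>"
        using z zc inside_Int_outside[of \<Sigma>] by (metis IntI connected_component_refl empty_iff mem_Collect_eq)
    qed
    then show "z \<in> C" using zc by (metis connected_component_refl mem_Collect_eq)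
  next
    fix z assume z: "z \<in> C"
    then have "z \<in> - \<Sigma>" "z \<notin> outside \<Sigma>"
      using in_components_subset[OF C] components_nonoverlap[OF C outc] Cne by blast+
    then show "z \<in> inside \<Sigma>" by (metis UnE inside_Un_outside)
  qed
  then have inc: "inside \<Sigma> \<in> components (- \<Sigma>)" using C by simp
  then show "connected (inside \<Sigma>)" using in_components_connected by blast
  show "frontier (inside \<Sigma>) = \<Sigma>" "frontier (outside \<Sigma>) = \<Sigma>" using fr inc outc by auto
  have insball: "inside \<Sigma> \<subseteq> ball x0 r0"
    using outside_subset_convex[OF convex_ball \<Sigma>ball] inside_Int_outside[of \<Sigma>] by blast
  have "\<not> N \<subseteq> inside \<Sigma>"
  proof
    assume N: "N \<subseteq> inside \<Sigma>"
    have "N \<noteq> {}"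
    proof
      assume "N = {}"
      then show False using meets[OF inc] meets[OF outc] inside_Int_outside[of \<Sigma>] by blast
    qed
    then obtain z where z: "z \<in> D" "t < dist w0 (f z)" by (auto simp: N_def)
    have "- cball w0 t \<subseteq> f ` D"
    proof (rule subset_image_of_trapped)
      show "connected (- cball w0 t)" by (rule connected_complement_bounded_convex) (use dim in auto)
      have "f z \<in> - cball w0 t \<inter> f ` D" using z by simp
      then show "- cball w0 t \<inter> f ` D \<noteq> {}" by blast
      have "g ` (- cball w0 t \<inter> f ` D) \<subseteq> N" by (auto simp: N_def)
      then show "g ` (- cball w0 t \<inter> f ` D) \<subseteq> cball x0 r0" using N insball by force
    qed (use t in auto)
    then show False using unbounded_not_subset_image[OF unbounded_Compl_cball] by blast
  qed
  then have "P \<subseteq> inside \<Sigma>" using meets[OF inc] by blast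
  have "N \<subseteq> outside \<Sigma>" using meets[OF outc] \<open>P \<subseteq> inside \<Sigma>\<close> inside_Int_outside[of \<Sigma>] by blast
  show "D \<inter> inside \<Sigma> = {z \<in> D. dist w0 (f z) < t}" "D \<inter> outside \<Sigma> = {z \<in> D. t < dist w0 (f z)}"
    using \<open>P \<subseteq> inside \<Sigma>\<close> \<open>N \<subseteq> outside \<Sigma>\<close> PN inside_Int_outside[of \<Sigma>] inside_no_overlap[of \<Sigma>] outside_no_overlap[of \<Sigma>]
    unfolding P_def[symmetric] N_def[symmetric] by blast+
  show Pball: "{z \<in> D. dist w0 (f z) < t} \<subseteq> ball x0 r0"
    using \<open>P \<subseteq> inside \<Sigma>\<close> insball by (auto simp: P_def)
  \<comment> \<open>The shell is trapped as well: the preimage of its part in the image lies in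
    \<open>P\<close>, hence in the ball, and the collar just below the sphere shows that this part
    is nonempty.\<close>
  show "{w. \<rho>0 < dist w0 w \<and> dist w0 w < t} \<subseteq> f ` D"
  proof (rule subset_image_of_trapped)
    show "connected {w. \<rho>0 < dist w0 w \<and> dist w0 w < t}" by (rule connected_shell[OF dim])
    obtain d where d: "0 < d" "d < t" "{x. t - d < dist w0 x \<and> dist w0 x < t + d} \<subseteq> f ` D"
      using sphere_collar[OF openV SV \<open>t > 0\<close>] .
    have "0 \<le> max \<rho>0 (t - d)" "max \<rho>0 (t - d) < t" using t d(1) rho0 by auto
    from shell_nonempty[OF this, of w0] obtain x where "max \<rho>0 (t - d) < dist w0 x" "dist w0 x < t"
      by blast
    then show "{w. \<rho>0 < dist w0 w \<and> dist w0 w < t} \<inter> f ` D \<noteq> {}" using d by force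
    show "g ` ({w. \<rho>0 < dist w0 w \<and> dist w0 w < t} \<inter> f ` D) \<subseteq> cball x0 r0"
      using Pball by (force simp: gD)
  qed auto
qed

end

section \<open>The ring between two preimages of spheres\<close>

lemma connected_components_of_two:
  assumes "topspace Y = A \<union> B" "A \<inter> B = {}" "closedin Y A" "closedin Y B"
    and "connectedin Y A" "connectedin Y B" "A \<noteq> {}" "B \<noteq> {}"
  shows "connected_components_of Y = {A, B}"
proof -
  have comp: "connected_component_of_set Y x = S"
    if S: "closedin Y S" "openin Y S" "connectedin Y S" "x \<in> S" for S x
  proof
    show "connected_component_of_set Y x \<subseteq> S"
      using connectedin_clopen_cases[OF connectedin_connected_component_of S(1,2), of x] S
      by (metis connected_component_of_refl closedin_subset disjnt_iff mem_Collect_eq subset_iff)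
    show "S \<subseteq> connected_component_of_set Y x"
      using connected_component_of_maximal[OF S(3,4)] .
  qed
  have "B = topspace Y - A" "A = topspace Y - B" using assms(1,2) by auto
  then have "openin Y A" "openin Y B" using assms(3,4) by (metis openin_closedin_eq closedin_def)+
  then have "\<And>x. x \<in> A \<Longrightarrow> connected_component_of_set Y x = A"
    "\<And>x. x \<in> B \<Longrightarrow> connected_component_of_set Y x = B"
    using comp assms by auto
  then show ?thesis
    unfolding connected_components_of_def assms(1) using assms(7,8) by (auto simp: image_Un image_iff)
qed

context boundary_trap
begin

text \<open>Both spheres are trapped, so the complement of \<open>W\<close> consists of the closed
  inside of \<open>\<Sigma>a\<close> and the closed outside of \<open>\<Sigma>t\<close> together
  with infinity. The first contains \<open>x0\<close>; the second contains \<open>x\<close> and is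
  unbounded, so it meets the frontier of the bounded set \<open>D\<close>.\<close>

lemma trapped_shell_ring:
  assumes a: "\<rho>0 < a" "a < t" and S: "sphere w0 t \<subseteq> f ` (D \<inter> ball x0 r0)"
    and x: "x \<in> D" "t < dist w0 (f x)"
  defines "W \<equiv> {z \<in> D. a < dist w0 (f z) \<and> dist w0 (f z) < t}"
  shows "is_ring (Some ` W)" "ring_separates (Some ` W) (frontier D)"
    "\<And>I \<gamma>. (I, \<gamma>) \<in> ring_curves (Some ` W) \<Longrightarrow> curve_in D (I, \<gamma>) \<and>
      (\<exists>s\<in>I. dist w0 (f (\<gamma> s)) = a) \<and> (\<exists>s\<in>I. dist w0 (f (\<gamma> s)) = t)"
proof -
  have tr: "\<rho>0 < t" using a by simp
  note T = trapped_sphere[OF tr S]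
  have Sa: "sphere w0 a \<subseteq> f ` (D \<inter> ball x0 r0)"
  proof
    fix w assume "w \<in> sphere w0 a"
    then have w: "dist w0 w = a" by simp
    then obtain z where "z \<in> D" "w = f z" using T(8) a by blast
    then show "w \<in> f ` (D \<inter> ball x0 r0)" using T(9) w a by blast
  qed
  note A = trapped_sphere[OF a(1) Sa]
  define \<Sigma>a \<Sigma>t where "\<Sigma>a = g ` sphere w0 a" and "\<Sigma>t = g ` sphere w0 t"
  note T = T[folded \<Sigma>t_def] and A = A[folded \<Sigma>a_def]
  have \<Sigma>a: "\<Sigma>a = {z \<in> D. dist w0 (f z) = a}" and \<Sigma>t: "\<Sigma>t = {z \<in> D. dist w0 (f z) = t}"
  proof -
    have "sphere w0 a \<subseteq> f ` D" "sphere w0 t \<subseteq> f ` D" using S Sa by blast+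
    then show "\<Sigma>a = {z \<in> D. dist w0 (f z) = a}" "\<Sigma>t = {z \<in> D. dist w0 (f z) = t}"
      unfolding \<Sigma>a_def \<Sigma>t_def by (simp_all add: g_image_eq)
  qed
  define Ca Ct where "Ca = \<Sigma>a \<union> inside \<Sigma>a" and "Ct = \<Sigma>t \<union> outside \<Sigma>t"
  have clCa: "Ca = closure (inside \<Sigma>a)" "Ct = closure (outside \<Sigma>t)"
    unfolding Ca_def Ct_def closure_Un_frontier A(4) T(5) by auto
  have bd: "bounded \<Sigma>a" "bounded \<Sigma>t" using A(1) T(1) compact_imp_bounded by auto
  have "\<Sigma>t \<subseteq> outside \<Sigma>a" "\<Sigma>a \<subseteq> inside \<Sigma>t" using A(7) T(6) a unfolding \<Sigma>t \<Sigma>a by auto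
  have xo: "x \<in> outside \<Sigma>a" "x \<in> outside \<Sigma>t" using A(7) T(7) x a by auto
  have comp: "outside \<Sigma>a \<in> components (- \<Sigma>a)"
    using connected_outside[OF bd(1) dim] xo by (auto simp: outside_in_components)
  have "outside \<Sigma>t \<subseteq> outside \<Sigma>a"
  proof (rule components_maximal[OF comp connected_outside[OF bd(2) dim]])
    show "outside \<Sigma>t \<subseteq> - \<Sigma>a" using \<open>\<Sigma>a \<subseteq> inside \<Sigma>t\<close> inside_Int_outside[of \<Sigma>t] by blast
    show "outside \<Sigma>a \<inter> outside \<Sigma>t \<noteq> {}" using xo by blast
  qed
  then have CtOa: "Ct \<subseteq> outside \<Sigma>a" using \<open>\<Sigma>t \<subseteq> outside \<Sigma>a\<close> by (simp add: Ct_def)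
  have CaCt: "Ca \<inter> Ct = {}"
    using CtOa inside_Int_outside[of \<Sigma>a] outside_no_overlap[of \<Sigma>a] unfolding Ca_def by blast
  define Kc where "Kc = {z \<in> D. a \<le> dist w0 (f z) \<and> dist w0 (f z) \<le> t}"
  have shell: "{w. a \<le> dist w0 w \<and> dist w0 w \<le> t} \<subseteq> f ` D"
  proof
    fix w assume "w \<in> {w. a \<le> dist w0 w \<and> dist w0 w \<le> t}"
    then consider "\<rho>0 < dist w0 w \<and> dist w0 w < t" | "w \<in> sphere w0 t" using a by force
    then show "w \<in> f ` D" using T(8) S by cases auto
  qed
  have "Kc = g ` {w. a \<le> dist w0 w \<and> dist w0 w \<le> t}" unfolding Kc_def by (subst g_image_eq[OF shell]) auto
  moreover have "compact {w. a \<le> dist w0 w \<and> dist w0 w \<le> t}"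
  proof -
    have "{w. a \<le> dist w0 w \<and> dist w0 w \<le> t} = cball w0 t - ball w0 a" by auto
    then show ?thesis by (simp add: compact_diff)
  qed
  ultimately have compK: "compact Kc"
    using shell by (auto intro!: compact_continuous_image continuous_on_subset[OF contg])
  have WK: "W \<subseteq> Kc" by (auto simp: W_def Kc_def)
  have shell': "{w. a < dist w0 w \<and> dist w0 w < t} \<subseteq> f ` D" using shell by auto
  have Wg: "W = g ` {w. a < dist w0 w \<and> dist w0 w < t}" unfolding W_def by (subst g_image_eq[OF shell']) auto
  have "open {w. a < dist w0 w \<and> dist w0 w < t}"
    by (intro open_Collect_conj open_Collect_less continuous_intros)
  then have openW: "open W" unfolding Wg using shell' by (rule open_g_image)
  have connW: "connected W"
    unfolding Wg by (rule connected_continuous_image[OF continuous_on_subset[OF contg shell'] connected_shell[OF dim]])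
  have Wne: "W \<noteq> {}" unfolding Wg using shell_nonempty[of a t w0] a rho0 by auto
  have WD: "W \<subseteq> D" by (auto simp: W_def)
  have WX: "inside \<Sigma>t \<inter> outside \<Sigma>a \<inter> D = W" using T(6) A(7) by (auto simp: W_def)
  \<comment> \<open>The region between the two preimages could still contain points outside
    \<open>D\<close>. They form a closed set, since the bounding surfaces lie in the open set
    \<open>D\<close>, and an open one, since the part of the region in \<open>D\<close> lies in the
    compact set \<open>Kc\<close>; hence there are none.\<close>
  define E where "E = inside \<Sigma>t \<inter> outside \<Sigma>a - D"
  have "closed E"
  proof -
    have "closure (inside \<Sigma>t) = inside \<Sigma>t \<union> \<Sigma>t" "closure (outside \<Sigma>a) = outside \<Sigma>a \<union> \<Sigma>a"
      unfolding closure_Un_frontier T(4) A(5) by auto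
    then have "E = closure (inside \<Sigma>t) \<inter> closure (outside \<Sigma>a) - D"
      using T(2) A(2) by (auto simp: E_def)
    then show ?thesis using D(1) by (metis closed_Diff closed_Int closed_closure)
  qed
  moreover have "open E"
  proof -
    have "E = inside \<Sigma>t \<inter> outside \<Sigma>a - Kc"
      using WX WK by (auto simp: E_def Kc_def)
    moreover have "open (inside \<Sigma>t)" "open (outside \<Sigma>a)"
      using T(1) A(1) by (auto intro: open_inside open_outside compact_imp_closed)
    ultimately show ?thesis using compK by (simp add: open_Diff open_Int compact_imp_closed)
  qed
  moreover have "E \<noteq> UNIV" using x by (auto simp: E_def)
  ultimately have "E = {}" using clopen by blast
  then have WX': "W = inside \<Sigma>t \<inter> outside \<Sigma>a" using WX by (auto simp: E_def)
  then have complW: "- W = Ca \<union> Ct"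
    using union_with_inside[of \<Sigma>a] union_with_outside[of \<Sigma>t] by (auto simp: Ca_def Ct_def)
  define CA CT where "CA = Some ` Ca" and "CT = insert None (Some ` Ct)"
  let ?X = "extended_space :: 'a option topology"
  let ?Y = "subtopology ?X (- Some ` W)"
  have UN: "(UNIV :: 'a option set) = insert None (range Some)" using notin_range_Some by blast
  then have top: "topspace ?X = UNIV" by simp
  have complR: "- Some ` W = CA \<union> CT"
  proof -
    have "- Some ` W = insert None (Some ` (- W))"
      using UN by (auto simp: image_iff)
    then show ?thesis by (auto simp: complW CA_def CT_def)
  qed
  have "bounded (inside \<Sigma>a)" using bd bounded_inside by blast
  then have compCa: "compact Ca" unfolding clCa by simp
  have clA: "closedin ?X CA"
    using compCa by (simp add: CA_def compact_imp_closed)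
  have CTeq: "CT = topspace ?X - Some ` (inside \<Sigma>t)"
  proof -
    have "- Ct = inside \<Sigma>t" unfolding Ct_def union_with_outside by simp
    then show ?thesis unfolding top CT_def using UN by (auto simp: image_iff) blast
  qed
  have clT: "closedin ?X CT"
    unfolding CTeq
    by (rule closedin_diff[OF closedin_topspace]) (use open_inside[OF compact_imp_closed[OF T(1)]] in simp)
  have cA: "connectedin ?X CA"
    unfolding CA_def clCa using A(3)
    by (intro connectedin_continuous_map_image[OF continuous_map_Some]) (simp add: connected_imp_connected_closure)
  have unb: "\<not> bounded Ct"
    using unbounded_outside[OF bd(2)] bounded_subset[of Ct "outside \<Sigma>t"] by (auto simp: Ct_def)
  have cT: "connectedin ?X CT"
  proof (rule connectedin_intermediate_closure_of)
    show cs: "connectedin ?X (Some ` Ct)"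
      unfolding clCa using connected_outside[OF bd(2) dim]
      by (intro connectedin_continuous_map_image[OF continuous_map_Some]) (simp add: connected_imp_connected_closure)
    show "Some ` Ct \<subseteq> CT" by (auto simp: CT_def)
    \<comment> \<open>Infinity is a limit of the unbounded set \<open>Ct\<close>, so adding it keeps
      connectedness.\<close>
    have "None \<in> ?X closure_of (Some ` Ct)"
      unfolding in_closure_of
    proof (intro conjI allI impI)
      fix U assume U: "None \<in> U \<and> openin ?X U"
      then obtain K where K: "compact K" "U = insert None (Some ` (UNIV - K))"
        by (auto simp: openin_Alexandroff_compactification)
      then have "\<not> Ct \<subseteq> K" using unb compact_imp_bounded bounded_subset by blast
      then show "\<exists>y. y \<in> Some ` Ct \<and> y \<in> U" using K by blast
    qed (simp add: top)
    moreover have "Some ` Ct \<subseteq> ?X closure_of (Some ` Ct)"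
      by (rule closure_of_subset) auto
    ultimately show "CT \<subseteq> ?X closure_of (Some ` Ct)" by (simp add: CT_def)
  qed
  have x0Ca: "x0 \<in> Ca"
  proof -
    have "\<rho>0 < a" "0 < a" using a rho0 by auto
    have x0c: "x0 \<in> closure D" using x0 by (simp add: frontier_def)
    then obtain d where d: "d > 0" "\<And>y. y \<in> closure D \<Longrightarrow> dist y x0 < d \<Longrightarrow> dist (f y) w0 < a"
      using contf \<open>0 < a\<close> unfolding continuous_on_iff by blast
    have "x0 \<in> closure (inside \<Sigma>a)"
      unfolding closure_approachable
    proof (intro allI impI)
      fix e :: real assume "0 < e"
      then obtain y where y: "y \<in> D" "dist y x0 < min e d"
        using x0c d(1) unfolding closure_approachable by (metis min_less_iff_conj)
      then have "dist w0 (f y) < a" using d(2)[of y] closure_subset by (auto simp: dist_commute)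
      then show "\<exists>y\<in>inside \<Sigma>a. dist y x0 < e" using y A(6) by (intro bexI[of _ y]) auto
    qed
    then show ?thesis by (simp add: clCa)
  qed
  have comps: "complement_components (Some ` W) = {CA, CT}"
    unfolding complement_components_def
  proof (rule connected_components_of_two)
    show "topspace ?Y = CA \<union> CT" by (simp only: topspace_subtopology top complR Int_UNIV_left)
    show "CA \<inter> CT = {}" using CaCt by (auto simp: CA_def CT_def)
    show "closedin ?Y CA" "closedin ?Y CT" using clA clT complR by (auto intro: closedin_subset_topspace)
    show "connectedin ?Y CA" "connectedin ?Y CT" using cA cT complR by (simp_all add: connectedin_subtopology)
  qed (use x0Ca in \<open>auto simp: CA_def CT_def\<close>)
  have "CA \<noteq> CT" by (auto simp: CA_def CT_def)
  show "is_ring (Some ` W)"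
    unfolding is_ring_def comps using openW Wne connW \<open>CA \<noteq> CT\<close>
    by (auto intro: connectedin_continuous_map_image[OF continuous_map_Some])
  show "ring_separates (Some ` W) (frontier D)"
    unfolding ring_separates_def comps
  proof (intro conjI)
    show "Some ` W \<inter> Some ` frontier D = {}"
      using WD D(1) by (auto simp: frontier_def interior_open)
    have "outside \<Sigma>t \<inter> frontier D \<noteq> {}"
    proof (rule connected_Int_frontier)
      show "connected (outside \<Sigma>t)" by (rule connected_outside[OF bd(2) dim])
      show "outside \<Sigma>t \<inter> D \<noteq> {}" using x xo by blast
      show "outside \<Sigma>t - D \<noteq> {}" using unbounded_outside[OF bd(2)] bounded_subset[OF D(3)] by blast
    qed
    then show "\<forall>C\<in>{CA, CT}. C \<inter> Some ` frontier D \<noteq> {}"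
      using x0 x0Ca by (auto simp: CA_def CT_def Ct_def)
  qed
  fix I and \<gamma> :: "real \<Rightarrow> 'a"
  assume "(I, \<gamma>) \<in> ring_curves (Some ` W)"
  then obtain s u where I: "I = {s..u}" "s < u" "continuous_on {s..u} \<gamma>"
    and int: "\<And>\<tau>. \<tau> \<in> {s<..<u} \<Longrightarrow> \<gamma> \<tau> \<in> W"
    and ends: "Some (\<gamma> s) \<in> CA \<and> Some (\<gamma> u) \<in> CT \<or> Some (\<gamma> s) \<in> CT \<and> Some (\<gamma> u) \<in> CA"
    unfolding ring_curves_def comps by (auto simp: image_iff)
  \<comment> \<open>Only the open part of the curve is known to lie in \<open>W\<close>. The compact
    set \<open>Kc\<close> catches the end points as well, and inside \<open>Kc\<close> the two
    complementary components reduce to \<open>\<Sigma>a\<close> and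
    \<open>\<Sigma>t\<close>.\<close>
  have "\<gamma> ` closure {s<..<u} \<subseteq> Kc"
    using I int WK compK by (intro image_closure_subset) (auto simp: compact_imp_closed)
  then have K: "\<gamma> ` {s..u} \<subseteq> Kc" using I(2) by simp
  have endA: "dist w0 (f z) = a" if "Some z \<in> CA" "z \<in> Kc" for z
  proof -
    have "z \<notin> D \<inter> inside \<Sigma>a" "z \<in> D" using that(2) unfolding A(6) by (auto simp: Kc_def)
    then have "z \<notin> inside \<Sigma>a" by blast
    then show ?thesis using that(1) \<Sigma>a by (auto simp: CA_def Ca_def)
  qed
  have endT: "dist w0 (f z) = t" if "Some z \<in> CT" "z \<in> Kc" for z
  proof -
    have "z \<notin> D \<inter> outside \<Sigma>t" "z \<in> D" using that(2) unfolding T(7) by (auto simp: Kc_def)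
    then have "z \<notin> outside \<Sigma>t" by blast
    then show ?thesis using that(1) \<Sigma>t by (auto simp: CT_def Ct_def)
  qed
  have su: "s \<in> I" "u \<in> I" "\<gamma> s \<in> Kc" "\<gamma> u \<in> Kc" using I K by auto
  have "curve_in D (I, \<gamma>)"
    unfolding curve_in_def prod.case
  proof (intro conjI)
    show "\<exists>s\<in>I. \<exists>t\<in>I. s < t" using su I(2) by blast
    show "\<gamma> ` I \<subseteq> D" using K I(1) by (auto simp: Kc_def)
  qed (use I in \<open>auto simp: is_interval_cc\<close>)
  moreover have "(\<exists>s\<in>I. dist w0 (f (\<gamma> s)) = a) \<and> (\<exists>s\<in>I. dist w0 (f (\<gamma> s)) = t)"
    using ends endA endT su by blast
  ultimately show "curve_in D (I, \<gamma>) \<and> (\<exists>s\<in>I. dist w0 (f (\<gamma> s)) = a) \<and> (\<exists>s\<in>I. dist w0 (f (\<gamma> s)) = t)"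
    by blast
qed

end

section \<open>Boundary distortion\<close>

lemma sphere_area_pos: "sphere_area TYPE('a::euclidean_space) > 0"
  by (simp add: sphere_area_def)

text \<open>The definition of the ring modulus solved for the modulus of the curve family, the
  quantity that quasiconformality controls. The value 0 is excluded, as the ring modulus would be
  infinite; an infinite value is trivial.\<close>

lemma ring_curves_modulus_ge:
  fixes K :: "'a::euclidean_space set"
  assumes up: "uniformly_perfect_with b K" and R: "is_ring R" "ring_separates R K" and dim: "2 \<le> DIM('a)"
  shows "ennreal (sphere_area TYPE('a) / b ^ (DIM('a) - 1)) \<le> curve_modulus (ring_curves R)"
proof -
  let ?\<omega> = "sphere_area TYPE('a)" and ?M = "curve_modulus (ring_curves R)" and ?k = "DIM('a) - 1"
  have b: "b > 0" and le: "ring_mod R \<le> ennreal b"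
    using up R unfolding uniformly_perfect_with_def by (auto simp: not_less)
  have k: "?k > 0" "real DIM('a) - 1 = real ?k" using dim by (auto simp: of_nat_diff)
  have "?M \<noteq> 0" using le by (auto simp: ring_mod_def top_unique)
  show ?thesis
  proof (cases ?M)
    case (real m)
    then have m: "m > 0" using \<open>?M \<noteq> 0\<close> by (cases "m = 0") auto
    have w: "?\<omega> / m > 0" using m sphere_area_pos by (rule divide_pos_pos[rotated])
    have "ennreal ((?\<omega> / m) powr (1 / ?k)) \<le> ennreal b"
      using le real m \<open>?M \<noteq> 0\<close> unfolding ring_mod_def Let_def k(2) by simp
    then have "(?\<omega> / m) powr (1 / ?k) \<le> b" using b by (simp add: ennreal_le_iff)
    then have "((?\<omega> / m) powr (1 / ?k)) ^ ?k \<le> b ^ ?k" by (intro power_mono) auto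
    also have "((?\<omega> / m) powr (1 / ?k)) ^ ?k = ?\<omega> / m"
    proof -
      have "((?\<omega> / m) powr (1 / real j)) ^ j = ?\<omega> / m" if "j > 0" for j :: nat
      proof -
        have "((?\<omega> / m) powr (1 / real j)) ^ j = ((?\<omega> / m) powr (1 / real j)) powr real j"
          using w by (subst powr_realpow) auto
        also have "\<dots> = (?\<omega> / m) powr 1" using that by (simp only: powr_powr) simp
        also have "\<dots> = ?\<omega> / m" by (rule powr_one[OF less_imp_le[OF w]])
        finally show ?thesis .
      qed
      then show ?thesis using k(1) by blast
    qed
    finally have "?\<omega> / b ^ ?k \<le> m" using m b by (simp add: field_simps)
    then show ?thesis using real by (simp add: ennreal_leI)
  qed simp
qed

lemma exists_divide_power_less:
  fixes A e :: real
  assumes "e > 0" "k > 0"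
  shows "\<exists>N>0. A / real N ^ k < e"
proof -
  obtain N0 :: nat where N0: "\<bar>A\<bar> / e < N0" using reals_Archimedean2 by blast
  define N where "N = Suc N0"
  have "\<bar>A\<bar> < e * N" using N0 \<open>e > 0\<close> by (simp add: N_def field_simps)
  also have "real N \<le> real N ^ k" using self_le_power[of "real N" k] \<open>k > 0\<close> by (simp add: N_def)
  then have "e * N \<le> e * real N ^ k" using \<open>e > 0\<close> by simp
  finally have "A < e * real N ^ k" by linarith
  then have "A / real N ^ k < e" by (simp add: N_def field_simps)
  then show ?thesis by (intro exI[of _ N]) (simp add: N_def)
qed

definition modulus_const :: "'a::euclidean_space itself \<Rightarrow> real"
  where "modulus_const _ = unit_ball_vol DIM('a) * 2 ^ DIM('a)"

context boundary_trap
begin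

text \<open>The path is lifted up to the first parameter \<open>\<tau>\<close> at which it leaves
  the image of \<open>D \<inter> ball x0 r0\<close>; at \<open>\<tau>\<close> there may be no lift,
  so the interval is half-open. If the lift stayed closer to \<open>x0\<close> than
  \<open>d * 2 ^ N\<close>, then \<open>\<gamma> \<tau>\<close> would be a value of \<open>f\<close>
  at a point of the closure equally near: in \<open>D\<close> this contradicts the choice of
  \<open>\<tau>\<close>, on the frontier the trap.\<close>

lemma sphere_lift:
  assumes d: "0 < d" "d * 2 ^ N < r0" and p: "p \<in> D" "dist x0 p \<le> d" and t: "\<rho>0 < t"
    and lip: "\<And>u v. u \<in> {0..2} \<Longrightarrow> v \<in> {0..2} \<Longrightarrow> dist (\<gamma> u) (\<gamma> v) \<le> \<Lambda> * \<bar>u - v\<bar>" and "0 \<le> \<Lambda>"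
    and \<gamma>: "\<gamma> 0 = f p" "\<gamma> 2 \<notin> f ` (D \<inter> ball x0 r0)" "\<gamma> ` {0..2} \<subseteq> sphere w0 t"
  obtains \<tau> where "\<tau> \<le> 2" "curve_in D ({0..<\<tau>}, g \<circ> \<gamma>)" "\<And>s. s \<in> {0..<\<tau>} \<Longrightarrow> f (g (\<gamma> s)) = \<gamma> s"
    "\<exists>s\<in>{0..<\<tau>}. dist x0 (g (\<gamma> s)) \<le> d" "\<exists>s\<in>{0..<\<tau>}. d * 2 ^ N \<le> dist x0 (g (\<gamma> s))"
proof -
  let ?V = "f ` (D \<inter> ball x0 r0)"
  have "d \<le> d * 2 ^ N" using d(1) by simp
  then have "d < r0" using d(2) by linarith
  have openV': "open ?V" using D(1) by (intro open_image) auto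
  have cont: "continuous_on {0..2} \<gamma>"
  proof (rule lipschitz_on_continuous_on)
    show "\<Lambda>-lipschitz_on {0..2} \<gamma>"
      using lip \<open>0 \<le> \<Lambda>\<close> by (intro lipschitz_onI) (simp_all add: dist_real_def)
  qed
  define B where "B = {0..2} \<inter> \<gamma> -` (- ?V)"
  have "closed B"
    unfolding B_def using openV' by (intro continuous_closed_preimage cont) auto
  then have "compact B" unfolding B_def by (metis bounded_Int bounded_closed_interval compact_eq_bounded_closed cbox_interval)
  moreover have "2 \<in> B" using \<gamma>(2) by (simp add: B_def)
  ultimately obtain \<tau> where \<tau>: "\<tau> \<in> B" "\<And>s. s \<in> B \<Longrightarrow> \<tau> \<le> s"
    using compact_attains_inf[of B] by blast
  have \<tau>2: "0 \<le> \<tau>" "\<tau> \<le> 2" "\<gamma> \<tau> \<notin> ?V" using \<tau>(1) by (auto simp: B_def)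
  have "\<gamma> 0 \<in> ?V" using \<gamma>(1) p \<open>d < r0\<close> by auto
  then have "\<tau> > 0" using \<tau>2 by (cases "\<tau> = 0") auto
  have inV: "\<gamma> s \<in> ?V" if "s \<in> {0..<\<tau>}" for s
    using \<tau>(2)[of s] that \<tau>2 by (auto simp: B_def)
  have inV': "\<gamma> s \<in> f ` D" if "s \<in> {0..<\<tau>}" for s using inV[OF that] by blast
  show thesis
  proof
    show "\<tau> \<le> 2" by fact
    show "f (g (\<gamma> s)) = \<gamma> s" if "s \<in> {0..<\<tau>}" for s using inV'[OF that] by (rule fg)
    show "curve_in D ({0..<\<tau>}, g \<circ> \<gamma>)"
      unfolding curve_in_def prod.case
    proof (intro conjI)
      show "\<exists>s\<in>{0..<\<tau>}. \<exists>t\<in>{0..<\<tau>}. s < t"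
        using \<open>\<tau> > 0\<close> by (intro bexI[of _ 0] bexI[of _ "\<tau> / 2"]) auto
      have sub: "{0..<\<tau>} \<subseteq> {0..2}" using \<tau>2 by auto
      show "continuous_on {0..<\<tau>} (g \<circ> \<gamma>)"
        by (intro continuous_on_compose continuous_on_subset[OF cont sub] continuous_on_subset[OF contg])
           (use inV' in auto)
      show "(g \<circ> \<gamma>) ` {0..<\<tau>} \<subseteq> D" using inV' gD by auto
      show "is_interval {0..<\<tau>}" by (auto simp: is_interval_1)
    qed
    show "\<exists>s\<in>{0..<\<tau>}. dist x0 (g (\<gamma> s)) \<le> d"
      using \<open>\<tau> > 0\<close> \<gamma>(1) p by (intro bexI[of _ 0]) auto
    show "\<exists>s\<in>{0..<\<tau>}. d * 2 ^ N \<le> dist x0 (g (\<gamma> s))"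
    proof (rule ccontr)
      assume no: "\<not> ?thesis"
      define C where "C = closure D \<inter> cball x0 (d * 2 ^ N)"
      have "compact (f ` C)"
        unfolding C_def using D(3) by (intro compact_continuous_image continuous_on_subset[OF contf] compact_Int_closed) auto
      moreover have "\<gamma> s \<in> f ` C" if s: "s \<in> {0..<\<tau>}" for s
      proof -
        have "g (\<gamma> s) \<in> D" using inV'[OF s] gD by blast
        then have "g (\<gamma> s) \<in> closure D" using closure_subset by blast
        moreover have "dist x0 (g (\<gamma> s)) \<le> d * 2 ^ N" using no s by force
        ultimately have "g (\<gamma> s) \<in> C" by (simp add: C_def)
        then show ?thesis using fg[OF inV'[OF s]] by (metis imageI)
      qed
      moreover have cl: "closure {0..<\<tau>} = {0..\<tau>}" using \<open>\<tau> > 0\<close> by simp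
      ultimately have "\<gamma> ` {0..\<tau>} \<subseteq> f ` C"
        using image_closure_subset[of "{0..<\<tau>}" \<gamma> "f ` C"] continuous_on_subset[OF cont, of "{0..\<tau>}"] \<tau>2
        by (auto simp: compact_imp_closed image_subset_iff)
      then have "\<gamma> \<tau> \<in> f ` C" using \<tau>2 by (auto simp: image_subset_iff)
      then obtain \<zeta> where z: "\<zeta> \<in> C" "\<gamma> \<tau> = f \<zeta>" by blast
      have zr: "dist x0 \<zeta> < r0" using z(1) d by (auto simp: C_def)
      show False
      proof (cases "\<zeta> \<in> D")
        case True
        then show False using z zr \<tau>2(3) by auto
      next
        case False
        then have "\<zeta> \<in> frontier D" using z(1) D(1) by (simp add: C_def frontier_def interior_open)
        then have "dist w0 (\<gamma> \<tau>) \<le> \<rho>0" using trap[of \<zeta>] zr z(2) by simp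
        moreover have "dist w0 (\<gamma> \<tau>) = t" using \<gamma>(3) \<tau>2(1,2)
          by (metis atLeastAtMost_iff image_subset_iff mem_sphere)
        ultimately show False using t by simp
      qed
    qed
  qed
qed

text \<open>The choice of \<open>N\<close> puts \<open>K\<close> times the modulus of the family
  crossing from distance \<open>d\<close> to \<open>d * 2 ^ N\<close> below
  \<open>sphere_const\<close>. Without a trapped sphere, every density admissible for the image
  family would satisfy the path condition of \<open>sphere_family_integral_ge\<close> with a = R /
  2; since R > 2 \<open>\<rho>0\<close>, all radii used exceed \<open>\<rho>0\<close>.\<close>

lemma exists_trapped_sphere:
  assumes upper: "\<And>\<Gamma>. (\<And>c. c \<in> \<Gamma> \<Longrightarrow> curve_in D c) \<Longrightarrow> curve_modulus (image_family f \<Gamma>) \<le> ennreal K * curve_modulus \<Gamma>"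
    and K: "K \<ge> 1"
    and N: "N > 0" "K * modulus_const TYPE('a) / N ^ (DIM('a) - 1) < sphere_const TYPE('a)"
    and x: "x \<in> D" "dist x0 x = d" "ball x d \<subseteq> D" and d: "0 < d" "d * 2 ^ N < r0"
    and R: "2 * \<rho>0 < dist w0 (f x)"
  shows "\<exists>t. dist w0 (f x) / 2 < t \<and> t < dist w0 (f x) \<and> sphere w0 t \<subseteq> f ` (D \<inter> ball x0 r0)"
proof (rule ccontr)
  assume no0: "\<not> ?thesis"
  define R where "R = dist w0 (f x)"
  have no: "\<not> sphere w0 t \<subseteq> f ` (D \<inter> ball x0 r0)" if "R / 2 < t" "t < R" for t
    using no0 that unfolding R_def by blast
  let ?c = "modulus_const TYPE('a) / N ^ (DIM('a) - 1)"
  define \<Gamma> where "\<Gamma> = {(I, \<gamma>). curve_in D (I, \<gamma>) \<and> (\<exists>s\<in>I. dist x0 (\<gamma> s) \<le> d) \<and> (\<exists>s\<in>I. d * 2 ^ N \<le> dist x0 (\<gamma> s))}"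
  have "curve_modulus \<Gamma> \<le> ennreal (?c)"
    unfolding modulus_const_def
    by (rule curve_modulus_le[OF _ d(1) N(1), where w=x0]) (auto simp: \<Gamma>_def curve_in_def)
  then have "ennreal K * curve_modulus \<Gamma> \<le> ennreal K * ennreal (?c)"
    by (rule mult_left_mono) simp
  also have "\<dots> = ennreal (K * modulus_const TYPE('a) / N ^ (DIM('a) - 1))"
    using K by (simp add: ennreal_mult'[symmetric])
  also have "\<dots> < ennreal (sphere_const TYPE('a))"
    using N(2) sphere_const_pos[where 'a='a] by (simp add: ennreal_lessI)
  finally have "ennreal K * curve_modulus \<Gamma> < ennreal (sphere_const TYPE('a))" .
  moreover have "curve_modulus (image_family f \<Gamma>) \<le> ennreal K * curve_modulus \<Gamma>"
    by (rule upper) (auto simp: \<Gamma>_def)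
  moreover have "ennreal (sphere_const TYPE('a)) \<le> curve_modulus (image_family f \<Gamma>)"
    unfolding curve_modulus_def
  proof (rule INF_greatest)
    fix \<rho> :: "'a \<Rightarrow> ennreal" assume "\<rho> \<in> admissible (image_family f \<Gamma>)"
    then have \<rho>[measurable]: "\<rho> \<in> borel_measurable borel"
      and adm: "\<And>c. c \<in> image_family f \<Gamma> \<Longrightarrow> locally_rectifiable c \<Longrightarrow> 1 \<le> line_integral \<rho> c"
      by (auto simp: admissible_def)
    have "R > 0" using R rho0 unfolding R_def by linarith
    show "ennreal (sphere_const TYPE('a)) \<le> (\<integral>\<^sup>+x. \<rho> x ^ DIM('a) \<partial>lborel)"
    proof (rule sphere_family_integral_ge[OF dim \<rho>, of "R / 2" w0])
      show "0 < R / 2" using \<open>R > 0\<close> by simp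
      fix t assume "R / 2 < t" "t < 2 * (R / 2)"
      then have t: "R / 2 < t" "t < R" "\<rho>0 < t" "0 < t" using R \<open>R > 0\<close> by (auto simp: R_def)
      \<comment> \<open>Along the segment from \<open>x\<close> to \<open>x0\<close> the distance of
        the value of \<open>f\<close> from \<open>w0\<close> goes continuously from \<open>R\<close>
        to 0, hence takes the value t at a point of \<open>D\<close> within \<open>d\<close> of
        \<open>x0\<close>.\<close>
      obtain p where p: "p \<in> D" "dist x0 p \<le> d" "dist w0 (f p) = t"
      proof -
        define \<sigma> where "\<sigma> s = x + s *\<^sub>R (x0 - x)" for s :: real
        have nd: "norm (x0 - x) = d" using x(2) by (simp add: dist_norm)
        have inD: "\<sigma> s \<in> D" if "0 \<le> s" "s < 1" for s
        proof -
          have "dist x (\<sigma> s) < d" using that nd d(1) by (simp add: \<sigma>_def dist_norm)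
          then show ?thesis using x(3) by auto
        qed
        have s1: "\<sigma> 1 = x0" by (simp add: \<sigma>_def)
        have "\<sigma> s \<in> closure D" if "s \<in> {0..1}" for s
          using that inD[of s] s1 x0 closure_subset by (cases "s = 1") (auto simp: frontier_def)
        then have "continuous_on {0..1} (\<lambda>s. f (\<sigma> s))"
          by (intro continuous_on_compose2[OF contf]) (auto simp: \<sigma>_def intro!: continuous_intros)
        then have "continuous_on {0..1} (\<lambda>s. dist w0 (f (\<sigma> s)))" by (intro continuous_intros)
        then obtain s where s: "0 \<le> s" "s \<le> 1" "dist w0 (f (\<sigma> s)) = t"
          using IVT2'[of "\<lambda>s. dist w0 (f (\<sigma> s))" 1 t 0] t s1 by (auto simp: R_def \<sigma>_def)
        then have "s < 1" using s1 t by (cases "s = 1") auto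
        moreover have "x0 - \<sigma> s = (1 - s) *\<^sub>R (x0 - x)" by (simp add: \<sigma>_def algebra_simps)
        then have "dist x0 (\<sigma> s) = (1 - s) * d" using nd s by (simp add: dist_norm)
        then have "dist x0 (\<sigma> s) \<le> d" using s d(1) by (simp add: mult_left_le_one_le)
        ultimately show thesis using that inD s by blast
      qed
      obtain y where y: "y \<in> sphere w0 t" "y \<notin> f ` (D \<inter> ball x0 r0)" using no t by blast
      show "\<exists>q\<in>sphere w0 t. \<exists>y\<in>sphere w0 t. \<forall>\<gamma>.
        (\<forall>u\<in>{0..2}. \<forall>v\<in>{0..2}. dist (\<gamma> u) (\<gamma> v) \<le> 32 * t * \<bar>u - v\<bar>) \<longrightarrow>
        \<gamma> 0 = q \<longrightarrow> \<gamma> 2 = y \<longrightarrow> \<gamma> ` {0..2} \<subseteq> sphere w0 t \<longrightarrow>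
        1 \<le> ennreal (32 * t) * (\<integral>\<^sup>+s\<in>{0..2}. \<rho> (\<gamma> s) \<partial>lborel)"
      proof (rule bexI[of _ "f p"], rule bexI[of _ y], intro allI impI)
        fix \<gamma> :: "real \<Rightarrow> 'a"
        assume lip0: "\<forall>u\<in>{0..2}. \<forall>v\<in>{0..2}. dist (\<gamma> u) (\<gamma> v) \<le> 32 * t * \<bar>u - v\<bar>"
          and \<gamma>: "\<gamma> 0 = f p" "\<gamma> 2 = y" "\<gamma> ` {0..2} \<subseteq> sphere w0 t"
        then have lip: "\<And>u v. u \<in> {0..2} \<Longrightarrow> v \<in> {0..2} \<Longrightarrow> dist (\<gamma> u) (\<gamma> v) \<le> 32 * t * \<bar>u - v\<bar>" by blast
        have "\<gamma> 2 \<notin> f ` (D \<inter> ball x0 r0)" using y \<gamma>(2) by simp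
        from sphere_lift[OF d p(1,2) t(3) lip _ \<gamma>(1) this \<gamma>(3)] t(4)
        obtain \<tau> where \<tau>: "\<tau> \<le> 2" "curve_in D ({0..<\<tau>}, g \<circ> \<gamma>)" "\<And>s. s \<in> {0..<\<tau>} \<Longrightarrow> f (g (\<gamma> s)) = \<gamma> s"
          "\<exists>s\<in>{0..<\<tau>}. dist x0 (g (\<gamma> s)) \<le> d" "\<exists>s\<in>{0..<\<tau>}. d * 2 ^ N \<le> dist x0 (g (\<gamma> s))"
          by auto
        have "({0..<\<tau>}, g \<circ> \<gamma>) \<in> \<Gamma>" using \<tau> by (simp add: \<Gamma>_def)
        then have mem: "({0..<\<tau>}, f \<circ> (g \<circ> \<gamma>)) \<in> image_family f \<Gamma>"
          by (auto simp: image_family_def intro!: image_eqI[where x="({0..<\<tau>}, g \<circ> \<gamma>)"])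
        have lip': "dist ((f \<circ> (g \<circ> \<gamma>)) u) ((f \<circ> (g \<circ> \<gamma>)) v) \<le> 32 * t * \<bar>u - v\<bar>"
          if "u \<in> {0..<\<tau>}" "v \<in> {0..<\<tau>}" for u v
          using that \<tau>(1,3) lip[of u v] by simp
        have int: "is_interval {0..<\<tau>}" by (auto simp: is_interval_1)
        have "0 \<le> 32 * t" using t by simp
        note li = line_integral_lipschitz_le[OF \<rho> lip' this int]
        have "1 \<le> line_integral \<rho> ({0..<\<tau>}, f \<circ> (g \<circ> \<gamma>))" by (rule adm[OF mem li(1)])
        also have "\<dots> \<le> ennreal (32 * t) * (\<integral>\<^sup>+s\<in>{0..<\<tau>}. \<rho> ((f \<circ> (g \<circ> \<gamma>)) s) \<partial>lborel)" by (rule li(2))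
        \<comment> \<open>Only the lifted part, up to \<open>\<tau>\<close>, belongs to the image
          family; the rest of the path merely enlarges the integral.\<close>
        also have "\<dots> \<le> ennreal (32 * t) * (\<integral>\<^sup>+s\<in>{0..2}. \<rho> (\<gamma> s) \<partial>lborel)"
          using \<tau>(1,3) by (intro mult_left_mono nn_integral_mono) (auto simp: indicator_def)
        finally show "1 \<le> ennreal (32 * t) * (\<integral>\<^sup>+s\<in>{0..2}. \<rho> (\<gamma> s) \<partial>lborel)" .
      qed (use y p in auto)
    qed
  qed
  ultimately show False by (meson leD le_less_trans order.trans)
qed

text \<open>The two constants use opposite halves of the quasiconformal inequality: \<open>N\<close>
  forces a trapped sphere to exist, \<open>N'\<close> limits the thickness of a trapped shell. A
  shell of ratio \<open>2 ^ N'\<close> would give a ring whose curve family has modulus below the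
  bound from uniform perfectness. The factor 2 in front pays for t > R / 2.\<close>

lemma boundary_distortion:
  assumes qc: "\<And>\<Gamma>. (\<And>c. c \<in> \<Gamma> \<Longrightarrow> curve_in D c) \<Longrightarrow>
      curve_modulus \<Gamma> / ennreal K \<le> curve_modulus (image_family f \<Gamma>) \<and>
      curve_modulus (image_family f \<Gamma>) \<le> ennreal K * curve_modulus \<Gamma>"
    and K: "K \<ge> 1" and up: "uniformly_perfect_with b (frontier D)"
    and N: "N > 0" "K * modulus_const TYPE('a) / N ^ (DIM('a) - 1) < sphere_const TYPE('a)"
    and N': "N' > 0" "K * modulus_const TYPE('a) / N' ^ (DIM('a) - 1) < sphere_area TYPE('a) / b ^ (DIM('a) - 1)"
    and x: "x \<in> D" "dist x0 x = d" "ball x d \<subseteq> D" and d: "0 < d" "d * 2 ^ N < r0"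
  shows "dist w0 (f x) \<le> 2 * 2 ^ N' * \<rho>0"
proof (cases "2 * \<rho>0 < dist w0 (f x)")
  case False
  have "1 * \<rho>0 \<le> 2 ^ N' * \<rho>0" by (intro mult_right_mono rho0) simp
  then show ?thesis using False by linarith
next
  case True
  obtain t where t: "dist w0 (f x) / 2 < t" "t < dist w0 (f x)" "sphere w0 t \<subseteq> f ` (D \<inter> ball x0 r0)"
    using exists_trapped_sphere[OF _ K N x d True] qc by blast
  let ?Kc = "K * modulus_const TYPE('a) / N' ^ (DIM('a) - 1)" and ?c = "modulus_const TYPE('a) / N' ^ (DIM('a) - 1)"
    and ?e = "sphere_area TYPE('a) / b ^ (DIM('a) - 1)"
  have "t \<le> 2 ^ N' * \<rho>0"
  proof (rule ccontr)
    assume "\<not> t \<le> 2 ^ N' * \<rho>0"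
    \<comment> \<open>This inner radius makes the ratio of the shell exactly \<open>2 ^ N'\<close>,
      and it exceeds \<open>\<rho>0\<close> by the negated claim.\<close>
    define a where "a = t / 2 ^ N'"
    have t0: "t > 0" using t(1) True rho0 by linarith
    have a: "\<rho>0 < a" "a < t" using \<open>\<not> t \<le> 2 ^ N' * \<rho>0\<close> N'(1) t0 by (auto simp: a_def field_simps one_less_power)
    then have "a > 0" using rho0 by simp
    define W where "W = {z \<in> D. a < dist w0 (f z) \<and> dist w0 (f z) < t}"
    note ring = trapped_shell_ring[OF a t(3) x(1) t(2), folded W_def]
    let ?\<Gamma> = "ring_curves (Some ` W)"
    have "curve_modulus (image_family f ?\<Gamma>) \<le> ennreal (?c)"
      unfolding modulus_const_def
    proof (rule curve_modulus_le[OF _ \<open>a > 0\<close> N'(1), where w=w0])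
      fix I and \<gamma>' :: "real \<Rightarrow> 'a" assume "(I, \<gamma>') \<in> image_family f ?\<Gamma>"
      then obtain \<gamma> where \<gamma>: "(I, \<gamma>) \<in> ?\<Gamma>" "\<gamma>' = f \<circ> \<gamma>" by (auto simp: image_family_def)
      have "continuous_on I (f \<circ> \<gamma>)"
        using ring(3)[OF \<gamma>(1)] continuous_on_compose[of I \<gamma> f] continuous_on_subset[OF contfD, of "\<gamma> ` I"]
        by (simp add: curve_in_def)
      moreover obtain s s' where "s \<in> I" "dist w0 (\<gamma>' s) = a" "s' \<in> I" "dist w0 (\<gamma>' s') = t"
        using ring(3)[OF \<gamma>(1)] \<gamma>(2) by auto
      moreover have "a * 2 ^ N' = t" by (simp add: a_def)
      moreover have "is_interval I" using ring(3)[OF \<gamma>(1)] by (simp add: curve_in_def)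
      ultimately show "is_interval I \<and> continuous_on I \<gamma>' \<and> (\<exists>s\<in>I. dist w0 (\<gamma>' s) \<le> a) \<and> (\<exists>s\<in>I. a * 2 ^ N' \<le> dist w0 (\<gamma>' s))"
        using \<gamma>(2) by (metis order_refl)
    qed
    moreover have "curve_modulus ?\<Gamma> / ennreal K \<le> curve_modulus (image_family f ?\<Gamma>)"
      using qc[of ?\<Gamma>] ring(3) by auto
    ultimately have "curve_modulus ?\<Gamma> / ennreal K \<le> ennreal (?c)" by simp
    then have "ennreal K * (curve_modulus ?\<Gamma> / ennreal K) \<le> ennreal K * ennreal (?c)"
      by (rule mult_left_mono) simp
    moreover have "ennreal K * (curve_modulus ?\<Gamma> / ennreal K) = curve_modulus ?\<Gamma>"
    proof -
      have "ennreal K \<noteq> 0" "ennreal K \<noteq> top" using K by auto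
      then show ?thesis by (simp add: ennreal_times_divide mult.commute[of "ennreal K"] ennreal_mult_divide_eq)
    qed
    moreover have "ennreal K * ennreal (?c) = ennreal (?Kc)"
      using K by (simp add: ennreal_mult'[symmetric])
    moreover have "ennreal (?e) \<le> curve_modulus ?\<Gamma>"
      by (rule ring_curves_modulus_ge[OF up ring(1,2) dim])
    ultimately have le: "ennreal (?e) \<le> ennreal (?Kc)"
      by simp
    have "0 \<le> ?Kc" using K by (simp add: modulus_const_def)
    then show False using le N'(2) by (subst (asm) ennreal_le_iff) auto
  qed
  then show ?thesis using t by simp
qed

end

section \<open>From the boundary estimate to the closure\<close>

lemma exists_nearest_frontier_point:
  fixes D :: "'a::euclidean_space set"
  assumes D: "open D" "bounded D" and x: "x \<in> D"
  obtains \<xi> where "\<xi> \<in> frontier D" "infdist x (frontier D) = dist x \<xi>" "ball x (dist x \<xi>) \<subseteq> D" "0 < dist x \<xi>"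
proof -
  have "frontier D \<noteq> {}" using x D by (metis empty_iff frontier_eq_empty not_bounded_UNIV)
  then obtain \<xi> where \<xi>: "\<xi> \<in> frontier D" "infdist x (frontier D) = dist x \<xi>"
    using infdist_attains_inf[OF frontier_closed] by metis
  have "x \<notin> frontier D" using x D(1) by (simp add: frontier_def interior_open)
  then have pos: "0 < dist x \<xi>" using \<xi>(1) by auto
  have "ball x (dist x \<xi>) \<subseteq> D"
  proof (rule ccontr)
    assume "\<not> ?thesis"
    moreover have "x \<in> ball x (dist x \<xi>) \<inter> D" using x pos by simp
    ultimately have "ball x (dist x \<xi>) \<inter> frontier D \<noteq> {}"
      using connected_Int_frontier[of "ball x (dist x \<xi>)" D] by blast
    then obtain z where z: "dist x z < dist x \<xi>" "z \<in> frontier D" by auto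
    then show False using infdist_le[OF z(2), of x] \<xi>(2) by simp
  qed
  then show ?thesis using \<xi> pos that by blast
qed

lemma harmonic_on_diff_const:
  assumes "harmonic_on D u"
  shows "harmonic_on D (\<lambda>x. u x - c)"
proof -
  obtain g H where gH: "continuous_on D H" "\<forall>x\<in>D. (u has_derivative (\<lambda>h. g x \<bullet> h)) (at x) \<and>
      (g has_derivative blinfun_apply (H x)) (at x) \<and> (\<Sum>b\<in>Basis. blinfun_apply (H x) b \<bullet> b) = 0"
    using assms unfolding harmonic_on_def by blast
  have "((\<lambda>x. u x - c) has_derivative (\<lambda>h. g x \<bullet> h)) (at x)" if "x \<in> D" for x
    using gH(2) that has_derivative_diff[of u "\<lambda>h. g x \<bullet> h" "at x" "\<lambda>_. c" "\<lambda>_. 0"] by simp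
  with gH show ?thesis unfolding harmonic_on_def by blast
qed

text \<open>The trap is set anew for each \<open>x\<close>, with radius proportional to its distance
  from \<open>\<xi>\<close>, whereas \<open>N\<close> and \<open>N'\<close> are fixed in advance;
  therefore \<open>C\<close> does not depend on \<open>x\<close>.\<close>

lemma quasiconformal_boundary_estimate:
  fixes D :: "'a::euclidean_space set" and f :: "'a \<Rightarrow> 'a"
  assumes dim: "DIM('a) \<ge> 2" and D: "open D" "connected D" "bounded D"
    and contf: "continuous_on (closure D) f" and "0 < \<alpha>" "0 \<le> L"
    and holder: "\<And>\<xi> \<eta>. \<xi> \<in> frontier D \<Longrightarrow> \<eta> \<in> frontier D \<Longrightarrow> dist (f \<xi>) (f \<eta>) \<le> L * dist \<xi> \<eta> powr \<alpha>"
    and qc: "quasiconformal_on D f" and up: "uniformly_perfect (frontier D)"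
  obtains C where "0 \<le> C" "\<And>x \<xi>. x \<in> D \<Longrightarrow> \<xi> \<in> frontier D \<Longrightarrow> ball x (dist x \<xi>) \<subseteq> D \<Longrightarrow>
      dist (f x) (f \<xi>) \<le> C * dist x \<xi> powr \<alpha>"
proof -
  obtain g where g: "homeomorphism D (f ` D) f g" and "open (f ` D)"
    using qc unfolding quasiconformal_on_def by auto
  obtain K :: real where K: "K \<ge> 1" and qcK0: "\<forall>\<Gamma>. (\<forall>c\<in>\<Gamma>. curve_in D c) \<longrightarrow>
      curve_modulus \<Gamma> / ennreal K \<le> curve_modulus (image_family f \<Gamma>) \<and>
      curve_modulus (image_family f \<Gamma>) \<le> ennreal K * curve_modulus \<Gamma>"
    using qc unfolding quasiconformal_on_def by (elim conjE exE)
  have qcK: "curve_modulus \<Gamma> / ennreal K \<le> curve_modulus (image_family f \<Gamma>) \<and>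
      curve_modulus (image_family f \<Gamma>) \<le> ennreal K * curve_modulus \<Gamma>"
    if "\<And>c. c \<in> \<Gamma> \<Longrightarrow> curve_in D c" for \<Gamma>
    using qcK0[rule_format, of \<Gamma>] that by blast
  obtain b where b: "uniformly_perfect_with b (frontier D)" using up unfolding uniformly_perfect_def by blast
  then have "b > 0" by (simp add: uniformly_perfect_with_def)
  have k: "DIM('a) - 1 > 0" using dim by simp
  obtain N where N: "N > 0" "K * modulus_const TYPE('a) / real N ^ (DIM('a) - 1) < sphere_const TYPE('a)"
    using exists_divide_power_less[OF sphere_const_pos k] by blast
  have "sphere_area TYPE('a) / b ^ (DIM('a) - 1) > 0" using sphere_area_pos[where 'a='a] \<open>b > 0\<close> by simp
  then obtain N' where N': "N' > 0" "K * modulus_const TYPE('a) / real N' ^ (DIM('a) - 1) < sphere_area TYPE('a) / b ^ (DIM('a) - 1)"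
    using exists_divide_power_less[OF _ k] by blast
  define C where "C = 2 * 2 ^ N' * (L * (2 * 2 ^ N) powr \<alpha>)"
  show thesis
  proof
    show "0 \<le> C" using \<open>0 \<le> L\<close> by (simp add: C_def)
    fix x \<xi> assume x: "x \<in> D" and \<xi>: "\<xi> \<in> frontier D" and ball: "ball x (dist x \<xi>) \<subseteq> D"
    have "x \<noteq> \<xi>" using x \<xi> D(1) by (auto simp: frontier_def interior_open)
    then have d: "0 < dist x \<xi>" by simp
    \<comment> \<open>The extra factor 2 makes \<open>dist x \<xi> * 2 ^ N\<close> strictly smaller
      than the radius of the trap.\<close>
    define \<rho> where "\<rho> = dist x \<xi> * (2 * 2 ^ N)"
    have \<rho>: "0 < \<rho>" "dist x \<xi> * 2 ^ N < \<rho>" using d by (simp_all add: \<rho>_def)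
    interpret boundary_trap D f g \<xi> \<rho> "L * \<rho> powr \<alpha>"
    proof
      fix \<zeta> assume z: "\<zeta> \<in> frontier D" "dist \<xi> \<zeta> \<le> \<rho>"
      have "dist (f \<xi>) (f \<zeta>) \<le> L * dist \<xi> \<zeta> powr \<alpha>" by (rule holder[OF \<xi> z(1)])
      also have "\<dots> \<le> L * \<rho> powr \<alpha>"
        using z(2) \<open>0 < \<alpha>\<close> \<open>0 \<le> L\<close> by (intro mult_left_mono powr_mono2) auto
      finally show "dist (f \<xi>) (f \<zeta>) \<le> L * \<rho> powr \<alpha>" .
    qed (use assms g \<open>open (f ` D)\<close> \<xi> \<rho> in auto)
    have "dist (f \<xi>) (f x) \<le> 2 * 2 ^ N' * (L * \<rho> powr \<alpha>)"
      by (rule boundary_distortion[OF qcK K b N N' x dist_commute ball d \<rho>(2)])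
    also have "\<rho> powr \<alpha> = dist x \<xi> powr \<alpha> * (2 * 2 ^ N) powr \<alpha>"
      unfolding \<rho>_def by (rule powr_mult)
    finally show "dist (f x) (f \<xi>) \<le> C * dist x \<xi> powr \<alpha>"
      by (simp add: C_def dist_commute mult_ac)
  qed
qed

text \<open>Subtracting the constant \<open>p\<close> keeps the coordinates harmonic, so
  \<open>M\<close> only has to bound the distance from a reference value. Summing over the
  coordinates gives the leading factor.\<close>

lemma harmonic_map_lipschitz_estimate:
  fixes f :: "real^'n \<Rightarrow> real^'n" and M r :: real
  assumes harm: "harmonic_map_on D f" and D: "cball ((1/2) *\<^sub>R (x + y)) r \<subseteq> D" and "r > 0" "M > 0"
    and M: "\<And>z. z \<in> cball ((1/2) *\<^sub>R (x + y)) r \<Longrightarrow> dist (f z) p \<le> M" and "dist x y \<le> 2 * r"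
  shows "dist (f x) (f y) \<le> CARD('n) * (M * (CARD('n) + 1) * dist x y / r)"
proof -
  have comp: "f x $ i - f y $ i \<le> M * (CARD('n) + 1) * dist x y / r"
    if D: "cball ((1/2) *\<^sub>R (x + y)) r \<subseteq> D" and xy: "dist x y \<le> 2 * r"
      and M: "\<And>z. z \<in> cball ((1/2) *\<^sub>R (x + y)) r \<Longrightarrow> dist (f z) p \<le> M" for i x y
  proof -
    have "harmonic_on D (\<lambda>z. f z $ i - p $ i)"
      using harm by (auto simp: harmonic_map_on_def intro: harmonic_on_diff_const)
    moreover have "\<bar>f z $ i - p $ i\<bar> \<le> M" if "z \<in> cball ((1/2) *\<^sub>R (x + y)) r" for z
      using M[OF that] component_le_norm_cart[of "f z - p" i] by (simp add: dist_norm)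
    ultimately show ?thesis
      using harmonic_diff_le[of D "\<lambda>z. f z $ i - p $ i" x y r M] D xy \<open>r > 0\<close> \<open>M > 0\<close>
      by (simp add: dist_norm add.commute)
  qed
  have "norm (f x - f y) \<le> (\<Sum>i\<in>UNIV. \<bar>(f x - f y) $ i\<bar>)" by (rule norm_le_l1_cart)
  also have "\<dots> \<le> (\<Sum>i\<in>(UNIV :: 'n set). M * (CARD('n) + 1) * dist x y / r)"
  proof (rule sum_mono)
    fix i
    have "f x $ i - f y $ i \<le> M * (CARD('n) + 1) * dist x y / r"
      by (rule comp[OF D \<open>dist x y \<le> 2 * r\<close> M])
    moreover have "f y $ i - f x $ i \<le> M * (CARD('n) + 1) * dist y x / r"
      using D \<open>dist x y \<le> 2 * r\<close> M by (intro comp) (auto simp: add.commute dist_commute)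
    ultimately show "\<bar>(f x - f y) $ i\<bar> \<le> M * (CARD('n) + 1) * dist x y / r"
      by (simp add: dist_commute abs_le_iff)
  qed
  finally show ?thesis by (simp add: dist_norm)
qed

text \<open>If |x - y| is at least a quarter of the distance \<delta> from x to the frontier, the
  detour over nearest frontier points is cheap. Otherwise the ball of radius \<delta> / 4 about the
  midpoint lies in \<open>D\<close>, the values there differ from \<open>f \<xi>\<close> by at most
  a multiple of \<delta>^\<alpha>, and harmonicity turns this into a Lipschitz constant of order
  \<delta>^(\<alpha>-1).\<close>

lemma harmonic_map_holder_on_closure:
  fixes D :: "(real^'n) set" and f :: "real^'n \<Rightarrow> real^'n"
  assumes D: "open D" "bounded D" and "0 < \<alpha>" "\<alpha> \<le> 1" and "0 < L" "0 \<le> C"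
    and holder: "\<And>\<xi> \<eta>. \<xi> \<in> frontier D \<Longrightarrow> \<eta> \<in> frontier D \<Longrightarrow> dist (f \<xi>) (f \<eta>) \<le> L * dist \<xi> \<eta> powr \<alpha>"
    and bdry: "\<And>x \<xi>. x \<in> D \<Longrightarrow> \<xi> \<in> frontier D \<Longrightarrow> ball x (dist x \<xi>) \<subseteq> D \<Longrightarrow>
      dist (f x) (f \<xi>) \<le> C * dist x \<xi> powr \<alpha>"
    and harm: "harmonic_map_on D f"
  shows "holder_on \<alpha> (closure D) f"
proof -
  let ?n = "real CARD('n)"
  let ?F = "frontier D"
  have pm: "a powr \<alpha> \<le> b powr \<alpha>" if "0 \<le> a" "a \<le> b" for a b :: real
    using that \<open>0 < \<alpha>\<close> by (intro powr_mono2) auto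
  have near: "\<exists>\<xi>\<in>?F. infdist x ?F = dist x \<xi> \<and> dist (f x) (f \<xi>) \<le> C * dist x \<xi> powr \<alpha>"
    if x: "x \<in> closure D" for x
  proof (cases "x \<in> D")
    case True
    then show ?thesis using exists_nearest_frontier_point[OF D True] bdry by metis
  next
    case False
    then have "x \<in> ?F" using x D(1) by (simp add: frontier_def interior_open)
    then show ?thesis by (intro bexI[of _ x]) auto
  qed
  \<comment> \<open>With h = |x - y|, the points x and y are within 4 h and 5 h of their nearest
    frontier points in the first case, and these are at most 4 h + h + 5 h = 10 h apart.\<close>
  define C1 where "C1 = (2 * C + L) * 10 powr \<alpha>"
  \<comment> \<open>In the second case a point of the ball has its nearest frontier point within 3
    \<delta> / 2, and that point is within 3 \<delta> of \<open>\<xi>\<close>; the 4 comes from the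
    radius \<delta> / 4.\<close>
  define C2 where "C2 = ?n * ((C + L) * 3 powr \<alpha> * (?n + 1) * 4)"
  have C12: "0 \<le> C1" "0 \<le> C2" using \<open>0 < L\<close> \<open>0 \<le> C\<close> by (simp_all add: C1_def C2_def)
  have "norm (f x - f y) \<le> (C1 + C2) * norm (x - y) powr \<alpha>" if x: "x \<in> closure D" and y: "y \<in> closure D" for x y
  proof -
    define h where "h = dist x y"
    have h: "0 \<le> h" by (simp add: h_def)
    obtain \<xi> where \<xi>: "\<xi> \<in> ?F" "infdist x ?F = dist x \<xi>" "dist (f x) (f \<xi>) \<le> C * dist x \<xi> powr \<alpha>"
      using near[OF x] by blast
    obtain \<eta> where \<eta>: "\<eta> \<in> ?F" "infdist y ?F = dist y \<eta>" "dist (f y) (f \<eta>) \<le> C * dist y \<eta> powr \<alpha>"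
      using near[OF y] by blast
    show ?thesis
    proof (cases "dist x \<xi> \<le> 4 * h")
      case True
      have "dist y \<eta> \<le> dist x \<xi> + h"
        using infdist_triangle[of y ?F x] \<xi>(2) \<eta>(2) by (simp add: h_def dist_commute)
      then have le: "dist x \<xi> \<le> 10 * h" "dist y \<eta> \<le> 10 * h" using True h by auto
      have "dist \<xi> \<eta> \<le> dist \<xi> x + dist x y + dist y \<eta>"
        using dist_triangle[of \<xi> \<eta> x] dist_triangle[of x \<eta> y] by linarith
      then have le3: "dist \<xi> \<eta> \<le> 10 * h"
        using True \<open>dist y \<eta> \<le> dist x \<xi> + h\<close> h by (simp add: h_def dist_commute)
      have "dist (f x) (f y) \<le> dist (f x) (f \<xi>) + dist (f \<xi>) (f \<eta>) + dist (f y) (f \<eta>)"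
        using dist_triangle[of "f x" "f y" "f \<xi>"] dist_triangle[of "f \<xi>" "f y" "f \<eta>"]
        by (simp add: dist_commute)
      also have "\<dots> \<le> C * (10 * h) powr \<alpha> + L * (10 * h) powr \<alpha> + C * (10 * h) powr \<alpha>"
      proof (intro add_mono)
        show "dist (f x) (f \<xi>) \<le> C * (10 * h) powr \<alpha>"
          by (rule order.trans[OF \<xi>(3) mult_left_mono[OF pm[OF _ le(1)] \<open>0 \<le> C\<close>]]) simp
        show "dist (f y) (f \<eta>) \<le> C * (10 * h) powr \<alpha>"
          by (rule order.trans[OF \<eta>(3) mult_left_mono[OF pm[OF _ le(2)] \<open>0 \<le> C\<close>]]) simp
        show "dist (f \<xi>) (f \<eta>) \<le> L * (10 * h) powr \<alpha>"
          by (rule order.trans[OF holder[OF \<xi>(1) \<eta>(1)] mult_left_mono[OF pm[OF _ le3]]])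
            (use \<open>0 < L\<close> in auto)
      qed
      also have "\<dots> = C1 * h powr \<alpha>" using h by (simp add: C1_def powr_mult algebra_simps)
      also have "\<dots> \<le> (C1 + C2) * h powr \<alpha>" using C12 by (intro mult_right_mono) auto
      finally show ?thesis by (simp add: h_def dist_norm)
    next
      case False
      define \<delta> where "\<delta> = dist x \<xi>"
      have \<delta>: "4 * h < \<delta>" "0 < \<delta>" using False h by (auto simp: \<delta>_def)
      have "x \<notin> ?F" using \<delta>(2) \<xi>(2) by (auto simp: \<delta>_def)
      then have xD: "x \<in> D" using x D(1) by (simp add: frontier_def interior_open)
      have ball: "ball x \<delta> \<subseteq> D"
      proof -
        obtain \<xi>' where "infdist x ?F = dist x \<xi>'" "ball x (dist x \<xi>') \<subseteq> D"
          using exists_nearest_frontier_point[OF D xD] by metis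
        then show ?thesis using \<xi>(2) by (simp add: \<delta>_def)
      qed
      define M where "M = (C + L) * (3 * \<delta>) powr \<alpha>"
      have "M > 0" using \<open>0 < L\<close> \<open>0 \<le> C\<close> \<delta>(2) by (simp add: M_def)
      have zx: "dist z x \<le> \<delta> / 2" if "z \<in> cball ((1/2) *\<^sub>R (x + y)) (\<delta> / 4)" for z
      proof -
        have "x - (1/2) *\<^sub>R (x + y) = (1/2) *\<^sub>R (x - y)" by (simp add: algebra_simps flip: scaleR_add_left)
        then have "dist x ((1/2) *\<^sub>R (x + y)) = h / 2" by (simp add: h_def dist_norm)
        then show ?thesis using that dist_triangle[of z x "(1/2) *\<^sub>R (x + y)"] \<delta>
          by (simp add: dist_commute)
      qed
      have zD: "z \<in> D" if "z \<in> cball ((1/2) *\<^sub>R (x + y)) (\<delta> / 4)" for z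
        using zx[OF that] ball \<delta>(2) by (auto simp: dist_commute subset_iff)
      have bound: "dist (f z) (f \<xi>) \<le> M" if z: "z \<in> cball ((1/2) *\<^sub>R (x + y)) (\<delta> / 4)" for z
      proof -
        obtain \<zeta> where \<zeta>: "\<zeta> \<in> ?F" "infdist z ?F = dist z \<zeta>" "dist (f z) (f \<zeta>) \<le> C * dist z \<zeta> powr \<alpha>"
          using near[of z] zD[OF z] closure_subset by blast
        have 1: "dist z \<zeta> \<le> \<delta> + \<delta> / 2"
          using infdist_triangle[of z ?F x] \<xi>(2) \<zeta>(2) zx[OF z] by (simp add: \<delta>_def)
        have 2: "dist \<zeta> \<xi> \<le> 3 * \<delta>"
          using dist_triangle[of \<zeta> \<xi> z] dist_triangle[of z \<xi> x] 1 zx[OF z] by (simp add: \<delta>_def dist_commute)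
        have 1: "dist z \<zeta> \<le> 3 * \<delta>" using 1 \<delta>(2) by simp
        have "dist (f z) (f \<xi>) \<le> dist (f z) (f \<zeta>) + dist (f \<zeta>) (f \<xi>)" by (rule dist_triangle)
        also have "\<dots> \<le> C * (3 * \<delta>) powr \<alpha> + L * (3 * \<delta>) powr \<alpha>"
        proof (intro add_mono)
          show "dist (f z) (f \<zeta>) \<le> C * (3 * \<delta>) powr \<alpha>"
            by (rule order.trans[OF \<zeta>(3) mult_left_mono[OF pm[OF _ 1] \<open>0 \<le> C\<close>]]) simp
          show "dist (f \<zeta>) (f \<xi>) \<le> L * (3 * \<delta>) powr \<alpha>"
            by (rule order.trans[OF holder[OF \<zeta>(1) \<xi>(1)] mult_left_mono[OF pm[OF _ 2]]])
              (use \<open>0 < L\<close> in auto)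
        qed
        finally show ?thesis by (simp add: M_def algebra_simps)
      qed
      have "dist (f x) (f y) \<le> ?n * (M * (?n + 1) * h / (\<delta> / 4))"
      proof -
        have "cball ((1/2) *\<^sub>R (x + y)) (\<delta> / 4) \<subseteq> D" using zD by blast
        moreover have "0 < \<delta> / 4" "dist x y \<le> 2 * (\<delta> / 4)" using \<delta> h by (simp_all add: h_def)
        ultimately have "dist (f x) (f y) \<le> CARD('n) * (M * (CARD('n) + 1) * dist x y / (\<delta> / 4))"
          by (intro harmonic_map_lipschitz_estimate[OF harm _ _ \<open>M > 0\<close> bound])
        then show ?thesis by (simp add: h_def add.commute)
      qed
      also have "\<dots> = C2 * (\<delta> powr \<alpha> * (h / \<delta>))"
        using \<delta>(2) by (simp add: C2_def M_def powr_mult)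
      \<comment> \<open>Here \<alpha> \<le> 1 enters: since h / \<delta> < 1, the quotient is at
        most its power with exponent \<alpha>.\<close>
      also have "\<delta> powr \<alpha> * (h / \<delta>) \<le> h powr \<alpha>"
      proof (cases "h = 0")
        case False
        then have "h > 0" using h by simp
        have "h / \<delta> = (h / \<delta>) powr 1" using \<open>h > 0\<close> \<delta>(2) by simp
        also have "\<dots> \<le> (h / \<delta>) powr \<alpha>"
          using \<open>h > 0\<close> \<delta> \<open>\<alpha> \<le> 1\<close> by (intro powr_mono') auto
        finally have "\<delta> powr \<alpha> * (h / \<delta>) \<le> \<delta> powr \<alpha> * (h / \<delta>) powr \<alpha>" by (rule mult_left_mono) simp
        also have "\<dots> = h powr \<alpha>" using \<open>h > 0\<close> \<delta>(2) by (simp add: powr_divide)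
        finally show ?thesis .
      qed simp
      then have "C2 * (\<delta> powr \<alpha> * (h / \<delta>)) \<le> C2 * h powr \<alpha>" using C12 by (intro mult_left_mono) auto
      also have "\<dots> \<le> (C1 + C2) * h powr \<alpha>" using C12 by (intro mult_right_mono) auto
      finally show ?thesis by (simp add: h_def dist_norm)
    qed
  qed
  then show ?thesis unfolding holder_on_def by blast
qed

theorem corollary2p2:
  fixes D :: "(real^'n) set" and f :: "real^'n \<Rightarrow> real^'n" and \<alpha> :: real
  assumes "CARD('n) \<ge> 3"
    and "open D" and "connected D" and "D \<noteq> {}" and "bounded D"
    and "0 < \<alpha>" and "\<alpha> \<le> 1"
    and "continuous_on (closure D) f"
    and "holder_on \<alpha> (frontier D) f"
    and "harmonic_map_on D f"
    and "quasiconformal_on D f"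
    and "uniformly_perfect (frontier D)"
  shows "holder_on \<alpha> (closure D) f"
proof -
  obtain L0 where L0: "\<And>x y. x \<in> frontier D \<Longrightarrow> y \<in> frontier D \<Longrightarrow> norm (f x - f y) \<le> L0 * norm (x - y) powr \<alpha>"
    using assms(9) unfolding holder_on_def by blast
  \<comment> \<open>The given Hoelder constant may be nonpositive; raising it to at least 1 makes
    the bound \<open>M\<close> in the harmonic estimate positive.\<close>
  define L where "L = max L0 1"
  have "L > 0" by (simp add: L_def)
  have L: "dist (f x) (f y) \<le> L * dist x y powr \<alpha>" if "x \<in> frontier D" "y \<in> frontier D" for x y
  proof -
    have "L0 * norm (x - y) powr \<alpha> \<le> L * norm (x - y) powr \<alpha>" by (intro mult_right_mono) (auto simp: L_def)
    then show ?thesis using L0[OF that] by (simp add: dist_norm)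
  qed
  have dim: "DIM(real^'n) \<ge> 2" using assms(1) by simp
  obtain C where "0 \<le> C" "\<And>x \<xi>. x \<in> D \<Longrightarrow> \<xi> \<in> frontier D \<Longrightarrow> ball x (dist x \<xi>) \<subseteq> D \<Longrightarrow>
      dist (f x) (f \<xi>) \<le> C * dist x \<xi> powr \<alpha>"
    using quasiconformal_boundary_estimate[OF dim assms(2,3,5,8,6) less_imp_le[OF \<open>L > 0\<close>] L assms(11,12)]
    by blast
  then show ?thesis
    using harmonic_map_holder_on_closure[OF assms(2,5,6,7) \<open>L > 0\<close> _ L _ assms(10)] by blast
qed

end
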